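(* The figure-eight knot complement has a special finite-sheeted cover of degree $20$.
   Context: The figure-eight knot complement is the complement of the figure-eight knot in $S^3$; its fundamental group is isomorphic, via the holonomy representation of its hyperbolic structure, to the index $12$ subgroup $$\Gamma_8=\left\langle \begin{pmatrix}1&1\\0&1\end{pmatrix},\begin{pmatrix}1&0\\ \frac{1+\sqrt{-3}}{2}&1\end{pmatrix}\right\rangle$$ of $\mathrm{PSL}(2,\mathcal{O}_3)$, where $\mathcal{O}_3=\mathbb{Z}[\frac{1+\sqrt{-3}}{2}]$. A group is special if it embeds in a right-angled Artin group (A-special) or in a right-angled Coxeter group (C-special); every right-angled Artin group is a finite-index subgroup of a right-angled Coxeter group, so every special group embeds in a right-angled Coxeter group. Here a right-angled Coxeter group is a group with a presentation $\langle r\in V : r^2=1,\ (rs)^2=1 \text{ for } \{r,s\}\in E\rangle$, and a right-angled Artin group is a group with a presentation $\langle r\in V : rs=sr \text{ for } \{r,s\}\in E\rangle$, for a finite simple graph $(V,E)$. A (connected) cover is special if its fundamental group is special. *)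

theory Defs
  imports "HOL-Analysis.Analysis" "HOL-Algebra.Group"
begin

section \<open>Group presentations and special groups\<close>

text \<open>
  The letter \<open>(x, True)\<close> stands for the generator \<open>x\<close> and \<open>(x, False)\<close> for its formal inverse.
  Relators are words.
\<close>

type_synonym 'v word = "('v \<times> bool) list"

definition words :: "'v set \<Rightarrow> 'v word set"
  where "words V = lists (V \<times> UNIV)"

inductive word_eq :: "'v set \<Rightarrow> 'v word set \<Rightarrow> 'v word \<Rightarrow> 'v word \<Rightarrow> bool"
  for V :: "'v set" and R :: "'v word set"
  where
    refl: "w \<in> words V \<Longrightarrow> word_eq V R w w"
  | sym: "word_eq V R u v \<Longrightarrow> word_eq V R v u"
  | trans: "word_eq V R u v \<Longrightarrow> word_eq V R v w \<Longrightarrow> word_eq V R u w"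
  | cancel: "u \<in> words V \<Longrightarrow> v \<in> words V \<Longrightarrow> x \<in> V \<Longrightarrow>
      word_eq V R (u @ [(x, b), (x, \<not> b)] @ v) (u @ v)"
  | relator: "u \<in> words V \<Longrightarrow> v \<in> words V \<Longrightarrow> r \<in> R \<Longrightarrow> r \<in> words V \<Longrightarrow>
      word_eq V R (u @ r @ v) (u @ v)"

definition word_rel :: "'v set \<Rightarrow> 'v word set \<Rightarrow> ('v word \<times> 'v word) set"
  where "word_rel V R = {(u, v). word_eq V R u v}"

definition presented_group :: "'v set \<Rightarrow> 'v word set \<Rightarrow> 'v word set monoid"
  where "presented_group V R =
    \<lparr>carrier = words V // word_rel V R,
     mult = (\<lambda>A B. \<Union>u\<in>A. \<Union>v\<in>B. word_rel V R `` {u @ v}),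
     one = word_rel V R `` {[]}\<rparr>"

definition finite_simple_graph :: "'v set \<Rightarrow> 'v set set \<Rightarrow> bool"
  where "finite_simple_graph V E \<longleftrightarrow> finite V \<and> (\<forall>e\<in>E. e \<subseteq> V \<and> card e = 2)"

definition raag :: "'v set \<Rightarrow> 'v set set \<Rightarrow> 'v word set monoid"
  where "raag V E =
    presented_group V {[(r, True), (s, True), (r, False), (s, False)] | r s. {r, s} \<in> E}"

definition racg :: "'v set \<Rightarrow> 'v set set \<Rightarrow> 'v word set monoid"
  where "racg V E =
    presented_group V
      ({[(r, True), (r, True)] | r. r \<in> V} \<union>
       {[(r, True), (s, True), (r, True), (s, True)] | r s. {r, s} \<in> E})"

text \<open>
  The graphs are finite, so taking the vertices to be natural numbers loses no generality.
\<close>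

definition A_special :: "('g, 'm) monoid_scheme \<Rightarrow> bool"
  where "A_special G \<longleftrightarrow>
    (\<exists>(V :: nat set) E f. finite_simple_graph V E \<and> f \<in> mon G (raag V E))"

definition C_special :: "('g, 'm) monoid_scheme \<Rightarrow> bool"
  where "C_special G \<longleftrightarrow>
    (\<exists>(V :: nat set) E f. finite_simple_graph V E \<and> f \<in> mon G (racg V E))"

definition special_group :: "('g, 'm) monoid_scheme \<Rightarrow> bool"
  where "special_group G \<longleftrightarrow> A_special G \<or> C_special G"


section \<open>The fundamental group\<close>

definition loops_at :: "'a topology \<Rightarrow> 'a \<Rightarrow> (real \<Rightarrow> 'a) set"
  where "loops_at X x = {g. pathin X g \<and> g 0 = x \<and> g 1 = x}"

definition loop_homotopy :: "'a topology \<Rightarrow> 'a \<Rightarrow> ((real \<Rightarrow> 'a) \<times> (real \<Rightarrow> 'a)) set"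
  where "loop_homotopy X x =
    {(f, g). f \<in> loops_at X x \<and> g \<in> loops_at X x \<and>
       homotopic_with (\<lambda>h. h 0 = x \<and> h 1 = x) (top_of_set {0..1}) X f g}"

text \<open>
  This is \<^const>\<open>joinpaths\<close> without its sort constraint: here the points belong to an
  abstract \<open>topology\<close>, not to a type of class \<open>topological_space\<close>.
\<close>

definition loop_join :: "(real \<Rightarrow> 'a) \<Rightarrow> (real \<Rightarrow> 'a) \<Rightarrow> real \<Rightarrow> 'a"
  where "loop_join f g = (\<lambda>t. if t \<le> 1/2 then f (2 * t) else g (2 * t - 1))"

definition fundamental_group :: "'a topology \<Rightarrow> 'a \<Rightarrow> (real \<Rightarrow> 'a) set monoid"
  where "fundamental_group X x =
    \<lparr>carrier = loops_at X x // loop_homotopy X x,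
     mult = (\<lambda>A B. \<Union>f\<in>A. \<Union>g\<in>B. loop_homotopy X x `` {loop_join f g}),
     one = loop_homotopy X x `` {\<lambda>_. x}\<rparr>"


section \<open>Covers\<close>

text \<open>
  The counterpart of \<^const>\<open>covering_space\<close> for abstract topologies.
\<close>

definition covering_map :: "'a topology \<Rightarrow> 'b topology \<Rightarrow> ('a \<Rightarrow> 'b) \<Rightarrow> bool"
  where "covering_map Y X p \<longleftrightarrow>
    continuous_map Y X p \<and> p ` topspace Y = topspace X \<and>
    (\<forall>x\<in>topspace X. \<exists>T. x \<in> T \<and> openin X T \<and>
      (\<exists>\<V>. \<Union>\<V> = {y \<in> topspace Y. p y \<in> T} \<and>
        (\<forall>U\<in>\<V>. openin Y U) \<and> pairwise disjnt \<V> \<and>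
        (\<forall>U\<in>\<V>. homeomorphic_map (subtopology Y U) (subtopology X T) p)))"

text \<open>
  If \<open>X\<close> lives on a type \<open>'b\<close>, the points of an \<open>n\<close>-sheeted cover of \<open>X\<close> are in bijection with
  \<open>topspace X \<times> {..<n}\<close>; so up to homeomorphism all finite-sheeted covers are topologies on
  \<open>'b \<times> nat\<close> (not the product topology in general).
\<close>

definition covering_of_degree :: "nat \<Rightarrow> 'a topology \<Rightarrow> 'b topology \<Rightarrow> ('a \<Rightarrow> 'b) \<Rightarrow> bool"
  where "covering_of_degree n Y X p \<longleftrightarrow>
    covering_map Y X p \<and>
    (\<forall>x\<in>topspace X. finite {y \<in> topspace Y. p y = x} \<and> card {y \<in> topspace Y. p y = x} = n)"

definition special_cover :: "'a topology \<Rightarrow> 'b topology \<Rightarrow> ('a \<Rightarrow> 'b) \<Rightarrow> bool"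
  where "special_cover Y X p \<longleftrightarrow>
    covering_map Y X p \<and> connected_space Y \<and>
    (\<forall>y\<in>topspace Y. special_group (fundamental_group Y y))"


section \<open>The figure-eight knot in the 3-sphere\<close>

text \<open>The norm on these products is the Euclidean one.\<close>

type_synonym R3 = "real \<times> real \<times> real"
type_synonym R4 = "R3 \<times> real"

definition S3 :: "R4 set"
  where "S3 = sphere 0 1"

text \<open>Inverse of stereographic projection from the north pole \<open>(0, 1)\<close>.\<close>

definition inv_stereographic :: "R3 \<Rightarrow> R4"
  where "inv_stereographic x = ((2 / (x \<bullet> x + 1)) *\<^sub>R x, (x \<bullet> x - 1) / (x \<bullet> x + 1))"

definition closed_polygon :: "'a::real_vector list \<Rightarrow> 'a set"
  where "closed_polygon vs =
    (\<Union>i<length vs. closed_segment (vs ! i) (vs ! (Suc i mod length vs)))"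

text \<open>
  A 6 by 6 grid diagram: the edges in direction \<open>y\<close> lie at height \<open>1\<close>, those in direction
  \<open>x\<close> at height \<open>0\<close>, and vertical edges join them over the corners. The projection to the
  \<open>xy\<close>-plane has exactly four crossings, at \<open>(1,3)\<close>, \<open>(2,2)\<close>, \<open>(4,1)\<close> and \<open>(3,4)\<close>.
  Following the list, one passes under \<open>(1,3)\<close>, over \<open>(2,2)\<close>, under \<open>(4,1)\<close>, over \<open>(3,4)\<close>,
  under \<open>(2,2)\<close>, over \<open>(1,3)\<close>, under \<open>(3,4)\<close> and over \<open>(4,1)\<close>.
  So the diagram is alternating; it is also
  reduced, so it has minimal crossing number four and represents the figure-eight knot, the
  only knot with that crossing number. The knot is amphichiral, so the orientation of \<open>R3\<close>
  is immaterial.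
\<close>

definition figure_eight_polygon :: "R3 set"
  where "figure_eight_polygon = closed_polygon
    [(0,0,1), (0,3,1), (0,3,0), (2,3,0),
     (2,3,1), (2,1,1), (2,1,0), (5,1,0),
     (5,1,1), (5,5,1), (5,5,0), (3,5,0),
     (3,5,1), (3,2,1), (3,2,0), (1,2,0),
     (1,2,1), (1,4,1), (1,4,0), (4,4,0),
     (4,4,1), (4,0,1), (4,0,0), (0,0,0)]"

definition ambient_isotopic_S3 :: "R4 set \<Rightarrow> R4 set \<Rightarrow> bool"
  where "ambient_isotopic_S3 K L \<longleftrightarrow>
    (\<exists>H :: real \<times> R4 \<Rightarrow> R4.
       continuous_on ({0..1} \<times> S3) H \<and>
       (\<forall>t\<in>{0..1}. \<exists>g. homeomorphism S3 S3 (\<lambda>x. H (t, x)) g) \<and>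
       (\<forall>x\<in>S3. H (0, x) = x) \<and>
       (\<lambda>x. H (1, x)) ` K = L)"

definition figure_eight_knot :: "R4 set \<Rightarrow> bool"
  where "figure_eight_knot K \<longleftrightarrow>
    ambient_isotopic_S3 (inv_stereographic ` figure_eight_polygon) K"

end

theory Submission
  imports Defs "HOL-Library.Nat_Bijection" "HOL-Algebra.Coset"
begin

text \<open>
  The knot complement is tiled by two regular ideal tetrahedra, so its group \<open>G\<close> acts
  freely on the tetrahedra of the tessellation of type \<open>{3,3,6}\<close> with named faces and embeds in
  \<open>T \<rtimes> S\<^sub>4\<close>, where \<open>T\<close> is the Coxeter group of the reflections \<open>s\<^sub>1, \<dots>, s\<^sub>4\<close> in the faces of one
  tetrahedron (all products \<open>s\<^sub>a s\<^sub>b\<close> have order 3). Let \<open>W\<close> be the right-angled Coxeter group on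
  the pairs from \<open>{0, \<dots>, 4}\<close>, where two pairs commute if they meet. Sending \<open>s\<^sub>a\<close> to the generator
  \<open>{0, a}\<close> followed by the transposition \<open>(0 a)\<close> gives \<open>T \<rtimes> S\<^sub>4 \<rightarrow> W \<rtimes> S\<^sub>5\<close>. It is injective
  on \<open>T\<close>: \<open>W \<rtimes> S\<^sub>5\<close> acts on \<open>\<int>\<^sup>5\<close>, and modulo \<open>e\<^sub>0\<close> the restriction to \<open>T\<close> is Tits' faithful
  representation. The image of \<open>G\<close> in \<open>S\<^sub>5\<close> is dihedral of order 10, so its kernel, and hence that
  of a map onto the dicyclic group of order 20, embeds in \<open>W\<close>.

  The topology enters through a cover of the complement by seven simply connected open sets: the part above
  the diagram, the part below it, a neighbourhood of infinity and a box at each crossing. The faces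
  of the diagram and the relations at the crossings give a \<open>G\<close>-valued cocycle. Its parallel
  sections define the cover of degree 20 and a holonomy on loops; holonomy is injective on homotopy
  classes, which is the only part of van Kampen's theorem that is needed.
\<close>

section \<open>Group presentations\<close>

text \<open>The image chosen for \<open>s_a\<close> respects the braid relations: when the
  transpositions are moved to the right, the two sides of the relation between \<open>s_a\<close>
  and \<open>s_b\<close> become the products of the walls \<open>{0, a}\<close>,
  \<open>{a, b}\<close>, \<open>{0, b}\<close> in opposite orders, followed by the same
  transposition \<open>(a b)\<close>. The three sides of a triangle meet pairwise, hence commute.

  No semidirect product is formed. Its elements are words with a running permutation that is updated
  letter by letter, and injectivity is read off from linear actions on integer vectors.

  The order 20 arises as follows. The two generators go to reflections of a pentagon, and to
  \<open>1\<close> and \<open>-1\<close> in \<open>\<int>/4\<close>. The parities agree, so the pair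
  lands in the fibre product over \<open>\<int>/2\<close>, which has order
  \<open>10 * 4 / 2\<close>.

  The fundamental group of the complement is not computed either. Loops through the faces give a
  homomorphism from \<open>G\<close> to it, holonomy leads in the other direction, and the class of
  a loop is recovered from its holonomy by means of that homomorphism.\<close>

lemma words_Nil [simp]: "[] \<in> words V"
  and words_Cons [simp]: "l # w \<in> words V \<longleftrightarrow> fst l \<in> V \<and> w \<in> words V"
  and words_append [simp]: "u @ v \<in> words V \<longleftrightarrow> u \<in> words V \<and> v \<in> words V"
  by (cases l; auto simp: words_def)+

lemma word_eq_words: "word_eq V R u v \<Longrightarrow> u \<in> words V \<and> v \<in> words V"
  by (induction rule: word_eq.induct) auto

lemma word_eq_cong:
  assumes "word_eq V R u v" "p \<in> words V" "q \<in> words V"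
  shows "word_eq V R (p @ u @ q) (p @ v @ q)"
  using assms
proof (induction rule: word_eq.induct)
  case (cancel u v x b)
  then show ?case using word_eq.cancel[of "p @ u" V "v @ q" x R b] by simp
next
  case (relator u v r)
  then show ?case using word_eq.relator[of "p @ u" V "v @ q" r R] by simp
qed (auto intro: word_eq.refl word_eq.sym word_eq.trans)

lemma word_eq_append:
  assumes "word_eq V R u u'" "word_eq V R v v'"
  shows "word_eq V R (u @ v) (u' @ v')"
proof -
  have "word_eq V R (u @ v) (u' @ v)"
    using word_eq_cong[OF assms(1), of "[]" v] word_eq_words[OF assms(2)] by simp
  moreover have "word_eq V R (u' @ v) (u' @ v')"
    using word_eq_cong[OF assms(2), of "u'" "[]"] word_eq_words[OF assms(1)] by simp
  ultimately show ?thesis by (rule word_eq.trans)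
qed

definition winv :: "'v word \<Rightarrow> 'v word"
  where "winv w = rev (map (\<lambda>(x, b). (x, \<not> b)) w)"

lemma winv_simps [simp]:
  "winv [] = []" "winv ((x, b) # w) = winv w @ [(x, \<not> b)]"
  "winv (u @ v) = winv v @ winv u" "winv (winv w) = w"
  by (auto simp: winv_def rev_map comp_def case_prod_unfold)

lemma winv_words [simp]: "winv w \<in> words V \<longleftrightarrow> w \<in> words V"
  by (induction w) auto

lemma word_eq_winv_right: "w \<in> words V \<Longrightarrow> word_eq V R (w @ winv w) []"
proof (induction w)
  case (Cons l w)
  obtain x b where l: "l = (x, b)" by fastforce
  have "word_eq V R ([(x, b)] @ (w @ winv w) @ [(x, \<not> b)]) ([(x, b)] @ [] @ [(x, \<not> b)])"
    using Cons l by (intro word_eq_cong) auto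
  moreover have "word_eq V R ([] @ [(x, b), (x, \<not> b)] @ []) ([] @ [])"
    using Cons l by (intro word_eq.cancel) auto
  ultimately show ?case using l by (auto intro: word_eq.trans)
qed (auto intro: word_eq.refl)

lemma word_eq_winv_left: "w \<in> words V \<Longrightarrow> word_eq V R (winv w @ w) []"
  using word_eq_winv_right[of "winv w" V R] by simp

lemma word_eq_winv:
  assumes "word_eq V R u v" shows "word_eq V R (winv u) (winv v)"
proof -
  note w = word_eq_words[OF assms]
  have "word_eq V R (winv u) (winv u @ v @ winv v)"
    using word_eq_append[OF word_eq.refl[of "winv u" V R] word_eq_winv_right[of v V R]] w
    by (auto intro: word_eq.sym)
  moreover have "word_eq V R (winv u @ v @ winv v) (winv u @ u @ winv v)"
    using word_eq_cong[OF word_eq.sym[OF assms], of "winv u" "winv v"] w by simp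
  moreover have "word_eq V R ((winv u @ u) @ winv v) ([] @ winv v)"
    using w by (intro word_eq_append word_eq_winv_left word_eq.refl) auto
  ultimately show ?thesis by (auto intro: word_eq.trans)
qed

lemma word_eq_Nil_iff:
  assumes "u \<in> words V" "v \<in> words V"
  shows "word_eq V R (winv u @ v) [] \<longleftrightarrow> word_eq V R u v"
proof
  assume *: "word_eq V R (winv u @ v) []"
  have "word_eq V R ([] @ v) ((u @ winv u) @ v)"
    using assms by (intro word_eq_append word_eq.sym[OF word_eq_winv_right] word_eq.refl) auto
  moreover have "word_eq V R (u @ (winv u @ v)) (u @ [])"
    using assms * by (intro word_eq_append word_eq.refl) auto
  ultimately have "word_eq V R v u" by (auto intro: word_eq.trans)
  then show "word_eq V R u v" by (rule word_eq.sym)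
next
  assume "word_eq V R u v"
  then have "word_eq V R (winv u @ v) (winv u @ u)"
    using assms by (intro word_eq_append word_eq.refl) (auto intro: word_eq.sym)
  then show "word_eq V R (winv u @ v) []"
    using word_eq_winv_left[OF assms(1)] by (rule word_eq.trans)
qed

lemma word_eq_conjugate:
  assumes "word_eq V R (winv c @ w @ c) []" "c \<in> words V" "w \<in> words V"
  shows "word_eq V R w []"
proof -
  have "word_eq V R c (w @ c)"
    using assms word_eq_Nil_iff[of c V "w @ c" R] by simp
  then have "word_eq V R ((w @ c) @ winv c) (c @ winv c)"
    using assms by (intro word_eq_append word_eq.refl) (auto intro: word_eq.sym)
  moreover have "word_eq V R (w @ (c @ winv c)) (w @ [])"
    using assms by (intro word_eq_append word_eq.refl word_eq_winv_right) auto
  moreover have "word_eq V R (c @ winv c) []"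
    using assms by (intro word_eq_winv_right) auto
  ultimately show ?thesis by (metis append.assoc append_Nil2 word_eq.sym word_eq.trans)
qed

fun free_reduce :: "'v word \<Rightarrow> 'v word"
  where
    "free_reduce [] = []"
  | "free_reduce ((x, b) # w) = (case free_reduce w of
       [] \<Rightarrow> [(x, b)]
     | (y, c) # v \<Rightarrow> if x = y \<and> b \<noteq> c then v else (x, b) # (y, c) # v)"

lemma word_eq_free_reduce: "w \<in> words V \<Longrightarrow> word_eq V R w (free_reduce w)"
proof (induction w rule: free_reduce.induct)
  case (2 x b w)
  have 1: "word_eq V R ([(x, b)] @ w) ([(x, b)] @ free_reduce w)"
    using 2 by (intro word_eq_append word_eq.refl) auto
  show ?case
  proof (cases "free_reduce w")
    case (Cons l v)
    obtain y c where l: "l = (y, c)" by fastforce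
    have v: "v \<in> words V" using word_eq_words[OF 2(1)] 2(2) Cons by auto
    show ?thesis
    proof (cases "x = y \<and> b \<noteq> c")
      case True
      then have "word_eq V R ([] @ [(x, b), (x, \<not> b)] @ v) ([] @ v)"
        using 2 v by (intro word_eq.cancel) auto
      moreover have "l = (x, \<not> b)" using True l by auto
      ultimately show ?thesis using 1 True Cons l by (auto intro: word_eq.trans)
    qed (use 1 Cons l in auto)
  qed (use 1 in auto)
qed (auto intro: word_eq.refl)

section \<open>Classes of words and the group that they form\<close>

abbreviation wcls :: "'v set \<Rightarrow> 'v word set \<Rightarrow> 'v word \<Rightarrow> 'v word set"
  where "wcls V R w \<equiv> word_rel V R `` {w}"

lemma word_rel_iff [simp]: "(u, v) \<in> word_rel V R \<longleftrightarrow> word_eq V R u v"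
  by (simp add: word_rel_def)

lemma equiv_word_rel: "equiv (words V) (word_rel V R)"
proof (rule equivI)
  show "word_rel V R \<subseteq> words V \<times> words V"
    using word_eq_words by (fastforce simp: word_rel_def)
  show "refl_on (words V) (word_rel V R)"
    by (rule refl_onI) (simp add: word_rel_def word_eq.refl)
  show "sym (word_rel V R)"
    by (rule symI) (simp add: word_rel_def word_eq.sym)
  show "trans (word_rel V R)"
    unfolding word_rel_def by (rule transI) (auto intro: word_eq.trans)
qed

lemma wcls_eq_iff:
  "u \<in> words V \<Longrightarrow> v \<in> words V \<Longrightarrow> wcls V R u = wcls V R v \<longleftrightarrow> word_eq V R u v"
  by (simp only: eq_equiv_class_iff[OF equiv_word_rel]) (simp add: word_rel_def)

lemma carrier_presented_group: "carrier (presented_group V R) = wcls V R ` words V"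
  by (auto simp: presented_group_def quotient_def)

lemma wcls_in_carrier [simp]: "w \<in> words V \<Longrightarrow> wcls V R w \<in> carrier (presented_group V R)"
  by (auto simp: carrier_presented_group)

lemma one_presented_group: "\<one>\<^bsub>presented_group V R\<^esub> = wcls V R []"
  by (simp add: presented_group_def)

lemma mult_presented_group:
  assumes "u \<in> words V" "v \<in> words V"
  shows "wcls V R u \<otimes>\<^bsub>presented_group V R\<^esub> wcls V R v = wcls V R (u @ v)"
proof -
  let ?A = "wcls V R u" and ?B = "wcls V R v" and ?C = "wcls V R (u @ v)"
  have *: "wcls V R (u' @ v') = ?C" if "u' \<in> ?A" "v' \<in> ?B" for u' v'
  proof -
    have "word_eq V R u u'" "word_eq V R v v'" using that by simp_all
    then have "word_eq V R (u @ v) (u' @ v')" by (rule word_eq_append)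
    moreover from this have "u' @ v' \<in> words V" by (blast dest: word_eq_words)
    ultimately show ?thesis using assms by (subst wcls_eq_iff) (auto intro: word_eq.sym)
  qed
  have ne: "u \<in> ?A" "v \<in> ?B" using assms by (auto intro: word_eq.refl)
  have "(\<Union>u'\<in>?A. \<Union>v'\<in>?B. wcls V R (u' @ v')) = ?C"
  proof (rule SUP_eq_const)
    show "?A \<noteq> {}" using ne(1) by (metis empty_iff)
    show "(\<Union>v'\<in>?B. wcls V R (u' @ v')) = ?C" if "u' \<in> ?A" for u'
    proof (rule SUP_eq_const)
      show "?B \<noteq> {}" using ne(2) by (metis empty_iff)
      show "wcls V R (u' @ v') = ?C" if "v' \<in> ?B" for v'
        using \<open>u' \<in> ?A\<close> that by (rule *)
    qed
  qed
  then show ?thesis by (simp add: presented_group_def)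
qed

lemma group_presented_group: "group (presented_group V R)"
proof (rule groupI)
  fix A B C assume "A \<in> carrier (presented_group V R)" "B \<in> carrier (presented_group V R)"
    "C \<in> carrier (presented_group V R)"
  then obtain u v w where "A = wcls V R u" "B = wcls V R v" "C = wcls V R w"
    "u \<in> words V" "v \<in> words V" "w \<in> words V"
    by (auto simp: carrier_presented_group)
  then show "A \<otimes>\<^bsub>presented_group V R\<^esub> B \<in> carrier (presented_group V R)"
    "A \<otimes>\<^bsub>presented_group V R\<^esub> B \<otimes>\<^bsub>presented_group V R\<^esub> C =
     A \<otimes>\<^bsub>presented_group V R\<^esub> (B \<otimes>\<^bsub>presented_group V R\<^esub> C)"
    by (simp_all add: mult_presented_group)
next
  fix A assume "A \<in> carrier (presented_group V R)"
  then obtain u where u: "A = wcls V R u" "u \<in> words V"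
    by (auto simp: carrier_presented_group)
  then show "\<one>\<^bsub>presented_group V R\<^esub> \<otimes>\<^bsub>presented_group V R\<^esub> A = A"
    by (simp add: one_presented_group mult_presented_group)
  show "\<exists>B\<in>carrier (presented_group V R). B \<otimes>\<^bsub>presented_group V R\<^esub> A = \<one>\<^bsub>presented_group V R\<^esub>"
    using u word_eq_winv_left[OF u(2), of R]
    by (intro bexI[of _ "wcls V R (winv u)"])
       (simp_all add: one_presented_group mult_presented_group wcls_eq_iff)
qed (simp add: one_presented_group)

lemma inv_presented_group:
  assumes "w \<in> words V"
  shows "inv\<^bsub>presented_group V R\<^esub> (wcls V R w) = wcls V R (winv w)"
proof -
  interpret group "presented_group V R" by (rule group_presented_group)
  show ?thesis
    using assms word_eq_winv_left[OF assms, of R]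
    by (intro inv_equality)
       (simp_all add: one_presented_group mult_presented_group wcls_eq_iff)
qed

section \<open>Evaluation of words in a group\<close>

primrec weval :: "('g, 'm) monoid_scheme \<Rightarrow> ('v \<Rightarrow> 'g) \<Rightarrow> 'v word \<Rightarrow> 'g"
  where
    "weval H h [] = \<one>\<^bsub>H\<^esub>"
  | "weval H h (l # w) = (if snd l then h (fst l) else inv\<^bsub>H\<^esub> h (fst l)) \<otimes>\<^bsub>H\<^esub> weval H h w"

context group
begin

lemma weval_closed [simp]:
  "h ` V \<subseteq> carrier G \<Longrightarrow> w \<in> words V \<Longrightarrow> weval G h w \<in> carrier G"
  by (induction w) auto

lemma weval_append:
  "h ` V \<subseteq> carrier G \<Longrightarrow> u \<in> words V \<Longrightarrow> v \<in> words V \<Longrightarrow>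
    weval G h (u @ v) = weval G h u \<otimes> weval G h v"
proof (induction u)
  case (Cons l u)
  then have "h (fst l) \<in> carrier G" by auto
  then show ?case using Cons by (auto simp: m_assoc)
qed auto

lemma word_eq_weval:
  assumes "word_eq V R u v" and h: "h ` V \<subseteq> carrier G"
    and "\<And>r. r \<in> R \<Longrightarrow> r \<in> words V \<Longrightarrow> weval G h r = \<one>"
  shows "weval G h u = weval G h v"
  using assms(1)
proof (induction rule: word_eq.induct)
  case (cancel u v x b)
  then have "h x \<in> carrier G" using h by auto
  then have "weval G h [(x, b), (x, \<not> b)] = \<one>" by (cases b) auto
  then show ?case using cancel h
    using weval_append[OF h, of "[(x, b), (x, \<not> b)]" v] weval_append[OF h] weval_closed[OF h] by simp
next
  case (relator u v r)
  then show ?case by (simp add: weval_append[OF h] weval_closed[OF h] assms(3))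
next
  case (trans u v w)
  then show ?case by (blast intro: HOL.trans)
next
  case (sym u v)
  from sym.IH show ?case by (rule HOL.sym)
qed simp

text \<open>Evaluation at an arbitrary representative; it does not depend on the choice as soon as
  the relators evaluate to one.\<close>

definition presented_hom :: "('v \<Rightarrow> 'a) \<Rightarrow> 'v word set \<Rightarrow> 'a"
  where "presented_hom h A = weval G h (SOME w. w \<in> A)"

lemma presented_hom_wcls:
  assumes h: "h ` V \<subseteq> carrier G" and "\<And>r. r \<in> R \<Longrightarrow> r \<in> words V \<Longrightarrow> weval G h r = \<one>"
    and w: "w \<in> words V"
  shows "presented_hom h (wcls V R w) = weval G h w"
proof -
  have "w \<in> wcls V R w" using word_eq.refl[OF w] by simp
  then have "(SOME v. v \<in> wcls V R w) \<in> wcls V R w" by (rule someI)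
  then have "word_eq V R w (SOME v. v \<in> wcls V R w)" by (simp only: Image_singleton_iff word_rel_iff)
  then show ?thesis
    unfolding presented_hom_def by (rule word_eq_weval[OF _ h assms(2), symmetric])
qed

lemma presented_hom_hom:
  assumes h: "h ` V \<subseteq> carrier G" and "\<And>r. r \<in> R \<Longrightarrow> r \<in> words V \<Longrightarrow> weval G h r = \<one>"
  shows "presented_hom h \<in> hom (presented_group V R) G"
proof (rule homI)
  fix A B assume "A \<in> carrier (presented_group V R)" "B \<in> carrier (presented_group V R)"
  then obtain u v where "A = wcls V R u" "B = wcls V R v" "u \<in> words V" "v \<in> words V"
    by (auto simp: carrier_presented_group)
  then show "presented_hom h A \<in> carrier G"
    "presented_hom h (A \<otimes>\<^bsub>presented_group V R\<^esub> B) = presented_hom h A \<otimes> presented_hom h B"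
    using weval_append[OF h, of u v] weval_closed[OF h] presented_hom_wcls[OF assms]
    by (simp_all add: mult_presented_group)
qed

end

declare One_nat_def [simp del]

section \<open>The reflection group of the regular ideal tetrahedron\<close>

text \<open>The generators of \<open>T\<close> are involutions, so plain lists of faces serve as
  words. The relation \<open>(s t)^3 = 1\<close> then takes the form of the braid move, which
  preserves length.\<close>

inductive cox_eq :: "nat list \<Rightarrow> nat list \<Rightarrow> bool"
  where
    refl: "set w \<subseteq> {1..4} \<Longrightarrow> cox_eq w w"
  | sym: "cox_eq u v \<Longrightarrow> cox_eq v u"
  | trans: "cox_eq u v \<Longrightarrow> cox_eq v w \<Longrightarrow> cox_eq u w"
  | square: "set (u @ v) \<subseteq> {1..4} \<Longrightarrow> s \<in> {1..4} \<Longrightarrow> cox_eq (u @ [s, s] @ v) (u @ v)"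
  | braid: "set (u @ v) \<subseteq> {1..4} \<Longrightarrow> s \<in> {1..4} \<Longrightarrow> t \<in> {1..4} \<Longrightarrow> s \<noteq> t \<Longrightarrow>
      cox_eq (u @ [s, t, s] @ v) (u @ [t, s, t] @ v)"

lemma cox_eq_set: "cox_eq u v \<Longrightarrow> set u \<subseteq> {1..4} \<and> set v \<subseteq> {1..4}"
  by (induction rule: cox_eq.induct) auto

lemma cox_eq_cong:
  assumes "cox_eq u v" "set p \<subseteq> {1..4}" "set q \<subseteq> {1..4}"
  shows "cox_eq (p @ u @ q) (p @ v @ q)"
  using assms
proof (induction rule: cox_eq.induct)
  case (square u v s)
  then show ?case using cox_eq.square[of "p @ u" "v @ q" s] by simp
next
  case (braid u v s t)
  then show ?case using cox_eq.braid[of "p @ u" "v @ q" s t] by simp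
next
  case (trans u v w)
  then show ?case by (blast intro: cox_eq.trans)
next
  case (sym u v)
  then show ?case by (blast intro: cox_eq.sym)
next
  case (refl w)
  then show ?case by (intro cox_eq.refl) auto
qed

text \<open>This is \<open>x - 2 B(x, e_s) e_s\<close> for the bilinear form with
  \<open>B(e_s, e_s) = 1\<close> and \<open>B(e_s, e_t) = - cos (pi/3) = - 1/2\<close>.\<close>

definition tits_refl :: "nat \<Rightarrow> (nat \<Rightarrow> int) \<Rightarrow> nat \<Rightarrow> int"
  where "tits_refl s x = x(s := x 1 + x 2 + x 3 + x 4 - 2 * x s)"

definition unit_vec :: "nat \<Rightarrow> nat \<Rightarrow> int"
  where "unit_vec s i = (if i = s then 1 else 0)"

lemma in14: "s \<in> {1..4} \<longleftrightarrow> s = 1 \<or> s = 2 \<or> s = 3 \<or> s = (4::nat)"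
  by auto

lemma all14: "(\<forall>i\<in>{1..4::nat}. P i) \<longleftrightarrow> P 1 \<and> P 2 \<and> P 3 \<and> P 4"
  by (auto simp: in14 simp del: atLeastAtMost_iff)

lemma tits_refl_refl:
  assumes "s \<in> {1..4}" shows "tits_refl s (tits_refl s x) = x"
  using assms unfolding in14 by (elim disjE) (auto simp: tits_refl_def fun_eq_iff)

lemma tits_refl_braid:
  assumes "s \<in> {1..4}" "t \<in> {1..4}" "s \<noteq> t"
  shows "tits_refl s (tits_refl t (tits_refl s x)) = tits_refl t (tits_refl s (tits_refl t x))"
  using assms unfolding in14 by (elim disjE) (auto simp: tits_refl_def fun_eq_iff)

lemma cox_eq_act: "cox_eq u v \<Longrightarrow> foldr tits_refl u x = foldr tits_refl v x"
proof (induction arbitrary: x rule: cox_eq.induct)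
  case (square u v s)
  then show ?case using tits_refl_refl by simp
next
  case (braid u v s t)
  then show ?case using tits_refl_braid by simp
next
  case (trans u v w)
  show ?case unfolding trans.IH(1) trans.IH(2) ..
next
  case (sym u v)
  show ?case unfolding sym.IH ..
qed simp

lemma act_add: "foldr tits_refl w (\<lambda>i. x i + y i) = (\<lambda>i. foldr tits_refl w x i + foldr tits_refl w y i)"
  by (induction w) (auto simp: tits_refl_def fun_eq_iff)

lemma act_uminus: "foldr tits_refl w (\<lambda>i. - x i) = (\<lambda>i. - foldr tits_refl w x i)"
  by (induction w) (auto simp: tits_refl_def fun_eq_iff)

lemma tits_refl_unit: "s \<in> {1..4} \<Longrightarrow> tits_refl s (unit_vec s) = (\<lambda>i. - unit_vec s i)"
  unfolding in14 by (elim disjE) (auto simp: tits_refl_def unit_vec_def fun_eq_iff)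

lemma tits_refl_unit_other:
  "s \<in> {1..4} \<Longrightarrow> t \<in> {1..4} \<Longrightarrow> s \<noteq> t \<Longrightarrow> tits_refl t (unit_vec s) = (\<lambda>i. unit_vec s i + unit_vec t i)"
  unfolding in14 by (elim disjE) (auto simp: tits_refl_def unit_vec_def fun_eq_iff)

text \<open>Two generators span a symmetric group \<open>S_3\<close>; its six elements are listed by
  their shortest words. The length bound is what makes the word in \<open>dihedral_unit\<close>
  strictly shorter.\<close>

lemma dihedral_normal_form:
  assumes st: "s \<in> {1..4}" "t \<in> {1..4}" "s \<noteq> t" and "set d \<subseteq> {s, t}"
  shows "\<exists>n \<in> {[], [s], [t], [s, t], [t, s], [s, t, s]}. cox_eq d n \<and> length n \<le> length d"
  using assms(4)
proof (induction d)
  case Nil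
  then show ?case by (auto intro: cox_eq.refl)
next
  case (Cons x d)
  then have "set d \<subseteq> {s, t}" by simp
  from Cons.IH[OF this] obtain n
    where n: "n \<in> {[], [s], [t], [s, t], [t, s], [s, t, s]}" "cox_eq d n" "length n \<le> length d"
    by (elim bexE conjE)
  have x: "x \<in> {s, t}" using Cons by auto
  have 1: "cox_eq (x # d) (x # n)"
    using cox_eq_cong[OF n(2), of "[x]" "[]"] x st by auto
  have 2: "length (x # n) \<le> length (x # d)" using n by auto
  have ss: "cox_eq [s, s] []" "cox_eq [t, t] []" "cox_eq [s, s, t] [t]" "cox_eq [t, t, s] [s]"
    "cox_eq [s, s, t, s] [t, s]" "cox_eq [t, s, t] [s, t, s]"
    using cox_eq.square[of "[]" "[]" s] cox_eq.square[of "[]" "[]" t] cox_eq.square[of "[]" "[t]" s]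
      cox_eq.square[of "[]" "[s]" t] cox_eq.square[of "[]" "[t, s]" s] cox_eq.braid[of "[]" "[]" t s] st
    by auto
  have "cox_eq [t, s, t, s] [s, t, s, s]" "cox_eq [s, t, s, s] [s, t]"
    using cox_eq.braid[of "[]" "[s]" t s] cox_eq.square[of "[s, t]" "[]" s] st by auto
  then have tsts: "cox_eq [t, s, t, s] [s, t]" by (rule cox_eq.trans)
  have r: "cox_eq [s] [s]" "cox_eq [t] [t]" "cox_eq [s, t] [s, t]" "cox_eq [t, s] [t, s]"
    "cox_eq [s, t, s] [s, t, s]"
    using st by (auto intro!: cox_eq.refl simp del: atLeastAtMost_iff)
  from x n(1) have "\<exists>m \<in> {[], [s], [t], [s, t], [t, s], [s, t, s]}. cox_eq (x # n) m \<and> length m \<le> length (x # n)"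
    by (elim insertE emptyE) (simp_all add: ss tsts r)
  then obtain m where m: "m \<in> {[], [s], [t], [s, t], [t, s], [s, t, s]}" "cox_eq (x # n) m"
    "length m \<le> length (x # n)"
    by (elim bexE conjE)
  show ?case
    using m(1) cox_eq.trans[OF 1 m(2)] order.trans[OF m(3) 2] by (intro bexI[of _ m] conjI)
qed

text \<open>The positive roots of the dihedral subgroup are \<open>e_s\<close>, \<open>e_t\<close>
  and \<open>e_s + e_t\<close>. Among the normal forms, \<open>[]\<close>, \<open>[t]\<close> and
  \<open>[s, t]\<close> send \<open>e_s\<close> to one of them; the other three end in
  \<open>s\<close>.\<close>

lemma dihedral_unit:
  assumes st: "s \<in> {1..4}" "t \<in> {1..4}" "s \<noteq> t" and "set d \<subseteq> {s, t}"
  shows "foldr tits_refl d (unit_vec s) \<in> {unit_vec s, unit_vec t, \<lambda>i. unit_vec s i + unit_vec t i} \<or>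
    (\<exists>d'. set d' \<subseteq> {s, t} \<and> length d' < length d \<and> cox_eq d (d' @ [s]))"
proof -
  from dihedral_normal_form[OF assms] obtain n
    where n: "n \<in> {[], [s], [t], [s, t], [t, s], [s, t, s]}" "cox_eq d n" "length n \<le> length d"
    by (elim bexE conjE)
  have a: "foldr tits_refl d (unit_vec s) = foldr tits_refl n (unit_vec s)"
    by (rule cox_eq_act[OF n(2)])
  have add: "tits_refl s (\<lambda>i. x i + y i) = (\<lambda>i. tits_refl s x i + tits_refl s y i)" for s x y
    using act_add[of "[s]"] by simp
  note u = tits_refl_unit[OF st(1)] tits_refl_unit_other[OF st] tits_refl_unit_other[OF st(2,1) st(3)[symmetric]]
  have red: ?thesis if "n = d' @ [s]" "set d' \<subseteq> {s, t}" for d'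
    using that n by (intro disjI2 exI[of _ d']) auto
  from n(1) consider "n = []" | "n = [s]" | "n = [t]" | "n = [s, t]" | "n = [t, s]" | "n = [s, t, s]"
    by blast
  then show ?thesis
  proof cases
    case 2
    then show ?thesis by (intro red[of "[]"]) auto
  next
    case 5
    then show ?thesis by (intro red[of "[t]"]) auto
  next
    case 6
    then show ?thesis by (intro red[of "[s, t]"]) auto
  qed (simp_all add: a u add)
qed

text \<open>
  Tits' argument: factor \<open>w\<close> as \<open>v d\<close> with \<open>d\<close> in the dihedral group of \<open>s\<close> and the last letter
  of \<open>w\<close>, and \<open>v\<close> as short as possible.
\<close>

lemma tits_root_dichotomy:
  assumes "set w \<subseteq> {1..4}" "s \<in> {1..4}"
  shows "(\<forall>i\<in>{1..4}. foldr tits_refl w (unit_vec s) i \<ge> 0) \<or>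
    (\<exists>w'. length w' < length w \<and> cox_eq w (w' @ [s]))"
  using assms
proof (induction "length w" arbitrary: w s rule: less_induct)
  case less
  show ?case
  proof (cases w rule: rev_cases)
    case Nil
    then show ?thesis by (auto simp: unit_vec_def)
  next
    case (snoc u t)
    have u: "set u \<subseteq> {1..4}" "t \<in> {1..4}" using less.prems snoc by auto
    show ?thesis
    proof (cases "t = s")
      case True
      then have "cox_eq w (u @ [s])" using snoc cox_eq.refl[OF less.prems(1)] by simp
      then show ?thesis using snoc by (intro disjI2 exI[of _ u]) auto
    next
      case False
      define D where "D v d \<longleftrightarrow> set d \<subseteq> {s, t} \<and> cox_eq w (v @ d) \<and> length v + length d \<le> length w" for v d
      have "\<exists>d. D u d"
        using snoc cox_eq.refl[OF less.prems(1)] by (intro exI[of _ "[t]"]) (auto simp: D_def)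
      then obtain v where v: "\<exists>d. D v d" "\<And>v'. \<exists>d. D v' d \<Longrightarrow> length v \<le> length v'"
        using ex_has_least_nat[of "\<lambda>v. \<exists>d. D v d" u length] by blast
      obtain d where d: "D v d" using v by auto
      have "length v \<le> length u" by (rule v(2)) fact
      then have len: "length v < length w" using snoc by auto
      have vL: "set v \<subseteq> {1..4}" using cox_eq_set[of w "v @ d"] d by (auto simp: D_def)
      have dL: "set d \<subseteq> {1..4}" using d less.prems u by (auto simp: D_def)
      \<comment> \<open>By minimality of \<open>v\<close>: if \<open>v\<close> gave
        \<open>e_r\<close> a negative entry, induction would rewrite \<open>v\<close> as
        \<open>v' @ [r]\<close> with \<open>v'\<close> shorter, and \<open>r\<close> could be moved
        into \<open>d\<close>.\<close>
      have pos: "\<forall>i\<in>{1..4}. foldr tits_refl v (unit_vec r) i \<ge> 0" if r: "r \<in> {s, t}" for r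
      proof (rule ccontr)
        assume "\<not> ?thesis"
        moreover have "r \<in> {1..4}" using r u less.prems by auto
        ultimately obtain v' where v': "length v' < length v" "cox_eq v (v' @ [r])"
          using less.hyps[OF len vL, of r] by blast
        have "cox_eq (v @ d) (v' @ r # d)"
          using cox_eq_cong[OF v'(2), of "[]" d] dL by simp
        then have "D v' (r # d)"
          using d v' r by (auto simp: D_def intro: cox_eq.trans)
        then show False using v(2)[of v'] v'(1) by auto
      qed
      have ts: "s \<in> {1..4}" "t \<in> {1..4}" "s \<noteq> t" using False u less.prems by auto
      have w: "foldr tits_refl w (unit_vec s) = foldr tits_refl v (foldr tits_refl d (unit_vec s))"
        using cox_eq_act[of w "v @ d"] d by (simp add: D_def)
      consider "foldr tits_refl d (unit_vec s) = unit_vec s" | "foldr tits_refl d (unit_vec s) = unit_vec t"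
        | "foldr tits_refl d (unit_vec s) = (\<lambda>i. unit_vec s i + unit_vec t i)"
        | d' where "set d' \<subseteq> {s, t}" "length d' < length d" "cox_eq d (d' @ [s])"
        using dihedral_unit[OF ts, of d] d by (auto simp: D_def)
      then show ?thesis
      proof cases
        case (4 d')
        have "cox_eq (v @ d) (v @ d' @ [s])"
          using cox_eq_cong[OF 4(3) vL, of "[]"] by simp
        then show ?thesis
          using d 4(2) by (intro disjI2 exI[of _ "v @ d'"]) (auto simp: D_def intro: cox_eq.trans)
      next
        case 3
        then show ?thesis using w pos[of s] pos[of t] by (auto simp: act_add)
      qed (use w pos[of s] pos[of t] in auto)
    qed
  qed
qed

text \<open>If \<open>w = u @ [t]\<close>, then \<open>u\<close> sends \<open>e_t\<close> to the
  negative of a nonnegative vector, so by the dichotomy \<open>u\<close> can be rewritten to end in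
  \<open>t\<close>, and the two letters \<open>t\<close> cancel. Since only nonnegativity is
  assumed, the lemma applies to words that merely permute the simple roots.\<close>

lemma tits_faithful:
  assumes "set w \<subseteq> {1..4}"
    and "\<And>s i. s \<in> {1..4} \<Longrightarrow> i \<in> {1..4} \<Longrightarrow> foldr tits_refl w (unit_vec s) i \<ge> 0"
  shows "cox_eq w []"
  using assms
proof (induction "length w" arbitrary: w rule: less_induct)
  case less
  show ?case
  proof (cases w rule: rev_cases)
    case Nil
    then show ?thesis by (auto intro: cox_eq.refl)
  next
    case (snoc u t)
    have u: "set u \<subseteq> {1..4}" "t \<in> {1..4}" using less.prems snoc by auto
    have "foldr tits_refl w (unit_vec t) = (\<lambda>i. - foldr tits_refl u (unit_vec t) i)"
      using u snoc by (simp add: tits_refl_unit act_uminus)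
    then have neg: "foldr tits_refl u (unit_vec t) i \<le> 0" if "i \<in> {1..4}" for i
      using less.prems(2)[OF u(2) that] by simp
    have "\<exists>u'. length u' < length u \<and> cox_eq u (u' @ [t])"
    proof (rule ccontr)
      assume "\<not> ?thesis"
      then have "\<forall>i\<in>{1..4}. foldr tits_refl u (unit_vec t) i \<ge> 0"
        using tits_root_dichotomy[OF u] by blast
      \<comment> \<open>Both signs together force the four coordinates to vanish; the inverse word
        \<open>rev u\<close> would then yield \<open>unit_vec t t = 0\<close>.\<close>
      then have z: "\<forall>i\<in>{1..4}. foldr tits_refl u (unit_vec t) i = 0"
        using neg by force
      have ind: "\<forall>i\<in>{1..4}. foldr tits_refl (rev v) x i = 0" if "\<forall>i\<in>{1..4}. x i = 0" "set v \<subseteq> {1..4}" for v x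
        using that
      proof (induction v arbitrary: x)
        case (Cons a v)
        have "\<forall>i\<in>{1..4}. tits_refl a x i = 0"
          using Cons.prems(1) by (auto simp: tits_refl_def all14)
        then show ?case using Cons by simp
      qed simp
      have inv: "foldr tits_refl (rev v) (foldr tits_refl v x) = x" if "set v \<subseteq> {1..4}" for v x
        using that by (induction v arbitrary: x) (auto simp: tits_refl_refl)
      have "unit_vec t t = 0"
        using ind[OF z u(1)] inv[OF u(1), of "unit_vec t"] u(2) by auto
      then show False by (simp add: unit_vec_def)
    qed
    then obtain u' where u': "length u' < length u" "cox_eq u (u' @ [t])" by blast
    have u'L: "set u' \<subseteq> {1..4}" using cox_eq_set[OF u'(2)] by auto
    have "cox_eq w (u' @ [t, t])"
      using cox_eq_cong[OF u'(2), of "[]" "[t]"] snoc u by simp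
    moreover have "cox_eq (u' @ [t, t]) u'"
      using cox_eq.square[of u' "[]" t] u u'L by simp
    ultimately have wu: "cox_eq w u'" by (rule cox_eq.trans)
    have "cox_eq u' []"
      using u' snoc u'L less.prems(2) cox_eq_act[OF wu] by (intro less.hyps) auto
    with wu show ?thesis by (rule cox_eq.trans)
  qed
qed

section \<open>The figure-eight group acts on the tetrahedra\<close>

text \<open>With \<open>a\<close> and \<open>b\<close> for the letters 0 and 1, this is the relation
  \<open>a b a^-1 = b^-1 a b a^-1 b^-1 a^-1 b\<close> of the crossing \<open>(2,2)\<close>, after
  the other three crossings have been used to express the faces 2, 3 and 4 in \<open>a\<close> and
  \<open>b\<close>.\<close>

definition fig8_relator :: "nat word"
  where "fig8_relator = [(0, True), (1, False), (0, False), (1, False), (0, True),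
    (1, True), (0, False), (1, False), (0, False), (1, True)]"

definition fig8_gens :: "nat set"
  where "fig8_gens = {0, 1}"

abbreviation fig8_eq :: "nat word \<Rightarrow> nat word \<Rightarrow> bool"
  where "fig8_eq \<equiv> word_eq fig8_gens {fig8_relator}"

lemma fig8_letter_cases:
  assumes "fst l \<in> fig8_gens"
  obtains "l = (0, True)" | "l = (0, False)" | "l = (1, True)" | "l = (1, False)"
  using assms by (cases l; cases "snd l") (auto simp: fig8_gens_def)

text \<open>A sufficient condition that can be evaluated: after conjugation by one of five fixed
  words and free reduction, nothing or a single relator is left. The five conjugators suffice for
  the gluing, edge and crossing checks below, so no word problem has to be solved.\<close>

definition fig8_trivial :: "nat word \<Rightarrow> bool"
  where "fig8_trivial w \<longleftrightarrow> (\<forall>l\<in>set w. fst l \<in> {0, 1}) \<and>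
    (\<exists>c\<in>{[], [(1, True)], [(0, True), (1, True), (0, False)], [(1, False), (0, False), (1, True)],
          [(1, True), (0, True), (1, True), (0, False)]}.
      free_reduce (winv c @ w @ c) \<in> {[], fig8_relator, winv fig8_relator})"

lemma fig8_trivial_imp: "fig8_trivial w \<Longrightarrow> fig8_eq w []"
proof -
  assume "fig8_trivial w"
  then obtain c where c: "free_reduce (winv c @ w @ c) \<in> {[], fig8_relator, winv fig8_relator}"
    and cC: "c \<in> {[], [(1, True)], [(0, True), (1, True), (0, False)], [(1, False), (0, False), (1, True)],
          [(1, True), (0, True), (1, True), (0, False)]}" and ww: "\<forall>l\<in>set w. fst l \<in> {0, 1}"
    unfolding fig8_trivial_def by blast
  from cC have cw: "c \<in> words fig8_gens"
    by (elim insertE emptyE) (simp_all add: fig8_gens_def)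
  have w: "w \<in> words fig8_gens"
    using ww by (induction w) (auto simp: fig8_gens_def)
  have rw: "fig8_relator \<in> words fig8_gens"
    by (simp add: fig8_relator_def fig8_gens_def)
  have r: "fig8_eq fig8_relator []"
    using word_eq.relator[of "[]" fig8_gens "[]" fig8_relator] rw by simp
  have "fig8_eq v []" if "v \<in> {[], fig8_relator, winv fig8_relator}" for v
    using that r word_eq_winv[OF r] word_eq.refl[of "[]"] by auto
  with c have "fig8_eq (free_reduce (winv c @ w @ c)) []" by blast
  then have "fig8_eq (winv c @ w @ c) []"
    using word_eq_free_reduce[of "winv c @ w @ c" fig8_gens] w cw by (auto intro: word_eq.trans)
  then show ?thesis using cw w by (rule word_eq_conjugate)
qed

text \<open>
  The complement has two ideal tetrahedra \<open>X\<close>, indexed by \<open>bool\<close>, with faces \<open>1, \<dots>, 4\<close>.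
  Crossing face \<open>f\<close> of \<open>X\<close> leads to the tetrahedron \<open>\<not> X\<close>, contributes the deck transformation
  \<open>face_label X f\<close>, and identifies the face names by \<open>face_glue X f\<close> (which fixes the dummy \<open>0\<close>).
\<close>

fun face_label :: "bool \<Rightarrow> nat \<Rightarrow> nat word"
  where
    "face_label True f = (if f = 1 then [(0, True), (1, False), (0, False)] else if f = 2 then []
       else if f = 3 then [(1, False), (0, False)] else [(1, False)])"
  | "face_label False f = (if f = 1 then [(0, True), (1, True)] else if f = 2 then []
       else if f = 3 then [(1, True)] else [(0, True), (1, True), (0, False)])"

fun face_glue :: "bool \<Rightarrow> nat \<Rightarrow> nat list"
  where
    "face_glue True f = (if f = 1 then [0, 4, 1, 3, 2] else if f = 2 then [0, 1, 2, 3, 4]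
       else if f = 3 then [0, 3, 4, 1, 2] else [0, 1, 4, 2, 3])"
  | "face_glue False f = (if f = 1 then [0, 3, 4, 1, 2] else if f = 2 then [0, 1, 2, 3, 4]
       else if f = 3 then [0, 1, 3, 4, 2] else [0, 2, 4, 3, 1])"

section \<open>Namings of faces and galleries of tetrahedra\<close>

definition naming :: "nat list \<Rightarrow> bool"
  where "naming q \<longleftrightarrow> length q = 5 \<and> q ! 0 = 0 \<and> distinct q \<and> set q \<subseteq> {..4}"

definition compose_list :: "nat list \<Rightarrow> nat list \<Rightarrow> nat list"
  where "compose_list p q = map (nth p) q"

lemma nth_compose_list: "i < length q \<Longrightarrow> compose_list p q ! i = p ! (q ! i)"
  by (simp add: compose_list_def)

lemma length_compose_list [simp]: "length (compose_list p q) = length q"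
  by (simp add: compose_list_def)

lemma naming_nth:
  assumes "naming q" "s \<in> {1..4}"
  shows "q ! s \<in> {1..4}"
proof -
  have "s < length q" using assms by (simp add: naming_def)
  then have "q ! s \<in> set q" by simp
  then have "q ! s \<in> {..4}" using assms(1) unfolding naming_def by blast
  moreover have "q ! s \<noteq> q ! 0"
    using assms by (subst nth_eq_iff_index_eq) (auto simp: naming_def)
  ultimately show ?thesis using assms by (auto simp: naming_def)
qed

lemma naming_nth_neq:
  "naming q \<Longrightarrow> s \<in> {1..4} \<Longrightarrow> t \<in> {1..4} \<Longrightarrow> s \<noteq> t \<Longrightarrow> q ! s \<noteq> q ! t"
  by (subst nth_eq_iff_index_eq) (auto simp: naming_def)

lemma naming_compose:
  assumes "naming p" "naming q"
  shows "naming (compose_list p q)"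
proof -
  have "inj_on (nth p) (set q)"
    using assms by (intro inj_onI) (subst (asm) nth_eq_iff_index_eq, auto simp: naming_def)
  moreover have "p ! i \<le> 4" if "i \<in> set q" for i
  proof -
    have "i < length p" using that assms by (auto simp: naming_def)
    then have "p ! i \<in> set p" by simp
    then have "p ! i \<in> {..4}" using assms(1) unfolding naming_def by blast
    then show ?thesis by simp
  qed
  ultimately show ?thesis
    using assms by (auto simp: naming_def compose_list_def distinct_map)
qed

lemma naming_face_glue: "naming (face_glue X f)"
  by (cases X) (auto simp: naming_def)

text \<open>A list of faces is a gallery in the tessellation: from a tetrahedron over
  \<open>X\<close>, cross the face named \<open>s\<close>, and so on. The naming \<open>q\<close>
  sends the name of a face to its number in the quotient tetrahedron; reflected tetrahedra inherit
  their names, so a crossing changes \<open>q\<close> by the gluing permutation. The product of the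
  labels is the deck transformation picked up on the way.\<close>

fun gallery_word :: "bool \<Rightarrow> nat list \<Rightarrow> nat list \<Rightarrow> nat word"
  where
    "gallery_word X q [] = []"
  | "gallery_word X q (s # w) =
       face_label X (q ! s) @ gallery_word (\<not> X) (compose_list (face_glue X (q ! s)) q) w"

fun gallery_end :: "bool \<Rightarrow> nat list \<Rightarrow> nat list \<Rightarrow> nat list"
  where
    "gallery_end X q [] = q"
  | "gallery_end X q (s # w) = gallery_end (\<not> X) (compose_list (face_glue X (q ! s)) q) w"

lemma face_label_words [simp]: "face_label X f \<in> words fig8_gens"
  by (cases X) (auto simp: fig8_gens_def)

lemma gallery_word_words [simp]: "gallery_word X q w \<in> words fig8_gens"
  by (induction X q w rule: gallery_word.induct) auto

lemma gallery_word_append: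
  "gallery_word X q (u @ v) =
    gallery_word X q u @ gallery_word (if even (length u) then X else \<not> X) (gallery_end X q u) v"
  by (induction X q u rule: gallery_word.induct) auto

lemma gallery_end_append:
  "gallery_end X q (u @ v) = gallery_end (if even (length u) then X else \<not> X) (gallery_end X q u) v"
  by (induction X q u rule: gallery_word.induct) auto

lemma naming_gallery_end: "naming q \<Longrightarrow> naming (gallery_end X q w)"
  by (induction X q w rule: gallery_word.induct) (auto simp: naming_compose naming_face_glue)

lemma naming_length: "naming q \<Longrightarrow> length q = 5"
  by (simp add: naming_def)

lemma square_check:
  "\<forall>X\<in>{True, False}. \<forall>f\<in>{1, 2, 3, 4}.
     fig8_trivial (face_label X f @ face_label (\<not> X) (face_glue X f ! f)) \<and>
     (\<forall>v\<in>{0, 1, 2, 3, 4}. face_glue (\<not> X) (face_glue X f ! f) ! (face_glue X f ! v) = v)"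
  by code_simp

text \<open>The condition at the edges: six tetrahedra with dihedral angle pi/3 surround each edge,
  so three crossings in either direction around the edge between \<open>f\<close> and
  \<open>h\<close> end in the same tetrahedron. Closing up around the edges is where the relator is
  used.\<close>

lemma braid_check:
  "\<forall>X\<in>{True, False}. \<forall>f\<in>{1, 2, 3, 4}. \<forall>h\<in>{1, 2, 3, 4}. f \<noteq> h \<longrightarrow>
    (let a1 = face_glue X f; a2 = face_glue (\<not> X) (a1 ! h); a3 = face_glue X (a2 ! (a1 ! f));
         b1 = face_glue X h; b2 = face_glue (\<not> X) (b1 ! f); b3 = face_glue X (b2 ! (b1 ! h)) in
     fig8_trivial (winv (face_label X f @ face_label (\<not> X) (a1 ! h) @ face_label X (a2 ! (a1 ! f))) @
       face_label X h @ face_label (\<not> X) (b1 ! f) @ face_label X (b2 ! (b1 ! h))) \<and>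
     (\<forall>v\<in>{0, 1, 2, 3, 4}. a3 ! (a2 ! (a1 ! v)) = b3 ! (b2 ! (b1 ! v))))"
  by code_simp

lemma in_five: "naming q \<Longrightarrow> i < length q \<Longrightarrow> q ! i \<in> {0, 1, 2, 3, 4}"
proof -
  assume "naming q" "i < length q"
  then have "q ! i \<in> {..4}" using nth_mem[of i q] unfolding naming_def by blast
  then show ?thesis by auto
qed

lemma gallery_square:
  assumes q: "naming q" and s: "s \<in> {1..4}"
  shows "fig8_eq (gallery_word X q [s, s]) []" "gallery_end X q [s, s] = q"
proof -
  define f where "f = q ! s"
  have f: "f \<in> {1, 2, 3, 4}" using naming_nth[OF q s] by (auto simp: f_def)
  have X: "X \<in> {True, False}" by simp
  note c = square_check[rule_format, OF X f]
  have sl: "s < length q" using q s by (simp add: naming_def)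
  have "compose_list (face_glue X f) q ! s = face_glue X f ! f"
    using sl by (simp add: nth_compose_list f_def)
  then have *: "gallery_word X q [s, s] = face_label X f @ face_label (\<not> X) (face_glue X f ! f)"
    "gallery_end X q [s, s] = compose_list (face_glue (\<not> X) (face_glue X f ! f)) (compose_list (face_glue X f) q)"
    by (simp_all flip: f_def)
  show "fig8_eq (gallery_word X q [s, s]) []"
    unfolding * using c by (intro fig8_trivial_imp) blast
  show "gallery_end X q [s, s] = q"
    unfolding *
  proof (rule nth_equalityI)
    fix i assume i: "i < length (compose_list (face_glue (\<not> X) (face_glue X f ! f)) (compose_list (face_glue X f) q))"
    then show "compose_list (face_glue (\<not> X) (face_glue X f ! f)) (compose_list (face_glue X f) q) ! i = q ! i"
      using c in_five[OF q, of i] by (simp only: nth_compose_list length_compose_list)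
  qed simp
qed

lemma gallery_braid:
  assumes q: "naming q" and s: "s \<in> {1..4}" "t \<in> {1..4}" "s \<noteq> t"
  shows "fig8_eq (gallery_word X q [s, t, s]) (gallery_word X q [t, s, t])"
    "gallery_end X q [s, t, s] = gallery_end X q [t, s, t]"
proof -
  define f h where "f = q ! s" "h = q ! t"
  have f: "f \<in> {1, 2, 3, 4}" "h \<in> {1, 2, 3, 4}" "f \<noteq> h"
    using naming_nth[OF q s(1)] naming_nth[OF q s(2)] naming_nth_neq[OF q s] by (auto simp: f_h_def)
  have X: "X \<in> {True, False}" by simp
  note c = braid_check[rule_format, OF X f, unfolded Let_def]
  have sl: "s < length q" "t < length q" using q s by (simp_all add: naming_def)
  let ?a1 = "face_glue X f" and ?b1 = "face_glue X h"
  let ?a2 = "face_glue (\<not> X) (?a1 ! h)" and ?b2 = "face_glue (\<not> X) (?b1 ! f)"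
  let ?a3 = "face_glue X (?a2 ! (?a1 ! f))" and ?b3 = "face_glue X (?b2 ! (?b1 ! h))"
  note n = nth_compose_list length_compose_list
  have a: "gallery_word X q [s, t, s] =
      face_label X f @ face_label (\<not> X) (?a1 ! h) @ face_label X (?a2 ! (?a1 ! f))"
    "gallery_end X q [s, t, s] = compose_list ?a3 (compose_list ?a2 (compose_list ?a1 q))"
    using sl by (simp_all add: n flip: f_h_def)
  have b: "gallery_word X q [t, s, t] =
      face_label X h @ face_label (\<not> X) (?b1 ! f) @ face_label X (?b2 ! (?b1 ! h))"
    "gallery_end X q [t, s, t] = compose_list ?b3 (compose_list ?b2 (compose_list ?b1 q))"
    using sl by (simp_all add: n flip: f_h_def)
  have "fig8_eq (winv (gallery_word X q [s, t, s]) @ gallery_word X q [t, s, t]) []"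
    unfolding a b using c by (intro fig8_trivial_imp) blast
  then show "fig8_eq (gallery_word X q [s, t, s]) (gallery_word X q [t, s, t])"
    by (simp only: word_eq_Nil_iff[OF gallery_word_words gallery_word_words])
  show "gallery_end X q [s, t, s] = gallery_end X q [t, s, t]"
    unfolding a b
  proof (rule nth_equalityI)
    fix i assume "i < length (compose_list ?a3 (compose_list ?a2 (compose_list ?a1 q)))"
    then show "compose_list ?a3 (compose_list ?a2 (compose_list ?a1 q)) ! i =
        compose_list ?b3 (compose_list ?b2 (compose_list ?b1 q)) ! i"
      using c in_five[OF q, of i] by (simp only: n)
  qed simp
qed

text \<open>Squares and braids are the two local checks above, so deck transformation and final
  naming depend only on the element of \<open>T\<close>. The parity of the length is carried along
  because it decides over which of the two tetrahedra a gallery ends.\<close>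

lemma gallery_cox_eq:
  assumes "cox_eq u v" "naming q"
  shows "fig8_eq (gallery_word X q u) (gallery_word X q v) \<and> gallery_end X q u = gallery_end X q v
    \<and> even (length u) = even (length v)"
  using assms
proof (induction arbitrary: X q rule: cox_eq.induct)
  case (refl w)
  then show ?case by (auto intro: word_eq.refl)
next
  case (sym u v)
  then show ?case by (metis word_eq.sym)
next
  case (trans u v w)
  then show ?case by (metis word_eq.trans)
next
  case (square u v s)
  let ?X = "if even (length u) then X else \<not> X" and ?q = "gallery_end X q u"
  note g = gallery_square[OF naming_gallery_end[OF square.prems] square.hyps(2), of ?X X u]
  have "fig8_eq (gallery_word X q u @ gallery_word ?X ?q [s, s] @ gallery_word ?X ?q v)
    (gallery_word X q u @ [] @ gallery_word ?X ?q v)"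
    by (intro word_eq_append word_eq.refl g) auto
  then show ?case using g(2) by (simp only: gallery_word_append gallery_end_append) auto
next
  case (braid u v s t)
  let ?X = "if even (length u) then X else \<not> X" and ?q = "gallery_end X q u"
  note g = gallery_braid[OF naming_gallery_end[OF braid.prems] braid.hyps(2-4), of ?X X u]
  have "fig8_eq
    (gallery_word X q u @ gallery_word ?X ?q [s, t, s] @ gallery_word (\<not> ?X) (gallery_end ?X ?q [s, t, s]) v)
    (gallery_word X q u @ gallery_word ?X ?q [t, s, t] @ gallery_word (\<not> ?X) (gallery_end ?X ?q [s, t, s]) v)"
    by (intro word_eq_append word_eq.refl g) auto
  then show ?case using g(2) by (simp only: gallery_word_append gallery_end_append) auto
qed

text \<open>Two crossings whose labels multiply to the letter lead from the base tetrahedron to one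
  of the same kind, and \<open>letter_naming\<close> compares the names there. Gallery and naming
  are the two components of the letter in \<open>T \<rtimes> S_4\<close>.\<close>

fun letter_gallery :: "nat \<times> bool \<Rightarrow> nat list"
  where "letter_gallery (x, b) =
    (if x = 0 then if b then [1, 2] else [3, 2] else if b then [2, 3] else [4, 3])"

fun letter_naming :: "nat \<times> bool \<Rightarrow> nat list"
  where "letter_naming (x, b) =
    (if x = 0 then if b then [0, 3, 1, 2, 4] else [0, 2, 3, 1, 4]
     else if b then [0, 1, 4, 2, 3] else [0, 1, 3, 4, 2])"

abbreviation flip_letter :: "nat \<times> bool \<Rightarrow> nat \<times> bool"
  where "flip_letter l \<equiv> (fst l, \<not> snd l)"

text \<open>Multiplication in the semidirect product: the gallery of each further letter is renamed
  by the permutation \<open>p\<close> accumulated so far. \<open>word_naming\<close> accumulates the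
  inverse permutation.\<close>

fun word_gallery :: "nat list \<Rightarrow> nat word \<Rightarrow> nat list"
  where
    "word_gallery p [] = []"
  | "word_gallery p (l # u) =
       map (nth p) (letter_gallery l) @ word_gallery (compose_list p (letter_naming l)) u"

fun word_naming :: "nat list \<Rightarrow> nat word \<Rightarrow> nat list"
  where
    "word_naming q [] = q"
  | "word_naming q (l # u) = word_naming (compose_list (letter_naming (flip_letter l)) q) u"

definition inverse_lists :: "nat list \<Rightarrow> nat list \<Rightarrow> bool"
  where "inverse_lists p q \<longleftrightarrow> length p = 5 \<and> length q = 5 \<and>
    (\<forall>i<5. p ! i < 5 \<and> q ! i < 5 \<and> q ! (p ! i) = i \<and> p ! (q ! i) = i)"

lemma less5: "i < 5 \<longleftrightarrow> i = 0 \<or> i = 1 \<or> i = 2 \<or> i = 3 \<or> i = (4::nat)"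
  by auto

lemma inverse_lists_compose:
  assumes "inverse_lists p q" "inverse_lists p' q'"
  shows "inverse_lists (compose_list p p') (compose_list q' q)"
  using assms by (auto simp: inverse_lists_def nth_compose_list)

lemma inverse_lists_letter_naming:
  "fst l \<in> fig8_gens \<Longrightarrow> inverse_lists (letter_naming l) (letter_naming (flip_letter l))"
  by (erule fig8_letter_cases) (auto simp: inverse_lists_def less5)

lemma naming_letter_naming: "fst l \<in> fig8_gens \<Longrightarrow> naming (letter_naming l)"
  by (erule fig8_letter_cases) (auto simp: naming_def)

lemma letter_gallery_word:
  assumes l: "fst l \<in> fig8_gens" and pq: "inverse_lists p q"
  shows "fig8_eq (gallery_word True q (map (nth p) (letter_gallery l))) [l]"
    "gallery_end True q (map (nth p) (letter_gallery l)) = compose_list (letter_naming (flip_letter l)) q"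
proof -
  have q: "q ! (p ! 1) = 1" "q ! (p ! 2) = 2" "q ! (p ! 3) = 3" "q ! (p ! 4) = 4"
    "p ! 1 < length q" "p ! 2 < length q" "p ! 3 < length q" "p ! 4 < length q"
    "p ! 1 < 5" "p ! 2 < 5" "p ! 3 < 5" "p ! 4 < 5"
    and ql: "length q = 5" and q5: "\<And>i. i < 5 \<Longrightarrow> q ! i < 5"
    using pq by (auto simp: inverse_lists_def)
  have "free_reduce (gallery_word True q (map (nth p) (letter_gallery l))) = [l]"
    using l by (cases rule: fig8_letter_cases) (simp_all add: q nth_compose_list)
  then show "fig8_eq (gallery_word True q (map (nth p) (letter_gallery l))) [l]"
    using word_eq_free_reduce[OF gallery_word_words] by metis
  have "gallery_end True q (map (nth p) (letter_gallery l)) ! i = compose_list (letter_naming (flip_letter l)) q ! i"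
    if i: "i < 5" for i
  proof -
    have c: "q ! i = 0 \<or> q ! i = 1 \<or> q ! i = 2 \<or> q ! i = 3 \<or> q ! i = 4"
      using q5[OF i] by (simp add: less5)
    show ?thesis
      using l c i ql by (cases rule: fig8_letter_cases) (auto simp: q nth_compose_list)
  qed
  moreover have "length (gallery_end True q (map (nth p) (letter_gallery l))) = 5"
    using l ql by (cases rule: fig8_letter_cases) (auto simp: q nth_compose_list)
  ultimately show "gallery_end True q (map (nth p) (letter_gallery l)) = compose_list (letter_naming (flip_letter l)) q"
    using ql by (intro nth_equalityI) auto
qed

lemma length_letter_gallery [simp]: "length (letter_gallery l) = 2"
  by (cases l) auto

text \<open>A letter gallery renamed by \<open>p\<close> reads as its letter in the inverse naming
  \<open>q\<close>, so a word of the group can be recovered from its gallery.\<close>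

lemma gallery_word_word_gallery:
  assumes "u \<in> words fig8_gens" "inverse_lists p q"
  shows "fig8_eq (gallery_word True q (word_gallery p u)) u"
  using assms
proof (induction u arbitrary: p q)
  case Nil
  then show ?case by (auto intro: word_eq.refl)
next
  case (Cons l u)
  have l: "fst l \<in> fig8_gens" "u \<in> words fig8_gens" using Cons.prems by auto
  note g = letter_gallery_word[OF l(1) Cons.prems(2)]
  have "inverse_lists (compose_list p (letter_naming l)) (compose_list (letter_naming (flip_letter l)) q)"
    by (rule inverse_lists_compose[OF Cons.prems(2) inverse_lists_letter_naming[OF l(1)]])
  from word_eq_append[OF g(1) Cons.IH[OF l(2) this]]
  show ?case by (simp add: gallery_word_append g(2))
qed

lemma word_gallery_set:
  assumes "u \<in> words fig8_gens" "naming p"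
  shows "set (word_gallery p u) \<subseteq> {1..4}"
  using assms
proof (induction u arbitrary: p)
  case (Cons l u)
  have l: "fst l \<in> fig8_gens" "u \<in> words fig8_gens" using Cons.prems by auto
  have "set (letter_gallery l) \<subseteq> {1..4}"
    using l(1) by (cases rule: fig8_letter_cases) auto
  then have "set (map (nth p) (letter_gallery l)) \<subseteq> {1..4}"
    using naming_nth[OF Cons.prems(2)] by (simp only: set_map) blast
  moreover have "set (word_gallery (compose_list p (letter_naming l)) u) \<subseteq> {1..4}"
    using Cons.IH[OF l(2) naming_compose[OF Cons.prems(2) naming_letter_naming[OF l(1)]]] .
  ultimately show ?case by simp
qed simp

section \<open>The linear action of the figure-eight group on four coordinates\<close>

definition eq4 :: "(nat \<Rightarrow> int) \<Rightarrow> (nat \<Rightarrow> int) \<Rightarrow> bool"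
  where "eq4 x y \<longleftrightarrow> x 1 = y 1 \<and> x 2 = y 2 \<and> x 3 = y 3 \<and> x 4 = y 4"

lemma eq4_nth: "eq4 x y \<Longrightarrow> i \<in> {1..4} \<Longrightarrow> x i = y i"
  by (auto simp: eq4_def in14 simp del: atLeastAtMost_iff)

lemma eq4I: "(\<And>i. i \<in> {1..4} \<Longrightarrow> x i = y i) \<Longrightarrow> eq4 x y"
  by (simp add: eq4_def)

lemma tits_refl_cong: "s \<in> {1..4} \<Longrightarrow> eq4 x y \<Longrightarrow> eq4 (tits_refl s x) (tits_refl s y)"
  unfolding in14 by (elim disjE) (auto simp: eq4_def tits_refl_def)

lemma act_cong: "set w \<subseteq> {1..4} \<Longrightarrow> eq4 x y \<Longrightarrow> eq4 (foldr tits_refl w x) (foldr tits_refl w y)"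
  by (induction w) (auto intro: tits_refl_cong simp del: atLeastAtMost_iff)

text \<open>Renaming the faces normalises \<open>T\<close>, because the Tits form is symmetric in
  the four coordinates.\<close>

lemma tits_refl_natural:
  assumes pq: "inverse_lists p q" and n: "naming p" "naming q" and s: "s \<in> {1..4}"
  shows "eq4 (tits_refl (p ! s) (\<lambda>i. z (q ! i))) (\<lambda>i. tits_refl s z (q ! i))"
proof -
  have inv: "q ! (p ! i) = i" "p ! (q ! i) = i" if "i \<in> {1..4}" for i
    using pq that by (auto simp: inverse_lists_def)
  have "bij_betw (nth q) {1..4} {1..4}"
    using inv naming_nth[OF n(1)] naming_nth[OF n(2)]
    by (intro bij_betw_byWitness[of _ "nth p"]) (auto simp del: atLeastAtMost_iff)
  then have "(\<Sum>i\<in>{1..4}. z (q ! i)) = (\<Sum>i\<in>{1..4}. z i)"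
    by (rule sum.reindex_bij_betw)
  moreover have "{1..4} = {1, 2, 3, 4::nat}" by auto
  ultimately have sum: "z (q ! 1) + z (q ! 2) + z (q ! 3) + z (q ! 4) = z 1 + z 2 + z 3 + z 4"
    by (simp add: add.assoc)
  show ?thesis
  proof (rule eq4I)
    fix i :: nat assume i: "i \<in> {1..4}"
    show "tits_refl (p ! s) (\<lambda>i. z (q ! i)) i = tits_refl s z (q ! i)"
      using inv[OF i] inv[OF s] sum by (auto simp: tits_refl_def)
  qed
qed

lemma act_natural:
  assumes pq: "inverse_lists p q" and n: "naming p" "naming q" and w: "set w \<subseteq> {1..4}"
  shows "eq4 (foldr tits_refl (map (nth p) w) (\<lambda>i. z (q ! i))) (\<lambda>i. foldr tits_refl w z (q ! i))"
  using w
proof (induction w)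
  case (Cons s w)
  have "eq4 (tits_refl (p ! s) (foldr tits_refl (map (nth p) w) (\<lambda>i. z (q ! i))))
      (tits_refl (p ! s) (\<lambda>i. foldr tits_refl w z (q ! i)))"
    using Cons naming_nth[OF n(1)] by (intro tits_refl_cong) auto
  moreover have "eq4 (tits_refl (p ! s) (\<lambda>i. foldr tits_refl w z (q ! i)))
      (\<lambda>i. tits_refl s (foldr tits_refl w z) (q ! i))"
    using Cons by (intro tits_refl_natural[OF pq n]) auto
  ultimately show ?case by (simp add: eq4_def)
qed (simp add: eq4_def)

text \<open>The image of a letter under the extension of the Tits representation to
  \<open>T \<rtimes> S_4\<close>, where \<open>S_4\<close> permutes the coordinates.\<close>

definition letter_mat :: "nat \<times> bool \<Rightarrow> (nat \<Rightarrow> int) \<Rightarrow> nat \<Rightarrow> int"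
  where "letter_mat l x = foldr tits_refl (letter_gallery l) (\<lambda>i. x (letter_naming (flip_letter l) ! i))"

lemma letter_mat_cong:
  assumes "fst l \<in> fig8_gens" "eq4 x y" shows "eq4 (letter_mat l x) (letter_mat l y)"
  using assms(1) assms(2) by (cases rule: fig8_letter_cases) (auto simp: letter_mat_def eq4_def tits_refl_def)

text \<open>Coordinate permutations can be moved past reflections by \<open>act_natural\<close>;
  this collects the product of the letter maps into one gallery acting on one permuted
  vector.\<close>

lemma word_gallery_act:
  assumes "u \<in> words fig8_gens" "inverse_lists p q" "naming p" "naming q"
  shows "eq4 (foldr tits_refl (word_gallery p u) (\<lambda>i. x (word_naming q u ! i)))
    (\<lambda>i. foldr letter_mat u x (q ! i))"
  using assms
proof (induction u arbitrary: p q)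
  case (Cons l u)
  have l: "fst l \<in> fig8_gens" "fst (flip_letter l) \<in> fig8_gens" "u \<in> words fig8_gens"
    using Cons.prems by auto
  let ?p = "compose_list p (letter_naming l)" and ?q = "compose_list (letter_naming (flip_letter l)) q"
  let ?w = "map (nth p) (letter_gallery l)" and ?y = "foldr letter_mat u x"
  have lg: "set (letter_gallery l) \<subseteq> {1..4}"
    using l(1) by (cases rule: fig8_letter_cases) auto
  then have w: "set ?w \<subseteq> {1..4}"
    using naming_nth[OF Cons.prems(3)] by (simp only: set_map) blast
  have 1: "eq4 (foldr tits_refl (word_gallery ?p u) (\<lambda>i. x (word_naming ?q u ! i))) (\<lambda>i. ?y (?q ! i))"
    using Cons.prems l
    by (intro Cons.IH inverse_lists_compose inverse_lists_letter_naming naming_compose naming_letter_naming)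
  have "eq4 (\<lambda>i. ?y (?q ! i)) (\<lambda>i. ?y (letter_naming (flip_letter l) ! (q ! i)))"
    using naming_length[OF Cons.prems(4)] by (auto simp: eq4_def nth_compose_list)
  with 1 have "eq4 (foldr tits_refl (word_gallery ?p u) (\<lambda>i. x (word_naming ?q u ! i)))
      (\<lambda>i. ?y (letter_naming (flip_letter l) ! (q ! i)))"
    by (simp add: eq4_def)
  from act_cong[OF w this] act_natural[OF Cons.prems(2-4) lg, of "\<lambda>i. ?y (letter_naming (flip_letter l) ! i)"]
  show ?case by (simp add: eq4_def letter_mat_def[of l ?y] del: letter_naming.simps)
qed (simp add: eq4_def)

lemma naming_word_naming: "u \<in> words fig8_gens \<Longrightarrow> naming q \<Longrightarrow> naming (word_naming q u)"
proof (induction u arbitrary: q)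
  case (Cons l u)
  have l: "fst (flip_letter l) \<in> fig8_gens" "u \<in> words fig8_gens" using Cons.prems by auto
  show ?case
    using Cons.IH[OF l(2) naming_compose[OF naming_letter_naming[OF l(1)] Cons.prems(2)]]
    by (simp del: letter_naming.simps)
qed simp

text \<open>If \<open>u\<close> acts trivially, its gallery acts on the four coordinates as a
  permutation, hence sends simple roots to simple roots and is trivial in \<open>T\<close> by Tits.
  The label of the gallery, which is \<open>u\<close>, is then trivial as well.\<close>

lemma fig8_faithful:
  assumes u: "u \<in> words fig8_gens" and id: "\<And>x. eq4 (foldr letter_mat u x) x"
  shows "fig8_eq u []"
proof -
  let ?i = "[0, 1, 2, 3, 4::nat]"
  have i: "inverse_lists ?i ?i" "naming ?i"
    by (auto simp: inverse_lists_def less5 naming_def)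
  define w where "w = word_gallery ?i u"
  define q where "q = word_naming ?i u"
  have w4: "set w \<subseteq> {1..4}" unfolding w_def by (rule word_gallery_set[OF u i(2)])
  have q: "naming q" unfolding q_def by (rule naming_word_naming[OF u i(2)])
  have act: "eq4 (foldr tits_refl w (\<lambda>i. x (q ! i))) x" for x
    using word_gallery_act[OF u i(1) i(2) i(2), of x] id[of x] unfolding w_def q_def
    by (simp add: eq4_def)
  have "foldr tits_refl w (unit_vec s) i \<ge> 0" if s: "s \<in> {1..4}" and i: "i \<in> {1..4}" for s i
  proof -
    have "eq4 (\<lambda>i. unit_vec (q ! s) (q ! i)) (unit_vec s)"
      using naming_nth_neq[OF q _ s] by (intro eq4I) (auto simp: unit_vec_def)
    from act_cong[OF w4 this] act[of "unit_vec (q ! s)"]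
    have "eq4 (foldr tits_refl w (unit_vec s)) (unit_vec (q ! s))"
      by (simp add: eq4_def)
    from eq4_nth[OF this i] show ?thesis by (simp add: unit_vec_def)
  qed
  then have "cox_eq w []" by (rule tits_faithful[OF w4])
  from gallery_cox_eq[OF this i(2), of True] have "fig8_eq (gallery_word True ?i w) []" by simp
  moreover have "fig8_eq (gallery_word True ?i w) u"
    unfolding w_def by (rule gallery_word_word_gallery[OF u i(1)])
  ultimately show ?thesis by (blast intro: word_eq.sym word_eq.trans)
qed

section \<open>Walls\<close>

text \<open>A natural number, because \<open>C_special\<close> asks for graphs on the naturals;
  \<open>set_encode\<close> makes it symmetric in \<open>i\<close> and \<open>j\<close>.\<close>

definition wall :: "nat \<Rightarrow> nat \<Rightarrow> nat"
  where "wall i j = set_encode {i, j}"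

definition walls :: "nat set"
  where "walls = {wall i j | i j. i < 5 \<and> j < 5 \<and> i \<noteq> j}"

definition wall_crossings :: "nat set set"
  where "wall_crossings =
    {{wall i j, wall i k} | i j k. i < 5 \<and> j < 5 \<and> k < 5 \<and> i \<noteq> j \<and> i \<noteq> k \<and> j \<noteq> k}"

definition racg_relators :: "'v set \<Rightarrow> 'v set set \<Rightarrow> 'v word set"
  where "racg_relators V E = {[(r, True), (r, True)] | r. r \<in> V} \<union>
       {[(r, True), (s, True), (r, True), (s, True)] | r s. {r, s} \<in> E}"

lemma racg_eq_presented: "racg V E = presented_group V (racg_relators V E)"
  by (simp add: racg_def racg_relators_def)

abbreviation wall_eq :: "nat word \<Rightarrow> nat word \<Rightarrow> bool"
  where "wall_eq \<equiv> word_eq walls (racg_relators walls wall_crossings)"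

lemma set_decode_wall [simp]: "set_decode (wall i j) = {i, j}"
  by (simp add: wall_def)

lemma wall_in [simp]: "i < 5 \<Longrightarrow> j < 5 \<Longrightarrow> i \<noteq> j \<Longrightarrow> wall i j \<in> walls"
  by (auto simp: walls_def)

lemma wall_eq_iff: "wall i j = wall k l \<longleftrightarrow> {i, j} = {k, l}"
  by (metis set_decode_wall wall_def)

lemma finite_simple_graph_walls: "finite_simple_graph walls wall_crossings"
proof -
  have "walls \<subseteq> (\<lambda>(i, j). wall i j) ` ({..<5} \<times> {..<5})"
    by (auto simp: walls_def)
  then have "finite walls" by (rule finite_subset) auto
  moreover have "e \<subseteq> walls \<and> card e = 2" if "e \<in> wall_crossings" for e
    using that by (auto simp: wall_crossings_def wall_eq_iff doubleton_eq_iff)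
  ultimately show ?thesis by (auto simp: finite_simple_graph_def)
qed

section \<open>The Lorentzian action of the walls\<close>

definition total5 :: "(nat \<Rightarrow> int) \<Rightarrow> int"
  where "total5 x = x 0 + x 1 + x 2 + x 3 + x 4"

text \<open>
  The reflection in the norm 1 vector \<open>e\<^sub>i + e\<^sub>j\<close> for the Lorentzian form
  \<open>\<Sum>x\<^sub>i\<^sup>2 - (\<Sum>x\<^sub>i)\<^sup>2 / 4\<close>.
\<close>

definition wall_refl :: "nat \<Rightarrow> (nat \<Rightarrow> int) \<Rightarrow> nat \<Rightarrow> int"
  where "wall_refl e x i =
    x i + (if i \<in> set_decode e then total5 x - 2 * sum x (set_decode e) else 0)"

lemma wall_refl_wall:
  "i \<noteq> j \<Longrightarrow> wall_refl (wall i j) x k = x k + (if k = i \<or> k = j then total5 x - 2 * (x i + x j) else 0)"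
  by (auto simp: wall_refl_def)

lemma total5_wall_refl:
  assumes "i < 5" "j < 5" "i \<noteq> j"
  shows "total5 (wall_refl (wall i j) x) = 3 * total5 x - 4 * (x i + x j)"
proof -
  have "total5 (wall_refl (wall i j) x) = total5 x + 2 * (total5 x - 2 * (x i + x j))"
    unfolding total5_def[of "wall_refl (wall i j) x"] wall_refl_wall[OF assms(3)]
    using assms by (auto simp: less5 total5_def)
  then show ?thesis by simp
qed

lemma wall_refl_refl:
  "i < 5 \<Longrightarrow> j < 5 \<Longrightarrow> i \<noteq> j \<Longrightarrow> wall_refl (wall i j) (wall_refl (wall i j) x) = x"
  by (rule ext) (auto simp: wall_refl_wall total5_wall_refl)

lemma wall_refl_commute:
  assumes "i < 5" "j < 5" "k < 5" "i \<noteq> j" "i \<noteq> k" "j \<noteq> k"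
  shows "wall_refl (wall i j) (wall_refl (wall i k) x) = wall_refl (wall i k) (wall_refl (wall i j) x)"
  by (rule ext) (use assms in \<open>auto simp: wall_refl_wall total5_wall_refl\<close>)

text \<open>The form gives \<open>e_i + e_j\<close> and \<open>e_i + e_k\<close> the product
  \<open>1 - 2 * 2 / 4 = 0\<close>, so walls that meet have commuting reflections. A letter and its
  formal inverse act by the same involution, which is why the exponents are dropped.\<close>

lemma wall_eq_act:
  assumes "wall_eq u v"
  shows "foldr (\<lambda>l. wall_refl (fst l)) u x = foldr (\<lambda>l. wall_refl (fst l)) v x"
  using assms
proof (induction arbitrary: x rule: word_eq.induct)
  case (sym u v)
  from sym.IH[symmetric] show ?case .
next
  case (trans u v w)
  show ?case unfolding trans.IH ..
next
  case (cancel u v e b)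
  then obtain i j where "e = wall i j" "i < 5" "j < 5" "i \<noteq> j" by (auto simp: walls_def)
  then show ?case by (simp add: wall_refl_refl)
next
  case (relator u v r)
  from relator.hyps(3) consider e where "r = [(e, True), (e, True)]" "e \<in> walls"
    | e f where "r = [(e, True), (f, True), (e, True), (f, True)]" "{e, f} \<in> wall_crossings"
    by (auto simp: racg_relators_def)
  then have "foldr (\<lambda>l. wall_refl (fst l)) r y = y" for y
  proof cases
    case 1
    then show ?thesis by (auto simp: walls_def wall_refl_refl)
  next
    case 2
    then obtain i j k where ijk: "i < 5" "j < 5" "k < 5" "i \<noteq> j" "i \<noteq> k" "j \<noteq> k"
      and "{e, f} = {wall i j, wall i k}"
      by (auto simp: wall_crossings_def)
    then have "e = wall i j \<and> f = wall i k \<or> e = wall i k \<and> f = wall i j"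
      by (simp add: doubleton_eq_iff)
    then show ?thesis
      using 2(1) ijk by (auto simp: wall_refl_refl wall_refl_commute[OF ijk])
  qed
  then show ?case by (simp only: foldr_append)
qed simp

text \<open>Replace each \<open>s_a\<close> in \<open>letter_gallery\<close> by the wall
  \<open>{0, a}\<close> followed by \<open>(0 a)\<close> and move the transpositions to the right:
  \<open>s_a s_b\<close> becomes the walls \<open>{0, a}\<close>, \<open>{a, b}\<close> followed by
  \<open>(0 a) (0 b)\<close>.\<close>

fun letter_walls :: "nat \<times> bool \<Rightarrow> (nat \<times> nat) list"
  where "letter_walls (x, b) =
    (if x = 0 then if b then [(0, 1), (1, 2)] else [(3, 0), (2, 3)]
     else if b then [(0, 2), (2, 3)] else [(4, 0), (3, 4)])"

text \<open>The permutation of five indices left over from the two transpositions and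
  \<open>letter_naming\<close>. It is the involution \<open>(0 2) (1 3)\<close> or
  \<open>(0 3) (2 4)\<close>, hence the same for a letter and its inverse. The product of the two
  involutions is a 5-cycle, so they generate a dihedral group of order 10.\<close>

definition letter_types :: "nat \<times> bool \<Rightarrow> nat list"
  where "letter_types l = (if fst l = 0 then [2, 3, 0, 1, 4] else [3, 1, 4, 0, 2])"

abbreviation wall_letter :: "nat list \<Rightarrow> nat \<times> nat \<Rightarrow> nat \<times> bool"
  where "wall_letter p e \<equiv> (wall (p ! fst e) (p ! snd e), True)"

fun wall_word :: "nat list \<Rightarrow> nat word \<Rightarrow> nat word"
  where
    "wall_word p [] = []"
  | "wall_word p (l # u) = map (wall_letter p) (letter_walls l) @ wall_word (compose_list p (letter_types l)) u"

text \<open>The word of walls before encoding, in a form that can be reduced by evaluation.\<close>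

fun wall_pairs :: "nat list \<Rightarrow> nat word \<Rightarrow> (nat \<times> nat) list"
  where
    "wall_pairs p [] = []"
  | "wall_pairs p (l # u) = map (\<lambda>(i, j). (p ! i, p ! j)) (letter_walls l) @ wall_pairs (compose_list p (letter_types l)) u"

fun word_types :: "nat list \<Rightarrow> nat word \<Rightarrow> nat list"
  where
    "word_types p [] = p"
  | "word_types p (l # u) = word_types (compose_list p (letter_types l)) u"

lemma wall_word_append: "wall_word p (u @ v) = wall_word p u @ wall_word (word_types p u) v"
  by (induction p u rule: word_types.induct) auto

lemma word_types_append: "word_types p (u @ v) = word_types (word_types p u) v"
  by (induction p u rule: word_types.induct) auto

definition types :: "nat list \<Rightarrow> bool"
  where "types p \<longleftrightarrow> length p = 5 \<and> distinct p \<and> set p \<subseteq> {..<5}"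

lemma types_nth: "types p \<Longrightarrow> i < 5 \<Longrightarrow> p ! i < 5"
  using nth_mem[of i p] unfolding types_def by fastforce

lemma types_nth_eq_iff: "types p \<Longrightarrow> i < 5 \<Longrightarrow> j < 5 \<Longrightarrow> p ! i = p ! j \<longleftrightarrow> i = j"
  by (simp add: types_def nth_eq_iff_index_eq)

lemma types_compose:
  assumes p: "types p" and q: "types q"
  shows "types (compose_list p q)"
proof -
  have q5: "i < 5" if "i \<in> set q" for i
    using q that unfolding types_def by blast
  have "inj_on (nth p) (set q)"
    using types_nth_eq_iff[OF p] q5 by (simp add: inj_on_def)
  moreover have "set (map (nth p) q) \<subseteq> {..<5}"
    using types_nth[OF p] q5 by auto
  ultimately show ?thesis
    using q unfolding types_def compose_list_def by (simp add: distinct_map)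
qed

lemma types_letter_types [simp]: "types (letter_types l)"
  by (auto simp: types_def letter_types_def)

lemma types_word_types: "types p \<Longrightarrow> types (word_types p u)"
  by (induction p u rule: word_types.induct) (simp_all add: types_compose)

lemma letter_walls_range: "(i, j) \<in> set (letter_walls l) \<Longrightarrow> i < 5 \<and> j < 5 \<and> i \<noteq> j"
  by (cases l) (auto split: if_splits)

lemma wall_letter_words:
  "types p \<Longrightarrow> \<forall>(i, j)\<in>set w. i < 5 \<and> j < 5 \<and> i \<noteq> j \<Longrightarrow> map (wall_letter p) w \<in> words walls"
  by (induction w) (auto simp: types_nth types_nth_eq_iff)

lemma wall_word_words: "types p \<Longrightarrow> wall_word p u \<in> words walls"
proof (induction p u rule: wall_word.induct)
  case (2 p l u)
  have "\<forall>(i, j)\<in>set (letter_walls l). i < 5 \<and> j < 5 \<and> i \<noteq> j"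
    using letter_walls_range by blast
  from wall_letter_words[OF 2(2) this] 2 show ?case
    by (simp add: types_compose del: letter_walls.simps)
qed simp

lemma nth_compose5: "types q \<Longrightarrow> i < 5 \<Longrightarrow> compose_list p q ! i = p ! (q ! i)"
  by (simp add: nth_compose_list types_def)

lemma compose_assoc: "types r \<Longrightarrow> types q \<Longrightarrow> compose_list (compose_list p q) r = compose_list p (compose_list q r)"
  using types_nth[of r] by (intro nth_equalityI) (auto simp: nth_compose_list types_def)

lemma wall_word_pairs:
  assumes "types q"
  shows "wall_word (compose_list p q) u = map (wall_letter p) (wall_pairs q u)"
  using assms
proof (induction u arbitrary: q)
  case (Cons l u)
  have "map (wall_letter (compose_list p q)) (letter_walls l) =
      map (wall_letter p) (map (\<lambda>(i, j). (q ! i, q ! j)) (letter_walls l))"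
    using letter_walls_range[of _ _ l] nth_compose5[OF Cons.prems]
    by (auto simp del: letter_walls.simps)
  then show ?case
    using Cons by (simp add: compose_assoc types_compose del: letter_walls.simps)
qed simp

text \<open>Looks for a copy of the given wall that can be brought to the front: every wall before
  it must share exactly one index with it and so commutes with it. The result is what remains after
  the two copies have cancelled.\<close>

fun extract_wall :: "nat \<times> nat \<Rightarrow> (nat \<times> nat) list \<Rightarrow> (nat \<times> nat) list option"
  where
    "extract_wall e [] = None"
  | "extract_wall (i, j) ((k, l) # w) =
      (if i = k \<and> j = l \<or> i = l \<and> j = k then Some w
       else if i = k \<or> i = l \<or> j = k \<or> j = l then map_option (Cons (k, l)) (extract_wall (i, j) w)
       else None)"

fun wall_reduce :: "(nat \<times> nat) list \<Rightarrow> (nat \<times> nat) list"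
  where
    "wall_reduce [] = []"
  | "wall_reduce (e # w) = (case extract_wall e (wall_reduce w) of None \<Rightarrow> e # wall_reduce w | Some v \<Rightarrow> v)"

abbreviation pairs_ok :: "(nat \<times> nat) list \<Rightarrow> bool"
  where "pairs_ok w \<equiv> \<forall>(i, j)\<in>set w. i < 5 \<and> j < 5 \<and> i \<noteq> j"

lemma wall_commute:
  assumes "{e, f} \<in> wall_crossings" "e \<in> walls" "f \<in> walls"
  shows "wall_eq [(f, True), (e, True)] [(e, True), (f, True)]"
proof -
  let ?e = "(e, True)" and ?f = "(f, True)"
  have sq: "wall_eq [?e, ?e] []" "wall_eq [?f, ?f] []"
    and ef: "wall_eq [?e, ?f, ?e, ?f] []"
    using word_eq.relator[of "[]" walls "[]" "[?e, ?e]"] word_eq.relator[of "[]" walls "[]" "[?f, ?f]"]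
      word_eq.relator[of "[]" walls "[]" "[?e, ?f, ?e, ?f]"] assms
    by (auto simp: racg_relators_def)
  have r: "wall_eq w w" if "w \<in> words walls" for w using that by (rule word_eq.refl)
  have "wall_eq ([?e, ?e] @ [?f, ?e] @ [?f, ?f]) ([] @ [?f, ?e] @ [])"
    using assms by (intro word_eq_append sq r) auto
  moreover have "wall_eq ([?e] @ [?e, ?f, ?e, ?f] @ [?f]) ([?e] @ [] @ [?f])"
    using assms by (intro word_eq_append ef r) auto
  ultimately show ?thesis by (auto intro: word_eq.sym word_eq.trans)
qed

lemma wall_commute_pairs:
  assumes "a < 5" "b < 5" "c < 5" "d < 5" "a \<noteq> b" "c \<noteq> d" "a = c \<or> a = d \<or> b = c \<or> b = d" "{a, b} \<noteq> {c, d}"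
  shows "{wall a b, wall c d} \<in> wall_crossings"
proof -
  have sw: "wall i j = wall j i" for i j by (simp add: wall_eq_iff insert_commute)
  have "\<exists>i j k. {wall a b, wall c d} = {wall i j, wall i k} \<and> i < 5 \<and> j < 5 \<and> k < 5 \<and> i \<noteq> j \<and> i \<noteq> k \<and> j \<noteq> k"
    using assms(7)
  proof (elim disjE)
    assume "a = c" then show ?thesis using assms by (intro exI[of _ a] exI[of _ b] exI[of _ d]) auto
  next
    assume "a = d" then show ?thesis using assms sw[of c d] by (intro exI[of _ a] exI[of _ b] exI[of _ c]) auto
  next
    assume "b = c" then show ?thesis using assms sw[of a b] by (intro exI[of _ b] exI[of _ a] exI[of _ d]) auto
  next
    assume "b = d" then show ?thesis
      using assms sw[of a b] sw[of c d] by (intro exI[of _ b] exI[of _ a] exI[of _ c]) auto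
  qed
  then show ?thesis unfolding wall_crossings_def by blast
qed

lemma extract_wall:
  assumes p: "types p" and "extract_wall e w = Some v" "pairs_ok (e # w)"
  shows "wall_eq (map (wall_letter p) (e # w)) (map (wall_letter p) v) \<and> pairs_ok v"
  using assms(2,3)
proof (induction e w arbitrary: v rule: extract_wall.induct)
  case (2 i j k l w)
  let ?L = "wall_letter p"
  have ij: "i < 5" "j < 5" "i \<noteq> j" "k < 5" "l < 5" "k \<noteq> l" "pairs_ok w"
    using 2(3) by auto
  note nth = types_nth[OF p] types_nth_eq_iff[OF p]
  have W: "map ?L w \<in> words walls" by (rule wall_letter_words[OF p ij(7)])
  consider "{i, j} = {k, l}"
    | v' where "{i, j} \<noteq> {k, l}" "i = k \<or> i = l \<or> j = k \<or> j = l"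
      "extract_wall (i, j) w = Some v'" "v = (k, l) # v'"
    using 2(2) by (auto split: if_splits simp: doubleton_eq_iff)
  then show ?case
  proof cases
    case 1
    then have "v = w" using 2(2) by (auto simp: doubleton_eq_iff)
    have "?L (k, l) = ?L (i, j)"
      using 1 by (auto simp: doubleton_eq_iff wall_eq_iff)
    moreover have "wall_eq ([] @ [?L (i, j), ?L (i, j)] @ map ?L w) ([] @ map ?L w)"
      using ij W by (intro word_eq.relator) (auto simp: racg_relators_def nth)
    ultimately show ?thesis using \<open>v = w\<close> ij by simp
  next
    case (2 v')
    have IH: "wall_eq (map ?L ((i, j) # w)) (map ?L v') \<and> pairs_ok v'"
      using "2.IH"[OF _ 2(2) 2(3)] 2(1) ij by (auto simp: doubleton_eq_iff)
    have "{wall (p ! i) (p ! j), wall (p ! k) (p ! l)} \<in> wall_crossings"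
      using ij 2 by (intro wall_commute_pairs) (auto simp: nth doubleton_eq_iff)
    then have "{wall (p ! k) (p ! l), wall (p ! i) (p ! j)} \<in> wall_crossings"
      by (simp add: insert_commute)
    from wall_commute[OF this] have "wall_eq [?L (i, j), ?L (k, l)] [?L (k, l), ?L (i, j)]"
      using ij by (simp add: nth)
    then have "wall_eq ([?L (i, j), ?L (k, l)] @ map ?L w) ([?L (k, l), ?L (i, j)] @ map ?L w)"
      using W by (intro word_eq_append word_eq.refl)
    moreover have "wall_eq ([?L (k, l)] @ map ?L ((i, j) # w)) ([?L (k, l)] @ map ?L v')"
      using IH ij by (intro word_eq_append word_eq.refl) (auto simp: nth)
    ultimately show ?thesis
      using IH ij 2(4) by (auto intro: word_eq.trans)
  qed
qed simp

lemma wall_reduce: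
  assumes p: "types p" and "pairs_ok w"
  shows "wall_eq (map (wall_letter p) w) (map (wall_letter p) (wall_reduce w)) \<and> pairs_ok (wall_reduce w)"
  using assms(2)
proof (induction w)
  case Nil
  then show ?case by (auto intro: word_eq.refl)
next
  case (Cons e w)
  then have IH: "wall_eq (map (wall_letter p) w) (map (wall_letter p) (wall_reduce w))" "pairs_ok (wall_reduce w)"
    by auto
  have e: "[wall_letter p e] \<in> words walls"
    using wall_letter_words[OF p, of "[e]"] Cons.prems by simp
  from word_eq_append[OF word_eq.refl[OF e] IH(1)]
  have 1: "wall_eq (map (wall_letter p) (e # w)) (map (wall_letter p) (e # wall_reduce w))" by simp
  show ?case
  proof (cases "extract_wall e (wall_reduce w)")
    case None
    then show ?thesis using 1 IH(2) Cons.prems by simp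
  next
    case (Some v)
    have "pairs_ok (e # wall_reduce w)" using IH(2) Cons.prems by simp
    from extract_wall[OF p Some this] 1 show ?thesis
      unfolding wall_reduce.simps Some option.case by (blast intro: word_eq.trans)
  qed
qed

lemma wall_relator_check:
  "wall_reduce (wall_pairs [0, 1, 2, 3, 4] fig8_relator) = [] \<and>
   word_types [0, 1, 2, 3, 4] fig8_relator = [0, 1, 2, 3, 4] \<and>
   (\<forall>(i, j)\<in>set (wall_pairs [0, 1, 2, 3, 4] fig8_relator). i < 5 \<and> j < 5 \<and> i \<noteq> j)"
  by code_simp

abbreviation id5 :: "nat list"
  where "id5 \<equiv> [0, 1, 2, 3, 4]"

lemma types_id5: "types id5"
  by (auto simp: types_def)

lemma compose_id5: "types p \<Longrightarrow> compose_list p id5 = p"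
proof (rule nth_equalityI)
  fix i assume "i < length (compose_list p id5)"
  then have "i < 5" by simp
  then show "compose_list p id5 ! i = p ! i" by (auto simp: less5 nth_compose_list)
qed (simp add: types_def)

lemma word_types_compose: "types q \<Longrightarrow> word_types (compose_list p q) u = compose_list p (word_types q u)"
proof (induction u arbitrary: q)
  case (Cons l u)
  then show ?case by (simp add: compose_assoc types_compose)
qed simp

text \<open>The graph of walls is symmetric under \<open>S_5\<close>, so a reduction evaluated at
  the identity permutation remains valid after renaming by any \<open>p\<close>.\<close>

lemma wall_eq_trivial:
  assumes p: "types p" and w: "wall_reduce (wall_pairs id5 w) = [] \<and> word_types id5 w = id5 \<and>
    pairs_ok (wall_pairs id5 w)"
  shows "wall_eq (wall_word p w) []" "word_types p w = p"
proof -
  have "wall_word p w = map (wall_letter p) (wall_pairs id5 w)"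
    using wall_word_pairs[OF types_id5, of p w] compose_id5[OF p] by simp
  then show "wall_eq (wall_word p w) []"
    using wall_reduce[OF p, of "wall_pairs id5 w"] w by simp
  show "word_types p w = p"
    using word_types_compose[OF types_id5, of p w] compose_id5[OF p] w by simp
qed

lemma wall_cancel_check:
  "\<forall>x\<in>{0, 1}. \<forall>b\<in>{True, False}.
     wall_reduce (wall_pairs id5 [(x, b), (x, \<not> b)]) = [] \<and>
     word_types id5 [(x, b), (x, \<not> b)] = id5 \<and>
     (\<forall>(i, j)\<in>set (wall_pairs id5 [(x, b), (x, \<not> b)]). i < 5 \<and> j < 5 \<and> i \<noteq> j)"
  by code_simp

lemma fig8_eq_wall_eq:
  assumes "fig8_eq u v" "types p"
  shows "wall_eq (wall_word p u) (wall_word p v) \<and> word_types p u = word_types p v"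
  using assms
proof (induction arbitrary: p rule: word_eq.induct)
  case (refl w)
  then show ?case using wall_word_words by (auto intro: word_eq.refl)
next
  case (sym u v)
  then show ?case by (metis word_eq.sym)
next
  case (trans u v w)
  then show ?case by (metis word_eq.trans)
next
  case (cancel u v x b)
  let ?p = "word_types p u" and ?w = "[(x, b), (x, \<not> b)]"
  have xb: "x \<in> {0, 1}" "b \<in> {True, False}" using cancel by (auto simp: fig8_gens_def)
  note t = wall_eq_trivial[OF types_word_types[OF cancel.prems] bspec[OF bspec[OF wall_cancel_check xb(1)] xb(2)]]
  have "wall_eq (wall_word p u @ wall_word ?p ?w @ wall_word ?p v) (wall_word p u @ [] @ wall_word ?p v)"
    using cancel by (intro word_eq_append word_eq.refl t wall_word_words types_word_types)
  then show ?case
    unfolding wall_word_append word_types_append t(2) by (simp only: append_Nil simp_thms)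
next
  case (relator u v r)
  let ?p = "word_types p u"
  have r: "r = fig8_relator" using relator by simp
  note t = wall_eq_trivial[OF types_word_types[OF relator.prems] wall_relator_check, folded r]
  have "wall_eq (wall_word p u @ wall_word ?p r @ wall_word ?p v) (wall_word p u @ [] @ wall_word ?p v)"
    using relator by (intro word_eq_append word_eq.refl t wall_word_words types_word_types)
  then show ?case
    unfolding wall_word_append word_types_append t(2) by (simp only: append_Nil simp_thms)
qed

section \<open>Comparison of the Lorentzian action with the Tits representation\<close>

definition eq5 :: "(nat \<Rightarrow> int) \<Rightarrow> (nat \<Rightarrow> int) \<Rightarrow> bool"
  where "eq5 x y \<longleftrightarrow> (\<forall>i<5. x i = y i)"

lemma eq5_trans: "eq5 x y \<Longrightarrow> eq5 y z \<Longrightarrow> eq5 x z"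
  by (simp add: eq5_def)

lemma total5_cong: "eq5 x y \<Longrightarrow> total5 x = total5 y"
  by (simp add: eq5_def total5_def)

lemma wall_refl_cong: "e \<in> walls \<Longrightarrow> eq5 x y \<Longrightarrow> eq5 (wall_refl e x) (wall_refl e y)"
  using total5_cong[of x y] by (auto simp: walls_def eq5_def wall_refl_wall)

lemma wall_act_cong: "w \<in> words walls \<Longrightarrow> eq5 x y \<Longrightarrow>
    eq5 (foldr (\<lambda>l. wall_refl (fst l)) w x) (foldr (\<lambda>l. wall_refl (fst l)) w y)"
  by (induction w) (auto intro: wall_refl_cong)

lemma total5_natural:
  assumes pq: "inverse_lists p q"
  shows "total5 (\<lambda>k. z (q ! k)) = total5 z"
proof -
  have "bij_betw (nth q) {..<5} {..<5}"
    using pq by (intro bij_betw_byWitness[of _ "nth p"]) (auto simp: inverse_lists_def)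
  then have "(\<Sum>i<5. z (q ! i)) = (\<Sum>i<5. z i)"
    by (rule sum.reindex_bij_betw)
  moreover have "{..<5} = {0, 1, 2, 3, 4::nat}" by auto
  ultimately show ?thesis by (simp add: total5_def add.assoc)
qed

lemma wall_refl_natural:
  assumes pq: "inverse_lists p q" and ij: "i < 5" "j < 5" "i \<noteq> j"
  shows "eq5 (wall_refl (wall (p ! i) (p ! j)) (\<lambda>k. z (q ! k))) (\<lambda>k. wall_refl (wall i j) z (q ! k))"
proof -
  have inv: "q ! (p ! i) = i" "p ! (q ! i) = i" if "i < 5" for i
    using pq that by (auto simp: inverse_lists_def)
  have ne: "p ! i \<noteq> p ! j" using inv(1)[OF ij(1)] inv(1)[OF ij(2)] ij(3) by metis
  have "q ! k = i \<longleftrightarrow> k = p ! i" "q ! k = j \<longleftrightarrow> k = p ! j" if "k < 5" for k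
    using inv that ij by metis+
  then show ?thesis
    using total5_natural[OF pq, of z] inv ij ne by (auto simp: eq5_def wall_refl_wall)
qed

definition letter_lorentz :: "nat \<times> bool \<Rightarrow> (nat \<Rightarrow> int) \<Rightarrow> nat \<Rightarrow> int"
  where "letter_lorentz l x =
    foldr (\<lambda>e. wall_refl (wall (fst e) (snd e))) (letter_walls l) (\<lambda>k. x (letter_types l ! k))"

text \<open>The reason for working modulo \<open>e_0\<close>: after the transposition
  \<open>(0 a)\<close>, the reflection in \<open>{0, a}\<close> gives the new entry
  \<open>x 0 + total5 x - 2 * (x 0 + x a)\<close>, from which \<open>x 0\<close> drops out, and this
  is the entry of \<open>tits_refl a x\<close>.\<close>

lemma letter_lorentz_eq4:
  assumes "fst l \<in> fig8_gens"
  shows "eq4 (letter_lorentz l x) (letter_mat l x)"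
  using assms
  by (cases rule: fig8_letter_cases)
     (simp_all add: eq4_def letter_lorentz_def letter_mat_def letter_types_def wall_refl_wall
        total5_wall_refl total5_def[of "\<lambda>k. x (_ ! k)"] tits_refl_def)

lemma eq4_trans: "eq4 x y \<Longrightarrow> eq4 y z \<Longrightarrow> eq4 x z"
  by (simp add: eq4_def)

lemma word_lorentz_eq4:
  assumes "u \<in> words fig8_gens"
  shows "eq4 (foldr letter_lorentz u x) (foldr letter_mat u x)"
  using assms
proof (induction u)
  case (Cons l u)
  then have g: "fst l \<in> fig8_gens" and "eq4 (foldr letter_lorentz u x) (foldr letter_mat u x)" by auto
  from eq4_trans[OF letter_lorentz_eq4[OF g] letter_mat_cong[OF this]]
  show ?case by simp
qed (simp add: eq4_def)

fun word_types_inv :: "nat list \<Rightarrow> nat word \<Rightarrow> nat list"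
  where
    "word_types_inv q [] = q"
  | "word_types_inv q (l # u) = word_types_inv (compose_list (letter_types l) q) u"

lemma inverse_lists_letter_types: "inverse_lists (letter_types l) (letter_types l)"
  by (auto simp: inverse_lists_def letter_types_def less5)

lemma inverse_lists_word_types:
  "inverse_lists p q \<Longrightarrow> inverse_lists (word_types p u) (word_types_inv q u)"
proof (induction u arbitrary: p q)
  case (Cons l u)
  show ?case
    using Cons.IH[OF inverse_lists_compose[OF Cons.prems inverse_lists_letter_types]] by simp
qed simp

lemma walls_natural:
  assumes pq: "inverse_lists p q" and p: "types p" and w: "pairs_ok w"
  shows "eq5 (foldr (\<lambda>l. wall_refl (fst l)) (map (wall_letter p) w) (\<lambda>k. z (q ! k)))
    (\<lambda>k. foldr (\<lambda>e. wall_refl (wall (fst e) (snd e))) w z (q ! k))"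
  using w
proof (induction w)
  case (Cons e w)
  obtain i j where e: "e = (i, j)" by fastforce
  have ij: "i < 5" "j < 5" "i \<noteq> j" using Cons.prems e by auto
  have "wall (p ! i) (p ! j) \<in> walls"
    using ij p by (simp add: types_nth types_nth_eq_iff)
  from wall_refl_cong[OF this Cons.IH] Cons.prems
  have "eq5 (wall_refl (wall (p ! i) (p ! j)) (foldr (\<lambda>l. wall_refl (fst l)) (map (wall_letter p) w) (\<lambda>k. z (q ! k))))
    (wall_refl (wall (p ! i) (p ! j)) (\<lambda>k. foldr (\<lambda>e. wall_refl (wall (fst e) (snd e))) w z (q ! k)))"
    by simp
  from eq5_trans[OF this wall_refl_natural[OF pq ij]] show ?case by (simp add: e)
qed (simp add: eq5_def)

lemma wall_word_act:
  assumes "inverse_lists p q" "types p"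
  shows "eq5 (foldr (\<lambda>l. wall_refl (fst l)) (wall_word p u) (\<lambda>k. x (word_types_inv q u ! k)))
    (\<lambda>k. foldr letter_lorentz u x (q ! k))"
  using assms
proof (induction u arbitrary: p q)
  case (Cons l u)
  let ?p = "compose_list p (letter_types l)" and ?q = "compose_list (letter_types l) q"
  let ?y = "foldr letter_lorentz u x" and ?w = "map (wall_letter p) (letter_walls l)"
  have ok: "pairs_ok (letter_walls l)" using letter_walls_range by blast
  have W: "?w \<in> words walls" by (rule wall_letter_words[OF Cons.prems(2) ok])
  have "eq5 (foldr (\<lambda>l. wall_refl (fst l)) (wall_word ?p u) (\<lambda>k. x (word_types_inv ?q u ! k))) (\<lambda>k. ?y (?q ! k))"
    using Cons.prems
    by (intro Cons.IH inverse_lists_compose inverse_lists_letter_types types_compose types_letter_types)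
  moreover have "eq5 (\<lambda>k. ?y (?q ! k)) (\<lambda>k. ?y (letter_types l ! (q ! k)))"
    using Cons.prems(1) by (auto simp: eq5_def inverse_lists_def nth_compose_list)
  ultimately have "eq5 (foldr (\<lambda>l. wall_refl (fst l)) (wall_word ?p u) (\<lambda>k. x (word_types_inv ?q u ! k)))
      (\<lambda>k. ?y (letter_types l ! (q ! k)))"
    by (rule eq5_trans)
  from eq5_trans[OF wall_act_cong[OF W this] walls_natural[OF Cons.prems ok, of "\<lambda>k. ?y (letter_types l ! k)"]]
  show ?case by (simp add: letter_lorentz_def[of l ?y] del: letter_walls.simps)
qed (simp add: eq5_def)

text \<open>A wall word that is trivial in \<open>W\<close> acts trivially on the lattice. Since the
  permutation also closes up, the product of the letters is the identity on five coordinates, hence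
  on the four of the Tits representation, which is faithful on the group.\<close>

lemma wall_word_faithful:
  assumes u: "u \<in> words fig8_gens" and pq: "inverse_lists p q" "types p"
    and loop: "word_types p u = p" and triv: "wall_eq (wall_word p u) []"
  shows "fig8_eq u []"
proof (rule fig8_faithful[OF u])
  fix x
  have inv: "inverse_lists p (word_types_inv q u)"
    using inverse_lists_word_types[OF pq(1), of u] loop by simp
  have eq: "word_types_inv q u ! k = q ! k" if k: "k < 5" for k
  proof -
    have b: "p ! (q ! k) = k" and "q ! k < 5"
      using pq(1) k unfolding inverse_lists_def by blast+
    then have "word_types_inv q u ! (p ! (q ! k)) = q ! k"
      using inv unfolding inverse_lists_def by blast
    then show ?thesis unfolding b .
  qed
  have e5: "eq5 (\<lambda>k. x (word_types_inv q u ! k)) (\<lambda>k. foldr letter_lorentz u x (q ! k))"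
    using wall_word_act[OF pq, of u x] wall_eq_act[OF triv] by simp
  have "x k = foldr letter_lorentz u x k" if k: "k < 5" for k
  proof -
    have pk: "p ! k < 5" and b: "q ! (p ! k) = k"
      using pq(1) k unfolding inverse_lists_def by blast+
    have "x (word_types_inv q u ! (p ! k)) = foldr letter_lorentz u x (q ! (p ! k))"
      using e5 pk unfolding eq5_def by blast
    then show ?thesis unfolding eq[OF pk] b .
  qed
  then have "eq4 (foldr letter_lorentz u x) x" by (simp add: eq4_def)
  with word_lorentz_eq4[OF u, of x] show "eq4 (foldr letter_mat u x) x" by (simp add: eq4_def)
qed

section \<open>A permutation representation of degree 20\<close>

text \<open>
  The regular representation of the dicyclic group of order 20, written as the fibre product of
  \<open>\<int>/4\<close> and the dihedral group generated by the involutions \<open>letter_types\<close>; the dihedral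
  component of the sheet \<open>s\<close> is \<open>sheet_types s\<close>.
\<close>

fun sheet_step :: "nat \<times> bool \<Rightarrow> nat list"
  where "sheet_step (x, b) =
    (if x = 0 then
       if b then [1, 5, 8, 0, 9, 3, 10, 11, 4, 2, 7, 6, 16, 17, 18, 19, 13, 12, 15, 14]
       else [3, 0, 9, 5, 8, 1, 11, 10, 2, 4, 6, 7, 17, 16, 19, 18, 12, 13, 14, 15]
     else
       if b then [2, 6, 5, 7, 0, 4, 3, 1, 12, 13, 14, 15, 9, 8, 11, 10, 19, 18, 16, 17]
       else [4, 7, 0, 6, 5, 2, 1, 3, 13, 12, 15, 14, 8, 9, 10, 11, 18, 19, 17, 16])"

definition sheet_types :: "nat \<Rightarrow> nat list"
  where "sheet_types s =
    [[0, 1, 2, 3, 4], [2, 3, 0, 1, 4], [3, 1, 4, 0, 2], [2, 3, 0, 1, 4], [3, 1, 4, 0, 2],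
     [0, 1, 2, 3, 4], [1, 3, 4, 2, 0], [1, 3, 4, 2, 0], [4, 0, 3, 1, 2], [4, 0, 3, 1, 2],
     [4, 2, 1, 3, 0], [4, 2, 1, 3, 0], [1, 0, 2, 4, 3], [1, 0, 2, 4, 3], [3, 2, 0, 4, 1],
     [3, 2, 0, 4, 1], [2, 4, 1, 0, 3], [2, 4, 1, 0, 3], [0, 4, 3, 2, 1], [0, 4, 3, 2, 1]] ! s"

definition sheet_act :: "nat \<Rightarrow> nat word \<Rightarrow> nat"
  where "sheet_act s u = foldl (\<lambda>s l. sheet_step l ! s) s u"

lemma sheet_act_append: "sheet_act s (u @ v) = sheet_act (sheet_act s u) v"
  by (simp add: sheet_act_def)

lemma sheet_check:
  "\<forall>s\<in>set [0..<20]. types (sheet_types s) \<and> sheet_act s fig8_relator = s \<and>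
    (\<forall>x\<in>{0, 1}. \<forall>b\<in>{True, False}. sheet_step (x, b) ! s < 20 \<and>
       sheet_step (x, \<not> b) ! (sheet_step (x, b) ! s) = s \<and>
       sheet_types (sheet_step (x, b) ! s) = compose_list (sheet_types s) (letter_types (x, b)))"
  by code_simp

lemma types_inverse:
  assumes p: "types p"
  obtains q where "inverse_lists p q"
proof -
  let ?f = "nth p" and ?g = "inv_into {..<5} (nth p)"
  have inj: "inj_on ?f {..<5}" using types_nth_eq_iff[OF p] by (auto simp: inj_on_def)
  have sub: "?f ` {..<5} \<subseteq> {..<5}" using types_nth[OF p] by auto
  have im: "?f ` {..<5} = {..<5}" by (rule endo_inj_surj[OF _ sub inj]) simp
  have g: "?g i < 5" "?f (?g i) = i" "?g (?f i) = i" if "i < 5" for i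
    using inv_into_into[of i ?f "{..<5}"] f_inv_into_f[of i ?f "{..<5}"] inv_into_f_f[OF inj, of i] im that
    by auto
  have "inverse_lists p (map ?g [0..<5])"
    using g p types_nth[OF p] by (simp add: inverse_lists_def types_def)
  then show ?thesis by (rule that)
qed

text \<open>A breadth-first search with the two positive letters; eight rounds exhaust the 20
  sheets. Transitivity is what makes the cover connected.\<close>

lemma sheet_transitive_check:
  "set [0..<20] \<subseteq> set (foldr (\<lambda>_ S. remdups (S @ map (nth (sheet_step (0, True))) S @ map (nth (sheet_step (1, True))) S))
     [0..<8::nat] [0])"
  by code_simp

lemma sheet_letter:
  assumes "s < 20" "fst l \<in> fig8_gens"
  shows "sheet_step l ! s < 20" "sheet_step (flip_letter l) ! (sheet_step l ! s) = s"
    "sheet_types (sheet_step l ! s) = compose_list (sheet_types s) (letter_types l)"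
proof -
  have "fst l \<in> {0, 1}" "snd l \<in> {True, False}" "s \<in> set [0..<20]"
    using assms by (auto simp: fig8_gens_def)
  from bspec[OF bspec[OF conjunct2[OF conjunct2[OF bspec[OF sheet_check this(3)]]] this(1)] this(2)]
  show "sheet_step l ! s < 20" "sheet_step (flip_letter l) ! (sheet_step l ! s) = s"
    "sheet_types (sheet_step l ! s) = compose_list (sheet_types s) (letter_types l)"
    unfolding prod.collapse by blast+
qed

lemma types_sheet_types: "s < 20 \<Longrightarrow> types (sheet_types s)"
  using sheet_check by auto

lemma sheet_act_less: "s < 20 \<Longrightarrow> u \<in> words fig8_gens \<Longrightarrow> sheet_act s u < 20"
proof (induction u arbitrary: s)
  case (Cons l u)
  then show ?case using sheet_letter(1)[of s l] by (simp add: sheet_act_def)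
qed (simp add: sheet_act_def)

lemma sheet_types_act:
  "s < 20 \<Longrightarrow> u \<in> words fig8_gens \<Longrightarrow> sheet_types (sheet_act s u) = word_types (sheet_types s) u"
proof (induction u arbitrary: s)
  case (Cons l u)
  then have l: "fst l \<in> fig8_gens" by simp
  show ?case
    using Cons.IH[OF sheet_letter(1)[OF Cons.prems(1) l]] Cons.prems(2) sheet_letter(3)[OF Cons.prems(1) l]
    by (simp add: sheet_act_def)
qed (simp add: sheet_act_def)

lemma sheet_act_fig8_eq: "fig8_eq u v \<Longrightarrow> s < 20 \<Longrightarrow> sheet_act s u = sheet_act s v"
proof (induction arbitrary: s rule: word_eq.induct)
  case (sym u v)
  from sym.IH[OF sym.prems] show ?case by (rule HOL.sym)
next
  case (trans u v w)
  from trans.IH(1)[OF trans.prems] trans.IH(2)[OF trans.prems] show ?case by (rule HOL.trans)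
next
  case (cancel u v x b)
  then have x: "fst (x, b) \<in> fig8_gens" by simp
  have "sheet_act t [(x, b), (x, \<not> b)] = t" if "t < 20" for t
    using sheet_letter(2)[OF that x] by (simp add: sheet_act_def)
  then show ?case
    using sheet_act_less[OF cancel.prems cancel.hyps(1)] by (simp only: sheet_act_append)
next
  case (relator u v r)
  have "\<forall>t<20. sheet_act t fig8_relator = t" using sheet_check by auto
  then show ?case
    using sheet_act_less[OF relator.prems relator.hyps(1)] relator.hyps(3)
    by (simp add: sheet_act_append)
qed simp

lemma sheet_transitive:
  assumes "s < 20"
  obtains u where "u \<in> words fig8_gens" "sheet_act 0 u = s"
proof -
  let ?S = "\<lambda>n. foldr (\<lambda>_ S. remdups (S @ map (nth (sheet_step (0, True))) S @ map (nth (sheet_step (1, True))) S))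
     [0..<n::nat] [0]"
  define P where "P t \<longleftrightarrow> (\<exists>u. u \<in> words fig8_gens \<and> sheet_act 0 u = t)" for t
  have step: "P (sheet_step (x, True) ! t)" if "P t" "x \<in> fig8_gens" for t x
  proof -
    from that obtain u where "u \<in> words fig8_gens" "sheet_act 0 u = t" by (auto simp: P_def)
    then have "u @ [(x, True)] \<in> words fig8_gens" "sheet_act 0 (u @ [(x, True)]) = sheet_step (x, True) ! t"
      using that by (simp_all add: sheet_act_def)
    then show ?thesis unfolding P_def by blast
  qed
  have P0: "P 0" unfolding P_def by (intro exI[of _ "[]"]) (simp add: sheet_act_def)
  have "\<forall>t\<in>set (foldr (\<lambda>_ S. remdups (S @ map (nth (sheet_step (0, True))) S @ map (nth (sheet_step (1, True))) S))
     ns [0]). P t" for ns :: "nat list"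
  proof (induction ns)
    case (Cons n ns)
    then show ?case
      using step[of _ 0] step[of _ 1] by (auto simp: fig8_gens_def simp del: sheet_step.simps)
  qed (simp add: P0)
  moreover have "s \<in> set (?S 8)"
    using sheet_transitive_check assms by auto
  ultimately have "P s" by blast
  then show ?thesis using that by (auto simp: P_def)
qed

lemma sheet_wall_word_eq:
  assumes "fig8_eq u v" "s < 20"
  shows "wall_eq (wall_word (sheet_types s) u) (wall_word (sheet_types s) v)"
  using fig8_eq_wall_eq[OF assms(1) types_sheet_types[OF assms(2)]] by blast

lemma sheet_wall_word_append:
  assumes "s < 20" "u \<in> words fig8_gens"
  shows "wall_word (sheet_types s) (u @ v) = wall_word (sheet_types s) u @ wall_word (sheet_types (sheet_act s u)) v"
  by (simp add: wall_word_append sheet_types_act[OF assms])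

lemma sheet_wall_word_faithful:
  assumes u: "u \<in> words fig8_gens" and s: "s < 20" "sheet_act s u = s"
    and "wall_eq (wall_word (sheet_types s) u) []"
  shows "fig8_eq u []"
proof -
  obtain q where "inverse_lists (sheet_types s) q"
    using types_inverse[OF types_sheet_types[OF s(1)]] .
  then show ?thesis
    using wall_word_faithful[OF u _ types_sheet_types[OF s(1)]] assms(4) sheet_types_act[OF s(1) u] s(2)
    by metis
qed

section \<open>Parallel sections and covers defined by cocycles\<close>

text \<open>The cocycle is given as the coboundary of pointwise labels: \<open>c i\<close> may be
  discontinuous, but the ratios of \<open>c i\<close> and \<open>c j\<close> are locally constant.
  Overlaps of charts are disconnected in the application, so one constant for each pair of charts
  would not do.\<close>

locale cocycle = group G for G :: "('a, 'm) monoid_scheme" (structure) +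
  fixes X :: "'b topology" and I :: "'i set" and U :: "'i \<Rightarrow> 'b set" and c :: "'i \<Rightarrow> 'b \<Rightarrow> 'a"
  assumes U_open: "i \<in> I \<Longrightarrow> openin X (U i)"
    and U_cover: "topspace X = (\<Union>i\<in>I. U i)"
    and c_closed: "i \<in> I \<Longrightarrow> x \<in> U i \<Longrightarrow> c i x \<in> carrier G"
    and c_locally: "i \<in> I \<Longrightarrow> j \<in> I \<Longrightarrow> x \<in> U i \<Longrightarrow> x \<in> U j \<Longrightarrow>
      \<exists>V g. openin X V \<and> x \<in> V \<and> V \<subseteq> U i \<inter> U j \<and> g \<in> carrier G \<and> (\<forall>y\<in>V. c i y = g \<otimes> c j y)"

text \<open>
  \<open>s\<close> over \<open>x \<in> U i\<close> has the coordinate \<open>t\<close> with \<open>s = act t (c i x)\<close> in the chart \<open>U i\<close>.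
\<close>

locale gset_cocycle = cocycle G X I U c
  for G :: "('a, 'm) monoid_scheme" (structure) and X :: "'b topology" and I :: "'i set" and U c +
  fixes S :: "'s set" and act :: "'s \<Rightarrow> 'a \<Rightarrow> 's"
  assumes act_closed: "s \<in> S \<Longrightarrow> g \<in> carrier G \<Longrightarrow> act s g \<in> S"
    and act_one: "s \<in> S \<Longrightarrow> act s \<one> = s"
    and act_mult: "s \<in> S \<Longrightarrow> g \<in> carrier G \<Longrightarrow> h \<in> carrier G \<Longrightarrow> act s (g \<otimes> h) = act (act s g) h"
begin

lemma act_inj: "act s g = act t g \<Longrightarrow> s \<in> S \<Longrightarrow> t \<in> S \<Longrightarrow> g \<in> carrier G \<Longrightarrow> s = t"
  by (metis act_mult act_one inv_closed r_inv)

lemma act_inv: "s \<in> S \<Longrightarrow> g \<in> carrier G \<Longrightarrow> act (act s (inv g)) g = s"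
  by (metis act_mult act_one inv_closed l_inv)

text \<open>Constant in chart coordinates near every point: this is a lift of \<open>h\<close> to
  the cover, expressed before the cover has a topology.\<close>

definition parallel :: "'z topology \<Rightarrow> ('z \<Rightarrow> 'b) \<Rightarrow> ('z \<Rightarrow> 's) \<Rightarrow> bool"
  where "parallel Z h \<sigma> \<longleftrightarrow> (\<forall>z\<in>topspace Z. \<exists>i\<in>I. \<exists>V s. openin Z V \<and> z \<in> V \<and> s \<in> S \<and>
    (\<forall>y\<in>V. h y \<in> U i \<and> \<sigma> y = act s (c i (h y))))"

lemma parallel_chart:
  assumes "parallel Z h \<sigma>" and h: "continuous_map Z X h" and z: "z \<in> topspace Z" and j: "j \<in> I" "h z \<in> U j"
  obtains V s where "openin Z V" "z \<in> V" "s \<in> S" "\<And>y. y \<in> V \<Longrightarrow> h y \<in> U j \<and> \<sigma> y = act s (c j (h y))"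
proof -
  obtain i V s where i: "i \<in> I" and V: "openin Z V" "z \<in> V" "s \<in> S"
    "\<forall>y\<in>V. h y \<in> U i \<and> \<sigma> y = act s (c i (h y))"
    using assms(1) z unfolding parallel_def by meson
  have "h z \<in> U i" using V by blast
  from c_locally[OF i j(1) this j(2)] obtain W g where W: "openin X W" "h z \<in> W" "W \<subseteq> U i \<inter> U j"
    "g \<in> carrier G" "\<forall>y\<in>W. c i y = g \<otimes> c j y"
    by meson
  show ?thesis
  proof (rule that)
    show "openin Z (V \<inter> {y \<in> topspace Z. h y \<in> W})"
      using V(1) openin_continuous_map_preimage[OF h W(1)] by blast
    show "z \<in> V \<inter> {y \<in> topspace Z. h y \<in> W}" using V W z by blast
    show "act s g \<in> S" using V W act_closed by blast
    fix y assume "y \<in> V \<inter> {y \<in> topspace Z. h y \<in> W}"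
    then have y: "y \<in> V" "h y \<in> W" by auto
    then have "c j (h y) \<in> carrier G" using W(3) c_closed j by blast
    then have "act (act s g) (c j (h y)) = act s (c i (h y))"
      using W y V(3) act_mult by metis
    then show "h y \<in> U j \<and> \<sigma> y = act (act s g) (c j (h y))"
      using V(4) W(3) y by auto
  qed
qed

lemma parallel_in: "parallel Z h \<sigma> \<Longrightarrow> z \<in> topspace Z \<Longrightarrow> \<sigma> z \<in> S"
  unfolding parallel_def by (metis act_closed c_closed)

lemma parallel_cong:
  assumes "parallel Z h \<sigma>" "\<And>z. z \<in> topspace Z \<Longrightarrow> h z = h' z" "\<And>z. z \<in> topspace Z \<Longrightarrow> \<sigma> z = \<sigma>' z"
  shows "parallel Z h' \<sigma>'"
  unfolding parallel_def
proof
  fix z assume "z \<in> topspace Z"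
  then obtain i V s where "i \<in> I" and V: "openin Z V" "z \<in> V" "s \<in> S"
    "\<forall>y\<in>V. h y \<in> U i \<and> \<sigma> y = act s (c i (h y))"
    using assms(1) unfolding parallel_def by meson
  moreover have "\<forall>y\<in>V. h' y \<in> U i \<and> \<sigma>' y = act s (c i (h' y))"
    using V openin_subset[OF V(1)] assms(2,3) by (metis subsetD)
  ultimately show "\<exists>i\<in>I. \<exists>V s. openin Z V \<and> z \<in> V \<and> s \<in> S \<and>
      (\<forall>y\<in>V. h' y \<in> U i \<and> \<sigma>' y = act s (c i (h' y)))"
    by blast
qed

lemma parallel_compose:
  assumes "parallel Z h \<sigma>" and f: "continuous_map Z' Z f"
  shows "parallel Z' (h \<circ> f) (\<sigma> \<circ> f)"
  unfolding parallel_def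
proof
  fix z assume z: "z \<in> topspace Z'"
  then have "f z \<in> topspace Z" using f by (auto simp: continuous_map_def)
  then obtain i V s where "i \<in> I" and V: "openin Z V" "f z \<in> V" "s \<in> S"
    "\<forall>y\<in>V. h y \<in> U i \<and> \<sigma> y = act s (c i (h y))"
    using assms(1) unfolding parallel_def by meson
  then show "\<exists>i\<in>I. \<exists>V s. openin Z' V \<and> z \<in> V \<and> s \<in> S \<and>
      (\<forall>y\<in>V. (h \<circ> f) y \<in> U i \<and> (\<sigma> \<circ> f) y = act s (c i ((h \<circ> f) y)))"
    using openin_continuous_map_preimage[OF f V(1)] z
    by (intro bexI[of _ i] exI[of _ "{y \<in> topspace Z'. f y \<in> V}"] exI[of _ s]) auto
qed

text \<open>In a common chart both sections have constant coordinates, so near each point they agree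
  everywhere or nowhere, and the set of agreement is open and closed.\<close>

lemma parallel_unique:
  assumes Z: "connected_space Z" and h: "continuous_map Z X h" and p: "parallel Z h \<sigma>" "parallel Z h \<tau>"
    and z: "z0 \<in> topspace Z" "\<sigma> z0 = \<tau> z0" "z \<in> topspace Z"
  shows "\<sigma> z = \<tau> z"
proof -
  have loc: "\<exists>V. openin Z V \<and> z \<in> V \<and> (\<forall>y\<in>V. (\<sigma> y = \<tau> y) = (\<sigma> z = \<tau> z))" if z: "z \<in> topspace Z" for z
  proof -
    have "h z \<in> topspace X" using h z by (auto simp: continuous_map_def)
    then obtain i where i: "i \<in> I" "h z \<in> U i" using U_cover by auto
    obtain V s where V: "openin Z V" "z \<in> V" "s \<in> S" "\<And>y. y \<in> V \<Longrightarrow> h y \<in> U i \<and> \<sigma> y = act s (c i (h y))"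
      by (rule parallel_chart[OF p(1) h z i]) blast
    obtain W t where W: "openin Z W" "z \<in> W" "t \<in> S" "\<And>y. y \<in> W \<Longrightarrow> h y \<in> U i \<and> \<tau> y = act t (c i (h y))"
      by (rule parallel_chart[OF p(2) h z i]) blast
    have "(\<sigma> y = \<tau> y) = (s = t)" if "y \<in> V \<inter> W" for y
      using that V W c_closed[OF i(1), of "h y"] act_inj[of s "c i (h y)" t] by auto
    then show ?thesis using V(1,2) W(1,2) by (intro exI[of _ "V \<inter> W"]) auto
  qed
  have op: "openin Z {z \<in> topspace Z. (\<sigma> z = \<tau> z) = b}" for b
  proof (subst openin_subopen, rule ballI)
    fix z assume z: "z \<in> {z \<in> topspace Z. (\<sigma> z = \<tau> z) = b}"
    then obtain V where V: "openin Z V" "z \<in> V" "\<forall>y\<in>V. (\<sigma> y = \<tau> y) = (\<sigma> z = \<tau> z)"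
      using loc by blast
    then have "V \<subseteq> {z \<in> topspace Z. (\<sigma> z = \<tau> z) = b}"
      using openin_subset[OF V(1)] z by blast
    then show "\<exists>T. openin Z T \<and> z \<in> T \<and> T \<subseteq> {z \<in> topspace Z. (\<sigma> z = \<tau> z) = b}"
      using V by blast
  qed
  define E1 E2 where "E1 = {z \<in> topspace Z. (\<sigma> z = \<tau> z) = True}" "E2 = {z \<in> topspace Z. (\<sigma> z = \<tau> z) = False}"
  have "openin Z E1" "openin Z E2" unfolding E1_E2_def by (rule op)+
  moreover have "topspace Z \<subseteq> E1 \<union> E2" "E1 \<inter> E2 = {}" "E1 \<noteq> {}"
    using z(1,2) by (auto simp: E1_E2_def)
  ultimately have "E2 = {}" using Z unfolding connected_space_def by blast
  then show ?thesis using z(3) by (auto simp: E1_E2_def)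
qed

text \<open>Agreement at \<open>e\<close> spreads over the connected overlap. Closedness provides
  neighbourhoods: a point outside one of the sets has one that misses it, and at a common point the
  chart coordinates of the two sections coincide.\<close>

lemma parallel_glue:
  fixes A B :: "'z::topological_space set"
  assumes cl: "closed A" "closed B" and con: "connected (A \<inter> B)" "e \<in> A \<inter> B"
    and h: "continuous_map (top_of_set (A \<union> B)) X h"
    and p: "parallel (top_of_set A) h \<sigma>" "parallel (top_of_set B) h \<tau>" and e: "\<sigma> e = \<tau> e"
  shows "parallel (top_of_set (A \<union> B)) h (\<lambda>z. if z \<in> A then \<sigma> z else \<tau> z)"
    "z \<in> A \<inter> B \<Longrightarrow> \<sigma> z = \<tau> z"
proof -
  let ?\<rho> = "\<lambda>z. if z \<in> A then \<sigma> z else \<tau> z"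
  have hA: "continuous_map (top_of_set A) X h" and hB: "continuous_map (top_of_set B) X h"
    and hAB: "continuous_map (top_of_set (A \<inter> B)) X h"
    using continuous_map_from_subtopology_mono[OF h] by auto
  have sub: "continuous_map (top_of_set (A \<inter> B)) (top_of_set A) id" "continuous_map (top_of_set (A \<inter> B)) (top_of_set B) id"
    by (auto simp: continuous_map_in_subtopology)
  have agree: "\<sigma> z = \<tau> z" if "z \<in> A \<inter> B" for z
    using parallel_unique[OF _ hAB, of \<sigma> \<tau> e z] parallel_compose[OF p(1) sub(1)] parallel_compose[OF p(2) sub(2)] con e that
    by (simp add: connected_space_subtopology)
  then show "z \<in> A \<inter> B \<Longrightarrow> \<sigma> z = \<tau> z" .
  show "parallel (top_of_set (A \<union> B)) h ?\<rho>"
    unfolding parallel_def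
  proof
    fix z assume z: "z \<in> topspace (top_of_set (A \<union> B))"
    then have "h z \<in> topspace X" using h by (auto simp: continuous_map_def)
    then obtain i where i: "i \<in> I" "h z \<in> U i" using U_cover by auto
    have A: "\<exists>W s. open W \<and> z \<in> W \<and> s \<in> S \<and> (\<forall>y\<in>W \<inter> A. h y \<in> U i \<and> \<sigma> y = act s (c i (h y)))"
      if zA: "z \<in> A"
    proof -
      obtain V s where V: "openin (top_of_set A) V" "z \<in> V" "s \<in> S" "\<And>y. y \<in> V \<Longrightarrow> h y \<in> U i \<and> \<sigma> y = act s (c i (h y))"
        by (rule parallel_chart[OF p(1) hA _ i]) (use zA in auto)
      then show ?thesis by (auto simp: openin_open)
    qed
    have B: "\<exists>W s. open W \<and> z \<in> W \<and> s \<in> S \<and> (\<forall>y\<in>W \<inter> B. h y \<in> U i \<and> \<tau> y = act s (c i (h y)))"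
      if zB: "z \<in> B"
    proof -
      obtain V s where V: "openin (top_of_set B) V" "z \<in> V" "s \<in> S" "\<And>y. y \<in> V \<Longrightarrow> h y \<in> U i \<and> \<tau> y = act s (c i (h y))"
        by (rule parallel_chart[OF p(2) hB _ i]) (use zB in auto)
      then show ?thesis by (auto simp: openin_open)
    qed
    have "\<exists>W s. open W \<and> z \<in> W \<and> s \<in> S \<and> (\<forall>y\<in>W \<inter> (A \<union> B). h y \<in> U i \<and> ?\<rho> y = act s (c i (h y)))"
    proof (cases "z \<in> A \<inter> B")
      case True
      then obtain W s W' t where W: "open W" "z \<in> W" "s \<in> S" "\<forall>y\<in>W \<inter> A. h y \<in> U i \<and> \<sigma> y = act s (c i (h y))"
        "open W'" "z \<in> W'" "t \<in> S" "\<forall>y\<in>W' \<inter> B. h y \<in> U i \<and> \<tau> y = act t (c i (h y))"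
        using A B by auto
      have "act s (c i (h z)) = act t (c i (h z))" using W True agree[OF True] by auto
      then have "s = t" using act_inj W(3,7) c_closed i by metis
      then show ?thesis using W by (intro exI[of _ "W \<inter> W'"] exI[of _ s]) auto
    next
      case False
      then consider "z \<in> A" "z \<notin> B" | "z \<in> B" "z \<notin> A" using z by auto
      then show ?thesis
      proof cases
        case 1
        then obtain W s where "open W" "z \<in> W" "s \<in> S" "\<forall>y\<in>W \<inter> A. h y \<in> U i \<and> \<sigma> y = act s (c i (h y))"
          using A by auto
        then show ?thesis using 1 cl by (intro exI[of _ "W - B"] exI[of _ s]) auto
      next
        case 2
        then obtain W s where "open W" "z \<in> W" "s \<in> S" "\<forall>y\<in>W \<inter> B. h y \<in> U i \<and> \<tau> y = act s (c i (h y))"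
          using B by auto
        then show ?thesis using 2 cl by (intro exI[of _ "W - A"] exI[of _ s]) auto
      qed
    qed
    then obtain W s where "open W" "z \<in> W" "s \<in> S" "\<forall>y\<in>W \<inter> (A \<union> B). h y \<in> U i \<and> ?\<rho> y = act s (c i (h y))"
      by blast
    then show "\<exists>i\<in>I. \<exists>V s. openin (top_of_set (A \<union> B)) V \<and> z \<in> V \<and> s \<in> S \<and>
        (\<forall>y\<in>V. h y \<in> U i \<and> ?\<rho> y = act s (c i (h y)))"
      using i z by (intro bexI[of _ i] exI[of _ "(A \<union> B) \<inter> W"] exI[of _ s]) (auto simp: openin_open_Int)
  qed
qed

definition extendable :: "('z::topological_space \<Rightarrow> 'b) \<Rightarrow> 'z set \<Rightarrow> bool"
  where "extendable h A \<longleftrightarrow> (\<forall>z\<in>A. \<forall>s\<in>S. \<exists>\<sigma>. parallel (top_of_set A) h \<sigma> \<and> \<sigma> z = s)"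

lemma extendable_Un:
  fixes A B :: "'z::topological_space set"
  assumes AB: "extendable h A" "extendable h B" and cl: "closed A" "closed B" and con: "connected (A \<inter> B)" "A \<inter> B \<noteq> {}"
    and h: "continuous_map (top_of_set (A \<union> B)) X h"
  shows "extendable h (A \<union> B)"
  unfolding extendable_def
proof (intro ballI)
  fix z s assume zs: "z \<in> A \<union> B" "s \<in> S"
  obtain e where e: "e \<in> A \<inter> B" using con by auto
  show "\<exists>\<sigma>. parallel (top_of_set (A \<union> B)) h \<sigma> \<and> \<sigma> z = s"
  proof (cases "z \<in> A")
    case True
    obtain \<sigma> where s: "parallel (top_of_set A) h \<sigma>" "\<sigma> z = s" using AB True zs unfolding extendable_def by blast
    have "\<sigma> e \<in> S" using parallel_in[OF s(1)] e by auto
    then obtain \<tau> where t: "parallel (top_of_set B) h \<tau>" "\<tau> e = \<sigma> e" using AB e unfolding extendable_def by blast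
    show ?thesis
      using parallel_glue(1)[OF cl con(1) e h s(1) t(1)] t s True by (intro exI[of _ "\<lambda>z. if z \<in> A then \<sigma> z else \<tau> z"]) auto
  next
    case False
    then obtain \<tau> where t: "parallel (top_of_set B) h \<tau>" "\<tau> z = s" using AB zs unfolding extendable_def by blast
    have "\<tau> e \<in> S" using parallel_in[OF t(1)] e by auto
    then obtain \<sigma> where s: "parallel (top_of_set A) h \<sigma>" "\<sigma> e = \<tau> e" using AB e unfolding extendable_def by blast
    show ?thesis
      using parallel_glue(1)[OF cl con(1) e h s(1) t(1)] t s False by (intro exI[of _ "\<lambda>z. if z \<in> A then \<sigma> z else \<tau> z"]) auto
  qed
qed

lemma extendable_local:
  assumes i: "i \<in> I" and "h ` A \<subseteq> U i"
  shows "extendable h A"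
  unfolding extendable_def
proof (intro ballI)
  fix z s assume zs: "z \<in> A" "s \<in> S"
  let ?t = "act s (inv (c i (h z)))"
  have c: "c i (h z) \<in> carrier G" using assms zs c_closed by blast
  have "parallel (top_of_set A) h (\<lambda>y. act ?t (c i (h y)))"
    unfolding parallel_def using assms zs c
    by (intro ballI bexI[of _ i] exI[of _ A] exI[of _ ?t]) (auto intro!: act_closed)
  moreover have "act ?t (c i (h z)) = s" using act_inv zs c by blast
  ultimately show "\<exists>\<sigma>. parallel (top_of_set A) h \<sigma> \<and> \<sigma> z = s" by blast
qed

end

section \<open>Parallel sections over the square and transport along paths\<close>

context gset_cocycle
begin

abbreviation square :: "(real \<times> real) set"
  where "square \<equiv> {0..1} \<times> {0..1}"

text \<open>Bisection in place of a Lebesgue number: small rectangles lie in one chart, and adjacent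
  rectangles share a connected edge. \<open>Bolzano\<close> is applied to the first coordinate near
  each fixed height, which gives full-width strips, and then to the second coordinate.\<close>

lemma extendable_square:
  fixes h :: "real \<times> real \<Rightarrow> 'b"
  assumes h: "continuous_map (top_of_set square) X h"
  shows "extendable h square"
proof -
  have hsub: "continuous_map (top_of_set A) X h" if "A \<subseteq> square" for A
    using continuous_map_from_subtopology_mono[OF h that] .
  \<comment> \<open>The guard makes \<open>P\<close> vacuous for rectangles that leave the unit
    square, as the small intervals in \<open>Bolzano\<close> may do at the ends.\<close>
  define P where "P a b v d \<longleftrightarrow> (0 \<le> a \<and> a \<le> b \<and> b \<le> 1 \<and> 0 \<le> v \<and> v \<le> d \<and> d \<le> 1 \<longrightarrow>
    extendable h ({a..b} \<times> {v..d}))" for a b v d :: real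
  have P1: "P a e v d" if "P a b v d" "P b e v d" "a \<le> b" "b \<le> e" for a b e v d
    unfolding P_def
  proof
    assume r: "0 \<le> a \<and> a \<le> e \<and> e \<le> 1 \<and> 0 \<le> v \<and> v \<le> d \<and> d \<le> 1"
    have un: "{a..e} \<times> {v..d} = {a..b} \<times> {v..d} \<union> {b..e} \<times> {v..d}"
      using that by auto
    have int: "{a..b} \<times> {v..d} \<inter> {b..e} \<times> {v..d} = {b} \<times> {v..d}" using that by auto
    show "extendable h ({a..e} \<times> {v..d})"
      unfolding un
    proof (rule extendable_Un)
      show "extendable h ({a..b} \<times> {v..d})" "extendable h ({b..e} \<times> {v..d})"
        using that r unfolding P_def by auto
      show "connected ({a..b} \<times> {v..d} \<inter> {b..e} \<times> {v..d})" "{a..b} \<times> {v..d} \<inter> {b..e} \<times> {v..d} \<noteq> {}"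
        unfolding int using r by (auto intro: connected_Times)
      show "continuous_map (top_of_set ({a..b} \<times> {v..d} \<union> {b..e} \<times> {v..d})) X h"
        unfolding un[symmetric] using r by (intro hsub) auto
    qed (auto intro: closed_Times)
  qed
  have P2: "P a b v e" if "P a b v d" "P a b d e" "v \<le> d" "d \<le> e" for a b v d e
    unfolding P_def
  proof
    assume r: "0 \<le> a \<and> a \<le> b \<and> b \<le> 1 \<and> 0 \<le> v \<and> v \<le> e \<and> e \<le> 1"
    have un: "{a..b} \<times> {v..e} = {a..b} \<times> {v..d} \<union> {a..b} \<times> {d..e}"
      using that by auto
    have int: "{a..b} \<times> {v..d} \<inter> {a..b} \<times> {d..e} = {a..b} \<times> {d}" using that by auto
    show "extendable h ({a..b} \<times> {v..e})"
      unfolding un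
    proof (rule extendable_Un)
      show "extendable h ({a..b} \<times> {v..d})" "extendable h ({a..b} \<times> {d..e})"
        using that r unfolding P_def by auto
      show "connected ({a..b} \<times> {v..d} \<inter> {a..b} \<times> {d..e})" "{a..b} \<times> {v..d} \<inter> {a..b} \<times> {d..e} \<noteq> {}"
        unfolding int using r by (auto intro: connected_Times)
      show "continuous_map (top_of_set ({a..b} \<times> {v..d} \<union> {a..b} \<times> {d..e})) X h"
        unfolding un[symmetric] using r by (intro hsub) auto
    qed (auto intro: closed_Times)
  qed
  have loc: "\<exists>\<delta>>0. \<forall>a b v d. a \<le> x \<and> x \<le> b \<and> b - a < \<delta> \<and> v \<le> y \<and> y \<le> d \<and> d - v < \<delta> \<longrightarrow> P a b v d"
    if "0 \<le> x" "x \<le> 1" "0 \<le> y" "y \<le> 1" for x y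
  proof -
    have xy: "(x, y) \<in> square" using that by auto
    then have "h (x, y) \<in> topspace X" using h by (auto simp: continuous_map_def)
    then obtain i where i: "i \<in> I" "h (x, y) \<in> U i" using U_cover by auto
    have "openin (top_of_set square) {z \<in> square. h z \<in> U i}"
      using openin_continuous_map_preimage[OF h U_open[OF i(1)]] by simp
    then obtain W where W: "open W" "{z \<in> square. h z \<in> U i} = square \<inter> W"
      by (auto simp: openin_open)
    then have "(x, y) \<in> W" using xy i by blast
    then obtain e where e: "e > 0" "ball (x, y) e \<subseteq> W" using W(1) openE by blast
    have "P a b v d" if "a \<le> x" "x \<le> b" "b - a < e / 2" "v \<le> y" "y \<le> d" "d - v < e / 2" for a b v d
      unfolding P_def
    proof
      assume r: "0 \<le> a \<and> a \<le> b \<and> b \<le> 1 \<and> 0 \<le> v \<and> v \<le> d \<and> d \<le> 1"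
      have "z \<in> ball (x, y) e" if z: "z \<in> {a..b} \<times> {v..d}" for z
      proof -
        have "dist (x, y) z \<le> \<bar>x - fst z\<bar> + \<bar>y - snd z\<bar>"
          using norm_Pair_le[of "x - fst z" "y - snd z"] by (cases z) (simp add: dist_norm)
        also have "\<dots> < e" using that z \<open>a \<le> x\<close> \<open>x \<le> b\<close> \<open>v \<le> y\<close> \<open>y \<le> d\<close> \<open>b - a < e / 2\<close> \<open>d - v < e / 2\<close> by auto
        finally show ?thesis by simp
      qed
      then have "{a..b} \<times> {v..d} \<subseteq> square \<inter> W" using e(2) r by force
      then have "h ` ({a..b} \<times> {v..d}) \<subseteq> U i" using W(2) by blast
      then show "extendable h ({a..b} \<times> {v..d})" by (rule extendable_local[OF i(1)])
    qed
    then show ?thesis using e(1) by (intro exI[of _ "e / 2"]) auto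
  qed
  have strip: "\<exists>\<delta>>0. \<forall>v d. v \<le> y \<and> y \<le> d \<and> d - v < \<delta> \<longrightarrow> P 0 1 v d" if y: "0 \<le> y" "y \<le> 1" for y
  proof -
    have "0 \<le> (0::real) \<and> (1::real) \<le> 1 \<longrightarrow> (\<exists>\<delta>>0. \<forall>v d. v \<le> y \<and> y \<le> d \<and> d - v < \<delta> \<longrightarrow> P 0 1 v d)"
    proof (rule Bolzano[of 0 1 "\<lambda>a b. 0 \<le> a \<and> b \<le> 1 \<longrightarrow> (\<exists>\<delta>>0. \<forall>v d. v \<le> y \<and> y \<le> d \<and> d - v < \<delta> \<longrightarrow> P a b v d)"])
      fix a b e :: real
      assume 1: "0 \<le> a \<and> b \<le> 1 \<longrightarrow> (\<exists>\<delta>>0. \<forall>v d. v \<le> y \<and> y \<le> d \<and> d - v < \<delta> \<longrightarrow> P a b v d)"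
        and 2: "0 \<le> b \<and> e \<le> 1 \<longrightarrow> (\<exists>\<delta>>0. \<forall>v d. v \<le> y \<and> y \<le> d \<and> d - v < \<delta> \<longrightarrow> P b e v d)"
        and abe: "a \<le> b" "b \<le> e"
      show "0 \<le> a \<and> e \<le> 1 \<longrightarrow> (\<exists>\<delta>>0. \<forall>v d. v \<le> y \<and> y \<le> d \<and> d - v < \<delta> \<longrightarrow> P a e v d)"
      proof
        assume "0 \<le> a \<and> e \<le> 1"
        then obtain d1 d2 where "d1 > 0" "\<forall>v d. v \<le> y \<and> y \<le> d \<and> d - v < d1 \<longrightarrow> P a b v d"
          "d2 > 0" "\<forall>v d. v \<le> y \<and> y \<le> d \<and> d - v < d2 \<longrightarrow> P b e v d"
          using 1 2 abe by auto
        then show "\<exists>\<delta>>0. \<forall>v d. v \<le> y \<and> y \<le> d \<and> d - v < \<delta> \<longrightarrow> P a e v d"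
          using P1 abe by (intro exI[of _ "min d1 d2"]) (metis min_less_iff_conj)
      qed
    next
      fix x :: real assume x: "0 \<le> x" "x \<le> 1"
      obtain \<delta> where "\<delta> > 0" "\<forall>a b v d. a \<le> x \<and> x \<le> b \<and> b - a < \<delta> \<and> v \<le> y \<and> y \<le> d \<and> d - v < \<delta> \<longrightarrow> P a b v d"
        using loc[OF x y] by auto
      then show "\<exists>d>0. \<forall>a b. a \<le> x \<and> x \<le> b \<and> b - a < d \<longrightarrow>
          (0 \<le> a \<and> b \<le> 1 \<longrightarrow> (\<exists>\<delta>>0. \<forall>v d. v \<le> y \<and> y \<le> d \<and> d - v < \<delta> \<longrightarrow> P a b v d))"
        by metis
    qed simp
    then show ?thesis by simp
  qed
  have "P 0 1 0 1"
  proof (rule Bolzano[of 0 1 "P 0 1"])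
    fix a b e :: real assume "P 0 1 a b" "P 0 1 b e" "a \<le> b" "b \<le> e"
    then show "P 0 1 a e" by (rule P2)
  next
    fix y :: real assume "0 \<le> y" "y \<le> 1"
    from strip[OF this] show "\<exists>d>0. \<forall>a b. a \<le> y \<and> y \<le> b \<and> b - a < d \<longrightarrow> P 0 1 a b" .
  qed simp
  then show ?thesis by (simp add: P_def)
qed

abbreviation unit_topology :: "real topology"
  where "unit_topology \<equiv> top_of_set {0..1}"

lemma connected_unit: "connected_space unit_topology"
  by (simp add: connected_space_subtopology)

text \<open>A path is a square that is constant in the first coordinate.\<close>

lemma parallel_path_exists:
  assumes "pathin X \<gamma>" "s \<in> S"
  obtains \<sigma> where "parallel unit_topology \<gamma> \<sigma>" "\<sigma> 0 = s"
proof -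
  have "continuous_map (top_of_set square) unit_topology snd"
    by (auto simp: continuous_map_in_subtopology continuous_map_iff_continuous2 intro: continuous_intros)
  then have "continuous_map (top_of_set square) X (\<gamma> \<circ> snd)"
    using assms(1) unfolding pathin_def by (rule continuous_map_compose)
  then have "extendable (\<gamma> \<circ> snd) square" by (rule extendable_square)
  then obtain \<sigma> where \<sigma>: "parallel (top_of_set square) (\<gamma> \<circ> snd) \<sigma>" "\<sigma> (0, 0) = s"
    using assms(2) unfolding extendable_def by force
  have "continuous_map unit_topology (top_of_set square) (\<lambda>t. (0, t))"
    by (auto simp: continuous_map_in_subtopology continuous_map_iff_continuous2 intro!: continuous_intros)
  from parallel_compose[OF \<sigma>(1) this] have "parallel unit_topology \<gamma> (\<sigma> \<circ> (\<lambda>t. (0, t)))"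
    by (rule parallel_cong) auto
  with \<sigma>(2) that show ?thesis by force
qed

text \<open>Determined for paths in \<open>X\<close> and \<open>s \<in> S\<close>, by existence and
  uniqueness of parallel sections.\<close>

definition transport :: "(real \<Rightarrow> 'b) \<Rightarrow> 's \<Rightarrow> 's"
  where "transport \<gamma> s = (SOME t. \<exists>\<sigma>. parallel unit_topology \<gamma> \<sigma> \<and> \<sigma> 0 = s \<and> \<sigma> 1 = t)"

lemma transport_eq:
  assumes "pathin X \<gamma>" "parallel unit_topology \<gamma> \<sigma>"
  shows "transport \<gamma> (\<sigma> 0) = \<sigma> 1"
proof -
  have "\<exists>\<tau>. parallel unit_topology \<gamma> \<tau> \<and> \<tau> 0 = \<sigma> 0 \<and> \<tau> 1 = transport \<gamma> (\<sigma> 0)"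
    unfolding transport_def by (rule someI[of _ "\<sigma> 1"]) (use assms in blast)
  then obtain \<tau> where "parallel unit_topology \<gamma> \<tau>" "\<tau> 0 = \<sigma> 0" "\<tau> 1 = transport \<gamma> (\<sigma> 0)" by blast
  then show ?thesis
    using parallel_unique[OF connected_unit _ assms(2), of \<tau> 0 1] assms(1) by (simp add: pathin_def)
qed

lemma transport_in:
  assumes "pathin X \<gamma>" "s \<in> S" shows "transport \<gamma> s \<in> S"
proof -
  obtain \<sigma> where "parallel unit_topology \<gamma> \<sigma>" "\<sigma> 0 = s" using parallel_path_exists[OF assms] .
  with transport_eq[OF assms(1)] parallel_in[of unit_topology \<gamma> \<sigma> 1] show ?thesis by auto
qed

lemma transport_join:
  assumes f: "pathin X f" and g: "pathin X g" and fg: "pathin X (loop_join f g)" "f 1 = g 0" and s: "s \<in> S"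
  shows "transport (loop_join f g) s = transport g (transport f s)"
proof -
  obtain \<sigma> where \<sigma>: "parallel unit_topology (loop_join f g) \<sigma>" "\<sigma> 0 = s"
    using parallel_path_exists[OF fg(1) s] .
  have c1: "continuous_map unit_topology unit_topology (\<lambda>t. t / 2)"
    and c2: "continuous_map unit_topology unit_topology (\<lambda>t. (t + 1) / 2)"
    by (auto simp: continuous_map_in_subtopology continuous_map_iff_continuous2 intro!: continuous_intros)
  have p1: "parallel unit_topology f (\<lambda>t. \<sigma> (t / 2))"
    using parallel_compose[OF \<sigma>(1) c1] by (rule parallel_cong) (auto simp: loop_join_def)
  have p2: "parallel unit_topology g (\<lambda>t. \<sigma> ((t + 1) / 2))"
    using parallel_compose[OF \<sigma>(1) c2]
  proof (rule parallel_cong)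
    fix t :: real assume "t \<in> topspace unit_topology"
    then show "(loop_join f g \<circ> (\<lambda>t. (t + 1) / 2)) t = g t"
      using fg(2) by (cases "t = 0") (auto simp: loop_join_def add_divide_distrib)
  qed simp
  show ?thesis
    using transport_eq[OF f p1] transport_eq[OF g p2] transport_eq[OF fg(1) \<sigma>(1)] \<sigma>(2) by simp
qed

lemma parallel_const:
  assumes "x \<in> topspace X" "s \<in> S"
  shows "parallel Z (\<lambda>_. x) (\<lambda>_. s)"
proof -
  obtain i where i: "i \<in> I" "x \<in> U i" using U_cover assms by auto
  let ?t = "act s (inv (c i x))"
  have "?t \<in> S" "act ?t (c i x) = s"
    using c_closed[OF i] assms act_closed act_inv by auto
  then show ?thesis
    unfolding parallel_def using i by (intro ballI bexI[of _ i] exI[of _ "topspace Z"] exI[of _ ?t]) auto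
qed

lemma loop_homotopyD:
  assumes "(f, g) \<in> loop_homotopy X x"
  obtains H where "continuous_map (top_of_set square) X H"
    "\<And>t. H (0, t) = f t" "\<And>t. H (1, t) = g t"
    "\<And>u. u \<in> {0..1} \<Longrightarrow> H (u, 0) = x" "\<And>u. u \<in> {0..1} \<Longrightarrow> H (u, 1) = x"
  using assms by (auto simp: loop_homotopy_def homotopic_with_def prod_topology_subtopology_eu intro!: that)

text \<open>On the two edges where the endpoints of the loops rest at \<open>x\<close>, the section
  is parallel over a constant map, hence constant.\<close>

lemma homotopy_parallel:
  assumes H: "continuous_map (top_of_set square) X H" "\<And>u. u \<in> {0..1} \<Longrightarrow> H (u, 0) = x" "\<And>u. u \<in> {0..1} \<Longrightarrow> H (u, 1) = x"
    and x: "x \<in> topspace X" and s: "s \<in> S"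
  obtains \<sigma> where "parallel (top_of_set square) H \<sigma>" "\<And>u. u \<in> {0..1} \<Longrightarrow> \<sigma> (u, 0) = s"
    "\<And>u. u \<in> {0..1} \<Longrightarrow> \<sigma> (u, 1) = \<sigma> (0, 1)"
proof -
  obtain \<sigma> where \<sigma>: "parallel (top_of_set square) H \<sigma>" "\<sigma> (0, 0) = s"
    using extendable_square[OF H(1)] s unfolding extendable_def by force
  have edge: "\<sigma> (u, b) = \<sigma> (0, b)" if b: "b = 0 \<or> b = 1" and u: "u \<in> {0..1}" for u b
  proof -
    have cm: "continuous_map unit_topology (top_of_set square) (\<lambda>u. (u, b))"
      using b by (auto simp: continuous_map_in_subtopology continuous_map_iff_continuous2 intro!: continuous_intros)
    have p: "parallel unit_topology (\<lambda>_. x) (\<lambda>u. \<sigma> (u, b))"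
      using parallel_compose[OF \<sigma>(1) cm] by (rule parallel_cong) (use b H in auto)
    have "\<sigma> (0, b) \<in> S" using parallel_in[OF p, of 0] by simp
    from parallel_unique[OF connected_unit _ p parallel_const[OF x this], of 0 u] u x show ?thesis by simp
  qed
  show ?thesis
  proof (rule that[OF \<sigma>(1)])
    fix u :: real assume u: "u \<in> {0..1}"
    show "\<sigma> (u, 0) = s" unfolding \<sigma>(2)[symmetric] by (rule edge[OF _ u]) simp
    show "\<sigma> (u, 1) = \<sigma> (0, 1)" by (rule edge[OF _ u]) simp
  qed
qed

lemma transport_homotopic:
  assumes fg: "(f, g) \<in> loop_homotopy X x" and s: "s \<in> S"
  shows "transport f s = transport g s"
proof -
  obtain H where H: "continuous_map (top_of_set square) X H"
    "\<And>t. H (0, t) = f t" "\<And>t. H (1, t) = g t"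
    "\<And>u. u \<in> {0..1} \<Longrightarrow> H (u, 0) = x" "\<And>u. u \<in> {0..1} \<Longrightarrow> H (u, 1) = x"
    using loop_homotopyD[OF fg] by metis
  have loops: "pathin X f" "pathin X g" "x \<in> topspace X"
    using fg by (auto simp: loop_homotopy_def loops_at_def pathin_def continuous_map_def Pi_iff)
  obtain \<sigma> where \<sigma>: "parallel (top_of_set square) H \<sigma>" "\<And>u. u \<in> {0..1} \<Longrightarrow> \<sigma> (u, 0) = s"
    "\<And>u. u \<in> {0..1} \<Longrightarrow> \<sigma> (u, 1) = \<sigma> (0, 1)"
    using homotopy_parallel[OF H(1,4,5) loops(3) s] by metis
  have cm: "continuous_map unit_topology (top_of_set square) (\<lambda>t. (u, t))" if "u \<in> {0..1}" for u
    using that by (auto simp: continuous_map_in_subtopology continuous_map_iff_continuous2 intro!: continuous_intros)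
  have c0: "continuous_map unit_topology (top_of_set square) (\<lambda>t. (0, t))"
    and c1: "continuous_map unit_topology (top_of_set square) (\<lambda>t. (1, t))"
    using cm[of 0] cm[of 1] by auto
  have p0: "parallel unit_topology f (\<lambda>t. \<sigma> (0, t))"
    using parallel_compose[OF \<sigma>(1) c0] by (rule parallel_cong) (auto simp: H(2))
  have p1: "parallel unit_topology g (\<lambda>t. \<sigma> (1, t))"
    using parallel_compose[OF \<sigma>(1) c1] by (rule parallel_cong) (auto simp: H(3))
  from transport_eq[OF loops(1) p0] transport_eq[OF loops(2) p1] \<sigma>(2,3)[of 1] \<sigma>(2)[of 0]
  show ?thesis by simp
qed

end

section \<open>The cover as a product with a twisted topology\<close>

context gset_cocycle
begin

definition sheet :: "'i \<Rightarrow> 's \<Rightarrow> 'b set \<Rightarrow> ('b \<times> 's) set"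
  where "sheet i t V = (\<lambda>y. (y, act t (c i y))) ` V"

text \<open>The points of the cover are plain pairs, and the twist lies in the topology alone: its
  basic open sets are the graphs \<open>sheet i t V\<close> of sections with constant coordinate
  \<open>t\<close>.\<close>

definition cover_open :: "('b \<times> 's) set \<Rightarrow> bool"
  where "cover_open W \<longleftrightarrow> W \<subseteq> topspace X \<times> S \<and>
    (\<forall>x s. (x, s) \<in> W \<longrightarrow> (\<exists>i\<in>I. \<exists>V. \<exists>t\<in>S. openin X V \<and> x \<in> V \<and> V \<subseteq> U i \<and>
      s = act t (c i x) \<and> sheet i t V \<subseteq> W))"

definition cover :: "('b \<times> 's) topology"
  where "cover = topology cover_open"

lemma sheet_change:
  assumes i: "i \<in> I" "openin X V" "x \<in> V" "V \<subseteq> U i" "t \<in> S" and j: "j \<in> I" "x \<in> U j"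
    and t': "t' \<in> S" "act t (c i x) = act t' (c j x)"
  obtains V' where "openin X V'" "x \<in> V'" "V' \<subseteq> V" "V' \<subseteq> U j" "\<And>y. y \<in> V' \<Longrightarrow> act t (c i y) = act t' (c j y)"
proof -
  have "x \<in> U i" using i by auto
  from c_locally[OF i(1) j(1) this j(2)] obtain W g where W: "openin X W" "x \<in> W" "W \<subseteq> U i \<inter> U j"
    "g \<in> carrier G" "\<forall>y\<in>W. c i y = g \<otimes> c j y"
    by meson
  have *: "act t (c i y) = act (act t g) (c j y)" if "y \<in> W" for y
    using that W i(5) act_mult[of t g "c j y"] c_closed[OF j(1), of y] by auto
  have "act (act t g) (c j x) = act t' (c j x)" using *[OF W(2)] t'(2) by simp
  then have "act t g = t'"
    using act_inj act_closed[OF i(5) W(4)] t'(1) c_closed[OF j] by blast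
  then show ?thesis
    using * W i openin_Int[OF i(2) W(1)] by (intro that[of "V \<inter> W"]) auto
qed

lemma istopology_cover_open: "istopology cover_open"
  unfolding istopology_def
proof (intro conjI allI impI)
  fix A B assume A: "cover_open A" and B: "cover_open B"
  show "cover_open (A \<inter> B)"
    unfolding cover_open_def
  proof (intro conjI allI impI)
    show "A \<inter> B \<subseteq> topspace X \<times> S" using A by (auto simp: cover_open_def)
    fix x s assume xs: "(x, s) \<in> A \<inter> B"
    obtain i V t where i: "i \<in> I" "openin X V" "x \<in> V" "V \<subseteq> U i" "t \<in> S" and s: "s = act t (c i x)" and WA: "sheet i t V \<subseteq> A"
      using A xs unfolding cover_open_def by blast
    obtain j V' t' where j: "j \<in> I" "openin X V'" "x \<in> V'" "V' \<subseteq> U j" "t' \<in> S" and s': "s = act t' (c j x)" and WB: "sheet j t' V' \<subseteq> B"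
      using B xs unfolding cover_open_def by blast
    have "x \<in> U j" "act t (c i x) = act t' (c j x)" using j s s' by auto
    then obtain V'' where V'': "openin X V''" "x \<in> V''" "V'' \<subseteq> V" "V'' \<subseteq> U j"
      "\<And>y. y \<in> V'' \<Longrightarrow> act t (c i y) = act t' (c j y)"
      using sheet_change[OF i j(1) _ j(5)] by metis
    have "sheet i t (V'' \<inter> V') \<subseteq> A" using WA V''(3) by (auto simp: sheet_def)
    moreover have "sheet i t (V'' \<inter> V') \<subseteq> B" using WB V''(5) by (force simp: sheet_def)
    ultimately show "\<exists>i\<in>I. \<exists>V. \<exists>t\<in>S. openin X V \<and> x \<in> V \<and> V \<subseteq> U i \<and> s = act t (c i x) \<and> sheet i t V \<subseteq> A \<inter> B"
      using i j V'' s openin_Int[OF V''(1) j(2)]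
      by (intro bexI[of _ i] exI[of _ "V'' \<inter> V'"] bexI[of _ t]) auto
  qed
next
  fix \<K> assume K: "\<forall>A\<in>\<K>. cover_open A"
  show "cover_open (\<Union>\<K>)"
    unfolding cover_open_def
  proof (intro conjI allI impI)
    show "\<Union>\<K> \<subseteq> topspace X \<times> S" using K by (auto simp: cover_open_def)
    fix x s assume "(x, s) \<in> \<Union>\<K>"
    then obtain A where A: "A \<in> \<K>" "(x, s) \<in> A" by auto
    then obtain i V t where "i \<in> I" "openin X V" "x \<in> V" "V \<subseteq> U i" "t \<in> S" "s = act t (c i x)" "sheet i t V \<subseteq> A"
      using K unfolding cover_open_def by blast
    then show "\<exists>i\<in>I. \<exists>V. \<exists>t\<in>S. openin X V \<and> x \<in> V \<and> V \<subseteq> U i \<and> s = act t (c i x) \<and> sheet i t V \<subseteq> \<Union>\<K>"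
      using A by blast
  qed
qed

lemma openin_cover: "openin cover W \<longleftrightarrow> cover_open W"
  by (simp add: cover_def topology_inverse' istopology_cover_open)

lemma openin_sheet:
  assumes "i \<in> I" "openin X V" "V \<subseteq> U i" "t \<in> S"
  shows "openin cover (sheet i t V)"
  unfolding openin_cover cover_open_def
proof (intro conjI allI impI)
  show "sheet i t V \<subseteq> topspace X \<times> S"
    using assms openin_subset[OF assms(2)] c_closed[OF assms(1)] act_closed by (auto simp: sheet_def)
  fix x s assume "(x, s) \<in> sheet i t V"
  then show "\<exists>i'\<in>I. \<exists>V'. \<exists>t'\<in>S. openin X V' \<and> x \<in> V' \<and> V' \<subseteq> U i' \<and> s = act t' (c i' x) \<and> sheet i' t' V' \<subseteq> sheet i t V"
    using assms by (intro bexI[of _ i] exI[of _ V] bexI[of _ t]) (auto simp: sheet_def)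
qed

lemma chart_coordinate:
  assumes "i \<in> I" "x \<in> U i" "s \<in> S"
  obtains t where "t \<in> S" "s = act t (c i x)"
  using assms c_closed act_closed act_inv by (metis inv_closed)

lemma topspace_cover: "topspace cover = topspace X \<times> S"
proof
  show "topspace cover \<subseteq> topspace X \<times> S"
    using openin_topspace[of cover] unfolding openin_cover cover_open_def by blast
  show "topspace X \<times> S \<subseteq> topspace cover"
  proof clarify
    fix x s assume xs: "x \<in> topspace X" "s \<in> S"
    then obtain i where i: "i \<in> I" "x \<in> U i" using U_cover by auto
    obtain t where t: "t \<in> S" "s = act t (c i x)" by (rule chart_coordinate[OF i xs(2)])
    have "(x, s) \<in> sheet i t (U i)" using i t by (auto simp: sheet_def)
    then show "(x, s) \<in> topspace cover"
      using openin_subset[OF openin_sheet[OF i(1) U_open[OF i(1)] subset_refl t(1)]] by blast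
  qed
qed

lemma continuous_map_fst_cover: "continuous_map cover X fst"
  unfolding continuous_map_def
proof (intro conjI allI impI)
  show "fst \<in> topspace cover \<rightarrow> topspace X" by (auto simp: topspace_cover)
  fix V assume V: "openin X V"
  show "openin cover {z \<in> topspace cover. fst z \<in> V}"
    unfolding openin_cover cover_open_def
  proof (intro conjI allI impI)
    show "{z \<in> topspace cover. fst z \<in> V} \<subseteq> topspace X \<times> S" by (auto simp: topspace_cover)
    fix x s assume "(x, s) \<in> {z \<in> topspace cover. fst z \<in> V}"
    then have xs: "x \<in> topspace X" "s \<in> S" "x \<in> V" by (auto simp: topspace_cover)
    then obtain i where i: "i \<in> I" "x \<in> U i" using U_cover by auto
    obtain t where t: "t \<in> S" "s = act t (c i x)" by (rule chart_coordinate[OF i xs(2)])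
    have "openin X (V \<inter> U i)" using V U_open[OF i(1)] by blast
    moreover from this have "sheet i t (V \<inter> U i) \<subseteq> {z \<in> topspace cover. fst z \<in> V}"
      using openin_subset[OF openin_sheet[OF i(1) _ _ t(1), of "V \<inter> U i"]] by (auto simp: sheet_def)
    ultimately show "\<exists>i\<in>I. \<exists>V'. \<exists>t\<in>S. openin X V' \<and> x \<in> V' \<and> V' \<subseteq> U i \<and> s = act t (c i x) \<and>
        sheet i t V' \<subseteq> {z \<in> topspace cover. fst z \<in> V}"
      using i t xs by (intro bexI[of _ i] exI[of _ "V \<inter> U i"] bexI[of _ t]) auto
  qed
qed

text \<open>Near a point, both sides say that \<open>snd \<circ> f\<close> has a constant coordinate
  in a chart. This reduces the lifting of paths and homotopies to parallel sections.\<close>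

lemma continuous_map_cover:
  "continuous_map Z cover f \<longleftrightarrow> continuous_map Z X (fst \<circ> f) \<and> parallel Z (fst \<circ> f) (snd \<circ> f)"
proof
  assume f: "continuous_map Z cover f"
  have ff: "continuous_map Z X (fst \<circ> f)"
    by (rule continuous_map_compose[OF f continuous_map_fst_cover])
  have "parallel Z (fst \<circ> f) (snd \<circ> f)"
    unfolding parallel_def
  proof
    fix z assume z: "z \<in> topspace Z"
    then have "f z \<in> topspace X \<times> S" using f by (auto simp: continuous_map_def topspace_cover)
    then obtain x s where xs: "f z = (x, s)" "x \<in> topspace X" "s \<in> S" by auto
    then obtain i where i: "i \<in> I" "x \<in> U i" using U_cover by auto
    obtain t where t: "t \<in> S" "s = act t (c i x)" by (rule chart_coordinate[OF i xs(3)])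
    have "openin Z {y \<in> topspace Z. f y \<in> sheet i t (U i)}"
      using openin_continuous_map_preimage[OF f openin_sheet[OF i(1) U_open[OF i(1)] subset_refl t(1)]] .
    then show "\<exists>i\<in>I. \<exists>V s. openin Z V \<and> z \<in> V \<and> s \<in> S \<and>
        (\<forall>y\<in>V. (fst \<circ> f) y \<in> U i \<and> (snd \<circ> f) y = act s (c i ((fst \<circ> f) y)))"
      using i t xs z
      by (intro bexI[of _ i] exI[of _ "{y \<in> topspace Z. f y \<in> sheet i t (U i)}"] exI[of _ t]) (auto simp: sheet_def)
  qed
  with ff show "continuous_map Z X (fst \<circ> f) \<and> parallel Z (fst \<circ> f) (snd \<circ> f)" by blast
next
  assume "continuous_map Z X (fst \<circ> f) \<and> parallel Z (fst \<circ> f) (snd \<circ> f)"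
  then have f1: "continuous_map Z X (fst \<circ> f)" and f2: "parallel Z (fst \<circ> f) (snd \<circ> f)" by auto
  show "continuous_map Z cover f"
    unfolding continuous_map_def
  proof (intro conjI allI impI)
    show "f \<in> topspace Z \<rightarrow> topspace cover"
      using f1 parallel_in[OF f2] by (auto simp: topspace_cover continuous_map_def mem_Times_iff Pi_iff)
    fix W assume W: "openin cover W"
    show "openin Z {z \<in> topspace Z. f z \<in> W}"
    proof (subst openin_subopen, rule ballI)
      fix z assume "z \<in> {z \<in> topspace Z. f z \<in> W}"
      then have z: "z \<in> topspace Z" "f z \<in> W" by auto
      obtain x s where xs: "f z = (x, s)" by fastforce
      then obtain i V t where i: "i \<in> I" "openin X V" "x \<in> V" "V \<subseteq> U i" "t \<in> S" "s = act t (c i x)" "sheet i t V \<subseteq> W"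
        using W z unfolding openin_cover cover_open_def by metis
      have xi: "(fst \<circ> f) z \<in> U i" using xs i by auto
      obtain V' s' where V': "openin Z V'" "z \<in> V'" "s' \<in> S"
        "\<And>y. y \<in> V' \<Longrightarrow> (fst \<circ> f) y \<in> U i \<and> (snd \<circ> f) y = act s' (c i ((fst \<circ> f) y))"
        by (rule parallel_chart[OF f2 f1 z(1) i(1) xi]) blast
      have "act s' (c i x) = act t (c i x)" using V'(4)[OF V'(2)] xs i by simp
      then have "s' = t" using act_inj V'(3) i c_closed by (metis subsetD)
      have "openin Z (V' \<inter> {y \<in> topspace Z. (fst \<circ> f) y \<in> V})"
        using V'(1) openin_continuous_map_preimage[OF f1 i(2)] by blast
      moreover have "f y \<in> W" if "y \<in> V' \<inter> {y \<in> topspace Z. (fst \<circ> f) y \<in> V}" for y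
      proof -
        have fy: "fst (f y) \<in> V" and "snd (f y) = act t (c i (fst (f y)))"
          using that V'(4)[of y] \<open>s' = t\<close> by auto
        then have "f y = (fst (f y), act t (c i (fst (f y))))" by (simp add: prod_eq_iff)
        then have "f y \<in> sheet i t V" unfolding sheet_def using fy by (rule image_eqI)
        then show ?thesis using i by blast
      qed
      ultimately show "\<exists>T. openin Z T \<and> z \<in> T \<and> T \<subseteq> {z \<in> topspace Z. f z \<in> W}"
        using V' xs i z by (intro exI[of _ "V' \<inter> {y \<in> topspace Z. (fst \<circ> f) y \<in> V}"]) auto
    qed
  qed
qed

lemma continuous_map_sheet:
  assumes i: "i \<in> I" and t: "t \<in> S"
  shows "continuous_map (subtopology X (U i)) cover (\<lambda>y. (y, act t (c i y)))"
proof -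
  have "parallel (subtopology X (U i)) (\<lambda>y. y) (\<lambda>y. act t (c i y))"
    unfolding parallel_def
    using i t by (intro ballI bexI[of _ i] exI[of _ "topspace (subtopology X (U i))"] exI[of _ t] conjI
        openin_topspace) auto
  then show ?thesis
    by (simp add: continuous_map_cover comp_def continuous_map_from_subtopology)
qed

lemma covering_map_cover:
  assumes "S \<noteq> {}"
  shows "covering_map cover X fst"
  unfolding covering_map_def
proof (intro conjI ballI)
  show "continuous_map cover X fst" by (rule continuous_map_fst_cover)
  show "fst ` topspace cover = topspace X" using assms by (auto simp: topspace_cover)
  fix x assume "x \<in> topspace X"
  then obtain i where i: "i \<in> I" "x \<in> U i" using U_cover by auto
  have Ui: "U i \<subseteq> topspace X" using openin_subset[OF U_open[OF i(1)]] .
  let ?V = "(\<lambda>t. sheet i t (U i)) ` S"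
  have "\<Union>?V = {y \<in> topspace cover. fst y \<in> U i}"
  proof
    show "\<Union>?V \<subseteq> {y \<in> topspace cover. fst y \<in> U i}"
      using openin_subset[OF openin_sheet[OF i(1) U_open[OF i(1)] subset_refl]] by (auto simp: sheet_def)
    show "{y \<in> topspace cover. fst y \<in> U i} \<subseteq> \<Union>?V"
    proof clarify
      fix y s assume "(y, s) \<in> topspace cover" "fst (y, s) \<in> U i"
      then have y: "y \<in> U i" "s \<in> S" by (auto simp: topspace_cover)
      obtain t where "t \<in> S" "s = act t (c i y)" by (rule chart_coordinate[OF i(1) y])
      then show "(y, s) \<in> \<Union>?V" using y by (auto simp: sheet_def)
    qed
  qed
  moreover have "\<forall>W\<in>?V. openin cover W"
    using openin_sheet[OF i(1) U_open[OF i(1)] subset_refl] by auto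
  moreover have "pairwise disjnt ?V"
  proof (rule pairwiseI)
    fix A B assume AB: "A \<in> ?V" "B \<in> ?V" "A \<noteq> B"
    then obtain t t' where t: "A = sheet i t (U i)" "B = sheet i t' (U i)" "t \<in> S" "t' \<in> S" by auto
    then have "t \<noteq> t'" using AB by auto
    then show "disjnt A B"
      using act_inj[OF _ t(3,4) c_closed[OF i(1)]] unfolding t disjnt_iff sheet_def by auto
  qed
  moreover have "\<forall>W\<in>?V. homeomorphic_map (subtopology cover W) (subtopology X (U i)) fst"
  proof
    fix W assume "W \<in> ?V"
    then obtain t where t: "t \<in> S" "W = sheet i t (U i)" by auto
    have W: "W \<subseteq> topspace cover"
      using openin_subset[OF openin_sheet[OF i(1) U_open[OF i(1)] subset_refl t(1)]] t by simp
    have "homeomorphic_maps (subtopology cover W) (subtopology X (U i)) fst (\<lambda>y. (y, act t (c i y)))"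
      unfolding homeomorphic_maps_def
      using W Ui continuous_map_sheet[OF i(1) t(1)]
      by (auto simp: continuous_map_in_subtopology t(2) sheet_def
          intro: continuous_map_from_subtopology continuous_map_fst_cover)
    then show "homeomorphic_map (subtopology cover W) (subtopology X (U i)) fst"
      using homeomorphic_map_maps by blast
  qed
  ultimately show "\<exists>T. x \<in> T \<and> openin X T \<and> (\<exists>\<V>. \<Union>\<V> = {y \<in> topspace cover. fst y \<in> T} \<and>
      (\<forall>U\<in>\<V>. openin cover U) \<and> pairwise disjnt \<V> \<and>
      (\<forall>Ua\<in>\<V>. homeomorphic_map (subtopology cover Ua) (subtopology X T) fst))"
    using i U_open[OF i(1)] by (intro exI[of _ "U i"] conjI exI[of _ ?V])
qed

lemma covering_of_degree_cover:
  assumes "finite S" "card S = n" "n > 0"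
  shows "covering_of_degree n cover X fst"
proof -
  have "{y \<in> topspace cover. fst y = x} = Pair x ` S" if "x \<in> topspace X" for x
    using that by (auto simp: topspace_cover)
  moreover have "S \<noteq> {}" using assms by auto
  ultimately show ?thesis
    using assms covering_map_cover unfolding covering_of_degree_def
    by (auto simp: card_image inj_on_def)
qed

section \<open>Loops and homotopies in the cover\<close>

lemma loops_at_cover:
  assumes "f \<in> loops_at cover (x, s)"
  shows "fst \<circ> f \<in> loops_at X x" "parallel unit_topology (fst \<circ> f) (snd \<circ> f)" "s \<in> S"
    "transport (fst \<circ> f) s = s"
proof -
  have f: "continuous_map unit_topology cover f" "f 0 = (x, s)" "f 1 = (x, s)"
    using assms by (auto simp: loops_at_def pathin_def)
  then show 1: "fst \<circ> f \<in> loops_at X x" and 2: "parallel unit_topology (fst \<circ> f) (snd \<circ> f)"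
    by (auto simp: continuous_map_cover loops_at_def pathin_def)
  show "s \<in> S" using parallel_in[OF 2, of 0] f by simp
  show "transport (fst \<circ> f) s = s"
    using transport_eq[OF _ 2] 1 f by (auto simp: loops_at_def)
qed

text \<open>Injectivity of the projection on fundamental groups: the homotopy downstairs carries a
  parallel section that starts at \<open>s\<close>, and by uniqueness it restricts to the second
  components of the two given loops.\<close>

lemma loop_homotopy_lift:
  assumes f: "f \<in> loops_at cover (x, s)" and g: "g \<in> loops_at cover (x, s)"
    and fg: "(fst \<circ> f, fst \<circ> g) \<in> loop_homotopy X x"
  shows "(f, g) \<in> loop_homotopy cover (x, s)"
proof -
  note lf = loops_at_cover[OF f] and lg = loops_at_cover[OF g]
  obtain H where H: "continuous_map (top_of_set square) X H"
    "\<And>t. H (0, t) = (fst \<circ> f) t" "\<And>t. H (1, t) = (fst \<circ> g) t"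
    "\<And>u. u \<in> {0..1} \<Longrightarrow> H (u, 0) = x" "\<And>u. u \<in> {0..1} \<Longrightarrow> H (u, 1) = x"
    using loop_homotopyD[OF fg] by metis
  have paths: "pathin X (fst \<circ> f)" "pathin X (fst \<circ> g)" "x \<in> topspace X"
    using lf(1) lg(1) by (auto simp: loops_at_def pathin_def continuous_map_def Pi_iff)
  have f01: "f 0 = (x, s)" "f 1 = (x, s)" "g 0 = (x, s)" "g 1 = (x, s)"
    using f g by (auto simp: loops_at_def)
  obtain \<sigma> where \<sigma>: "parallel (top_of_set square) H \<sigma>" "\<And>u. u \<in> {0..1} \<Longrightarrow> \<sigma> (u, 0) = s"
    "\<And>u. u \<in> {0..1} \<Longrightarrow> \<sigma> (u, 1) = \<sigma> (0, 1)"
    using homotopy_parallel[OF H(1,4,5) paths(3) lf(3)] by metis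
  have c0: "continuous_map unit_topology (top_of_set square) (\<lambda>t. (0, t))"
    and c1: "continuous_map unit_topology (top_of_set square) (\<lambda>t. (1, t))"
    by (auto simp: continuous_map_in_subtopology continuous_map_iff_continuous2 intro!: continuous_intros)
  have p0: "parallel unit_topology (fst \<circ> f) (\<lambda>t. \<sigma> (0, t))"
    using parallel_compose[OF \<sigma>(1) c0] by (rule parallel_cong) (auto simp: H(2))
  have p1: "parallel unit_topology (fst \<circ> g) (\<lambda>t. \<sigma> (1, t))"
    using parallel_compose[OF \<sigma>(1) c1] by (rule parallel_cong) (auto simp: H(3))
  have e0: "\<sigma> (0, t) = (snd \<circ> f) t" if "t \<in> {0..1}" for t
    by (rule parallel_unique[OF connected_unit _ p0 lf(2), of 0])
       (use paths that f01 \<sigma>(2)[of 0] in \<open>auto simp: pathin_def\<close>)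
  have e1: "\<sigma> (1, t) = (snd \<circ> g) t" if "t \<in> {0..1}" for t
    by (rule parallel_unique[OF connected_unit _ p1 lg(2), of 0])
       (use paths that f01 \<sigma>(2)[of 1] in \<open>auto simp: pathin_def\<close>)
  have s1: "\<sigma> (u, 1) = s" if "u \<in> {0..1}" for u
    using \<sigma>(3)[OF that] e0[of 1] f01 by simp
  have "homotopic_with (\<lambda>h. h 0 = (x, s) \<and> h 1 = (x, s)) unit_topology cover f g"
  proof (subst homotopic_with, force, intro exI conjI)
    show "continuous_map (prod_topology unit_topology unit_topology) cover (\<lambda>z. (H z, \<sigma> z))"
      using H(1) \<sigma>(1) by (simp add: prod_topology_subtopology_eu continuous_map_cover comp_def)
    show "\<forall>t\<in>topspace unit_topology. (H (0, t), \<sigma> (0, t)) = f t"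
      using e0 H(2) by (auto simp: prod_eq_iff)
    show "\<forall>t\<in>topspace unit_topology. (H (1, t), \<sigma> (1, t)) = g t"
      using e1 H(3) by (auto simp: prod_eq_iff)
    show "\<forall>u\<in>{0..1}. (\<lambda>t. (H (u, t), \<sigma> (u, t))) 0 = (x, s) \<and> (\<lambda>t. (H (u, t), \<sigma> (u, t))) 1 = (x, s)"
      using H(4,5) \<sigma>(2) s1 by simp
  qed
  then show ?thesis using f g by (simp add: loop_homotopy_def)
qed

lemma loop_homotopy_project:
  assumes "(f, g) \<in> loop_homotopy cover (x, s)"
  shows "(fst \<circ> f, fst \<circ> g) \<in> loop_homotopy X x"
proof -
  have "homotopic_with (\<lambda>h. h 0 = x \<and> h 1 = x) unit_topology X (fst \<circ> f) (fst \<circ> g)"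
    by (rule homotopic_with_compose_continuous_map_left[where q = "\<lambda>h. h 0 = x \<and> h 1 = x", OF _ continuous_map_fst_cover])
       (use assms in \<open>auto simp: loop_homotopy_def elim: homotopic_with_mono\<close>)
  then show ?thesis
    using assms loops_at_cover(1) by (auto simp: loop_homotopy_def)
qed

end

section \<open>The fundamental group and coordinates of paths\<close>

definition path_in :: "'b::real_normed_vector set \<Rightarrow> (real \<Rightarrow> 'b) \<Rightarrow> 'b \<Rightarrow> 'b \<Rightarrow> bool"
  where "path_in M p x y \<longleftrightarrow> path p \<and> path_image p \<subseteq> M \<and> pathstart p = x \<and> pathfinish p = y"

lemma path_in_join [intro]: "path_in M p x y \<Longrightarrow> path_in M q y z \<Longrightarrow> path_in M (p +++ q) x z"
  by (auto simp: path_in_def path_image_join)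

lemma path_in_reverse [intro]: "path_in M p x y \<Longrightarrow> path_in M (reversepath p) y x"
  by (auto simp: path_in_def)

lemma path_in_linepath [intro]: "x \<in> M \<Longrightarrow> path_in M (linepath x x) x x"
  by (auto simp: path_in_def)

lemma path_in_mono: "path_in M p x y \<Longrightarrow> M \<subseteq> N \<Longrightarrow> path_in N p x y"
  by (auto simp: path_in_def)

lemma path_in_ends: "path_in M p x y \<Longrightarrow> x \<in> M \<and> y \<in> M"
  by (auto simp: path_in_def intro: pathstart_in_path_image pathfinish_in_path_image)

abbreviation hom_eq :: "'b::real_normed_vector set \<Rightarrow> (real \<Rightarrow> 'b) \<Rightarrow> (real \<Rightarrow> 'b) \<Rightarrow> bool"
  where "hom_eq \<equiv> homotopic_paths"

lemma hom_eq_refl: "path_in M p x y \<Longrightarrow> hom_eq M p p"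
  by (simp add: path_in_def)

lemma hom_eq_path_in: "hom_eq M p q \<Longrightarrow> path_in M p x y \<Longrightarrow> path_in M q x y"
  by (metis homotopic_paths_imp_path homotopic_paths_imp_pathfinish homotopic_paths_imp_pathstart
      homotopic_paths_imp_subset path_in_def)

lemma hom_eq_join:
  "hom_eq M p p' \<Longrightarrow> hom_eq M q q' \<Longrightarrow> path_in M p x y \<Longrightarrow> path_in M q y z \<Longrightarrow> hom_eq M (p +++ q) (p' +++ q')"
  by (rule homotopic_paths_join) (auto simp: path_in_def)

lemma hom_eq_assoc:
  "path_in M p w x \<Longrightarrow> path_in M q x y \<Longrightarrow> path_in M r y z \<Longrightarrow> hom_eq M ((p +++ q) +++ r) (p +++ (q +++ r))"
  by (rule homotopic_paths_sym, rule homotopic_paths_assoc) (auto simp: path_in_def)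

lemma hom_eq_cancel_right:
  assumes "path_in M p x y" "path_in M q y z"
  shows "hom_eq M ((p +++ q) +++ reversepath q) p"
proof -
  note q' = path_in_reverse[OF assms(2)]
  have y: "y \<in> M" using path_in_ends[OF assms(1)] by simp
  have "hom_eq M ((p +++ q) +++ reversepath q) (p +++ (q +++ reversepath q))"
    by (rule hom_eq_assoc[OF assms q'])
  also have "hom_eq M \<dots> (p +++ linepath y y)"
    using assms by (intro hom_eq_join[OF hom_eq_refl[OF assms(1)] _ assms(1) path_in_join[OF assms(2) q']])
      (use homotopic_paths_rinv[of q M] in \<open>auto simp: path_in_def\<close>)
  also have "hom_eq M \<dots> p"
    using assms(1) by (intro homotopic_paths_rid') (auto simp: path_in_def)
  finally show ?thesis .
qed

lemma loops_at_top_of_set: "loops_at (top_of_set M) x = {p. path_in M p x x}"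
  by (auto simp: loops_at_def pathin_canon_iff path_in_def path_image_def pathstart_def pathfinish_def
      image_subset_iff_funcset)

lemma loop_homotopy_top_of_set:
  "(p, q) \<in> loop_homotopy (top_of_set M) x \<longleftrightarrow> path_in M p x x \<and> path_in M q x x \<and> hom_eq M p q"
  by (auto simp: loop_homotopy_def loops_at_top_of_set homotopic_paths_def path_in_def pathstart_def
      pathfinish_def elim: homotopic_with_mono)

lemma loop_join_eq: "loop_join f g = f +++ g"
  by (simp add: loop_join_def joinpaths_def)

definition loop_class :: "'b::real_normed_vector set \<Rightarrow> 'b \<Rightarrow> (real \<Rightarrow> 'b) \<Rightarrow> (real \<Rightarrow> 'b) set"
  where "loop_class M x p = loop_homotopy (top_of_set M) x `` {p}"

abbreviation pi1 :: "'b::real_normed_vector set \<Rightarrow> 'b \<Rightarrow> (real \<Rightarrow> 'b) set monoid"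
  where "pi1 M x \<equiv> fundamental_group (top_of_set M) x"

lemma mem_loop_class: "q \<in> loop_class M x p \<longleftrightarrow> path_in M p x x \<and> path_in M q x x \<and> hom_eq M p q"
  by (simp add: loop_class_def loop_homotopy_top_of_set)

lemma loop_class_eq_iff:
  assumes "path_in M p x x" "path_in M q x x"
  shows "loop_class M x p = loop_class M x q \<longleftrightarrow> hom_eq M p q"
proof
  assume "loop_class M x p = loop_class M x q"
  moreover have "q \<in> loop_class M x q" using assms hom_eq_refl[OF assms(2)] by (simp add: mem_loop_class)
  ultimately show "hom_eq M p q" by (metis mem_loop_class)
next
  assume pq: "hom_eq M p q"
  show "loop_class M x p = loop_class M x q"
    using assms pq homotopic_paths_sym[OF pq] by (auto simp: mem_loop_class intro: homotopic_paths_trans)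
qed

lemma loop_class_eqI: "hom_eq M p q \<Longrightarrow> path_in M p x x \<Longrightarrow> loop_class M x p = loop_class M x q"
  using hom_eq_path_in loop_class_eq_iff by blast

lemma carrier_pi1: "carrier (pi1 M x) = loop_class M x ` {p. path_in M p x x}"
  by (auto simp: fundamental_group_def quotient_def loops_at_top_of_set loop_class_def)

lemma loop_class_carrier [intro]: "path_in M p x x \<Longrightarrow> loop_class M x p \<in> carrier (pi1 M x)"
  by (auto simp: carrier_pi1)

lemma mult_pi1:
  assumes "path_in M p x x" "path_in M q x x"
  shows "loop_class M x p \<otimes>\<^bsub>pi1 M x\<^esub> loop_class M x q = loop_class M x (p +++ q)"
proof -
  let ?A = "loop_class M x p" and ?B = "loop_class M x q" and ?C = "loop_class M x (p +++ q)"
  have *: "loop_class M x (p' +++ q') = ?C" if "p' \<in> ?A" "q' \<in> ?B" for p' q'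
    using that hom_eq_join[of M p p' q q' x x x] assms
    by (subst loop_class_eq_iff) (auto simp: mem_loop_class intro: homotopic_paths_sym)
  have ne: "p \<in> ?A" "q \<in> ?B" 
    using assms hom_eq_refl[OF assms(1)] hom_eq_refl[OF assms(2)] by (auto simp: mem_loop_class)
  have "(\<Union>p'\<in>?A. \<Union>q'\<in>?B. loop_class M x (p' +++ q')) = ?C"
  proof (rule SUP_eq_const)
    show "?A \<noteq> {}" using ne(1) by (metis empty_iff)
    show "(\<Union>q'\<in>?B. loop_class M x (p' +++ q')) = ?C" if "p' \<in> ?A" for p'
    proof (rule SUP_eq_const)
      show "?B \<noteq> {}" using ne(2) by (metis empty_iff)
      show "loop_class M x (p' +++ q') = ?C" if "q' \<in> ?B" for q'
        using \<open>p' \<in> ?A\<close> that by (rule *)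
    qed
  qed
  then show ?thesis
    by (simp add: fundamental_group_def loop_class_def loop_join_eq)
qed

lemma one_pi1:
  assumes "x \<in> M" shows "\<one>\<^bsub>pi1 M x\<^esub> = loop_class M x (linepath x x)"
proof -
  have "(\<lambda>_. x) = linepath x x" by (simp add: linepath_def fun_eq_iff algebra_simps)
  then show ?thesis by (simp add: fundamental_group_def loop_class_def)
qed

lemma group_pi1:
  assumes x: "x \<in> M" shows "group (pi1 M x)"
proof (rule groupI)
  fix A B C assume "A \<in> carrier (pi1 M x)" "B \<in> carrier (pi1 M x)" "C \<in> carrier (pi1 M x)"
  then obtain p q r where p: "A = loop_class M x p" "B = loop_class M x q" "C = loop_class M x r"
    "path_in M p x x" "path_in M q x x" "path_in M r x x"
    by (auto simp: carrier_pi1)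
  then show "A \<otimes>\<^bsub>pi1 M x\<^esub> B \<in> carrier (pi1 M x)"
    by (auto simp: mult_pi1)
  show "A \<otimes>\<^bsub>pi1 M x\<^esub> B \<otimes>\<^bsub>pi1 M x\<^esub> C = A \<otimes>\<^bsub>pi1 M x\<^esub> (B \<otimes>\<^bsub>pi1 M x\<^esub> C)"
    using p path_in_join[OF p(4,5)] path_in_join[OF p(5,6)]
      loop_class_eqI[OF hom_eq_assoc[OF p(4-6)] path_in_join[OF path_in_join[OF p(4,5)] p(6)]]
    by (simp add: mult_pi1)
next
  fix A assume "A \<in> carrier (pi1 M x)"
  then obtain p where p: "A = loop_class M x p" "path_in M p x x" by (auto simp: carrier_pi1)
  show "\<one>\<^bsub>pi1 M x\<^esub> \<otimes>\<^bsub>pi1 M x\<^esub> A = A"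
  proof -
    have "hom_eq M (linepath x x +++ p) p"
      using p(2) by (intro homotopic_paths_lid') (auto simp: path_in_def)
    from loop_class_eqI[OF this] show ?thesis
      using p path_in_join[OF path_in_linepath[OF x] p(2)] path_in_linepath[OF x]
      by (simp add: one_pi1[OF x] mult_pi1)
  qed
  have "hom_eq M (reversepath p +++ p) (linepath x x)"
    using homotopic_paths_linv[of p M] p by (simp add: path_in_def)
  then show "\<exists>B\<in>carrier (pi1 M x). B \<otimes>\<^bsub>pi1 M x\<^esub> A = \<one>\<^bsub>pi1 M x\<^esub>"
    using loop_class_eqI[of M "reversepath p +++ p" "linepath x x" x] path_in_reverse[OF p(2)] p
      path_in_join[OF path_in_reverse[OF p(2)] p(2)]
    by (intro bexI[of _ "loop_class M x (reversepath p)"]) (auto simp: one_pi1[OF x] mult_pi1)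
qed (use x in \<open>auto simp: one_pi1\<close>)

text \<open>Compares two paths with common ends by a loop at their start. Changes of charts and
  endpoints then become the rules \<open>path_diff_mult\<close> and
  \<open>path_diff_extend\<close>.\<close>

definition path_diff :: "'b::real_normed_vector set \<Rightarrow> 'b \<Rightarrow> (real \<Rightarrow> 'b) \<Rightarrow> (real \<Rightarrow> 'b) \<Rightarrow> (real \<Rightarrow> 'b) set"
  where "path_diff M x p q = loop_class M x (p +++ reversepath q)"

lemma path_diff_carrier [intro]: "path_in M p x y \<Longrightarrow> path_in M q x y \<Longrightarrow> path_diff M x p q \<in> carrier (pi1 M x)"
  by (auto simp: path_diff_def)

lemma path_diff_hom_eq:
  assumes p: "path_in M p x y" and q: "path_in M q x y" and "hom_eq M p p'" "hom_eq M q q'"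
  shows "path_diff M x p q = path_diff M x p' q'"
proof -
  have "hom_eq M (p +++ reversepath q) (p' +++ reversepath q')"
    using assms by (intro hom_eq_join[OF _ _ p path_in_reverse[OF q]]) (auto simp: homotopic_paths_reversepath)
  from loop_class_eqI[OF this path_in_join[OF p path_in_reverse[OF q]]] show ?thesis
    unfolding path_diff_def .
qed

lemma path_diff_mult:
  assumes p: "path_in M p x y" and q: "path_in M q x y" and r: "path_in M r x y"
  shows "path_diff M x p q \<otimes>\<^bsub>pi1 M x\<^esub> path_diff M x q r = path_diff M x p r"
proof -
  note q' = path_in_reverse[OF q] and r' = path_in_reverse[OF r]
  have "hom_eq M ((p +++ reversepath q) +++ (q +++ reversepath r)) (((p +++ reversepath q) +++ q) +++ reversepath r)"
    by (rule homotopic_paths_sym, rule hom_eq_assoc) (use p q r' q' in auto)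
  also have "hom_eq M \<dots> (p +++ reversepath r)"
    by (rule hom_eq_join[OF _ hom_eq_refl[OF r']])
       (use p q r' q' hom_eq_cancel_right[OF p q'] in auto)
  finally have "hom_eq M ((p +++ reversepath q) +++ (q +++ reversepath r)) (p +++ reversepath r)" .
  from loop_class_eqI[OF this path_in_join[OF path_in_join[OF p q'] path_in_join[OF q r']]]
  show ?thesis
    unfolding path_diff_def mult_pi1[OF path_in_join[OF p q'] path_in_join[OF q r']] .
qed

lemma path_diff_extend:
  assumes p: "path_in M p x y" and q: "path_in M q x y" and d: "path_in M d y z"
  shows "path_diff M x (p +++ d) (q +++ d) = path_diff M x p q"
proof -
  note q' = path_in_reverse[OF q] and d' = path_in_reverse[OF d]
  have r: "reversepath (q +++ d) = reversepath d +++ reversepath q"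
    using q d by (intro reversepath_joinpaths) (auto simp: path_in_def)
  have "hom_eq M ((p +++ d) +++ (reversepath d +++ reversepath q)) (((p +++ d) +++ reversepath d) +++ reversepath q)"
    by (rule homotopic_paths_sym, rule hom_eq_assoc) (use p d d' q' in auto)
  also have "hom_eq M \<dots> (p +++ reversepath q)"
    by (rule hom_eq_join[OF _ hom_eq_refl[OF q']])
       (use p d d' q' hom_eq_cancel_right[OF p d] in auto)
  finally have "hom_eq M ((p +++ d) +++ (reversepath d +++ reversepath q)) (p +++ reversepath q)" .
  from loop_class_eqI[OF this path_in_join[OF path_in_join[OF p d] path_in_join[OF d' q']]]
  show ?thesis unfolding path_diff_def r .
qed

lemma path_diff_self:
  assumes p: "path_in M p x y" shows "path_diff M x p p = \<one>\<^bsub>pi1 M x\<^esub>"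
proof -
  have x: "x \<in> M" using path_in_ends[OF p] by simp
  have "hom_eq M (p +++ reversepath p) (linepath x x)"
    using homotopic_paths_rinv[of p M] p by (simp add: path_in_def)
  from loop_class_eqI[OF this path_in_join[OF p path_in_reverse[OF p]]] show ?thesis
    unfolding path_diff_def one_pi1[OF x] .
qed

lemma path_diff_inj:
  assumes p: "path_in M p x y" and q: "path_in M q x y" and eq: "path_diff M x p q = \<one>\<^bsub>pi1 M x\<^esub>"
  shows "hom_eq M p q"
proof -
  note q' = path_in_reverse[OF q]
  have "path_diff M x p q = path_diff M x q q" using eq path_diff_self[OF q] by simp
  then have *: "hom_eq M (p +++ reversepath q) (q +++ reversepath q)"
    unfolding path_diff_def loop_class_eq_iff[OF path_in_join[OF p q'] path_in_join[OF q q']] .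
  have "hom_eq M p ((p +++ reversepath q) +++ q)"
    using hom_eq_cancel_right[OF p q'] by (simp add: homotopic_paths_sym)
  also have "hom_eq M \<dots> ((q +++ reversepath q) +++ q)"
    by (rule hom_eq_join[OF * hom_eq_refl[OF q]]) (use p q q' in auto)
  also have "hom_eq M \<dots> q"
    using hom_eq_cancel_right[OF q q'] by simp
  finally show ?thesis .
qed

section \<open>Charts marked by paths from the base point\<close>

lemma (in group) inv_mult_cancel:
  "x \<in> carrier G \<Longrightarrow> y \<in> carrier G \<Longrightarrow> inv x \<otimes> (x \<otimes> y) = y"
  "x \<in> carrier G \<Longrightarrow> y \<in> carrier G \<Longrightarrow> x \<otimes> (inv x \<otimes> y) = y"
  by (simp_all flip: m_assoc)

text \<open>Every point of a chart gets a path from \<open>x0\<close>, compatible up to homotopy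
  with moving inside the chart. Two such paths to one point form a loop, and \<open>\<Phi>\<close>
  sends the transition elements of the cocycle to the classes of these loops.\<close>

locale marked_cocycle = cocycle G "top_of_set M" I U c
  for G :: "('a, 'm) monoid_scheme" (structure) and M :: "'b::real_normed_vector set" and I :: "'i set" and U c +
  fixes x0 :: 'b and \<kappa> :: "'i \<Rightarrow> 'b \<Rightarrow> real \<Rightarrow> 'b" and \<Phi>
  assumes \<kappa>_path: "i \<in> I \<Longrightarrow> x \<in> U i \<Longrightarrow> path_in M (\<kappa> i x) x0 x"
    and \<kappa>_extend: "i \<in> I \<Longrightarrow> path_in (U i) d x y \<Longrightarrow> hom_eq M (\<kappa> i x +++ d) (\<kappa> i y)"
    and x0: "x0 \<in> M"
    and \<Phi>: "\<Phi> \<in> hom G (pi1 M x0)"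
    and \<kappa>_change: "i \<in> I \<Longrightarrow> j \<in> I \<Longrightarrow> x \<in> U i \<Longrightarrow> x \<in> U j \<Longrightarrow>
      path_diff M x0 (\<kappa> i x) (\<kappa> j x) = \<Phi> (c i x \<otimes> inv c j x)"

sublocale marked_cocycle \<subseteq> torsor: gset_cocycle G "top_of_set M" I U c "carrier G" "(\<otimes>)"
  by unfold_locales (auto simp: m_assoc)

context marked_cocycle
begin

text \<open>Both sides are multiplicative under subdivision, because the chart and the value of
  \<open>\<sigma>\<close> at an intermediate point cancel. A short piece stays in one chart
  \<open>l\<close>, where moving along it changes no marking, so that only the changes of chart at
  its two ends are left.\<close>

lemma path_coordinates:
  assumes \<gamma>: "path \<gamma>" "path_image \<gamma> \<subseteq> M" and \<sigma>: "torsor.parallel torsor.unit_topology \<gamma> \<sigma>"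
    and ij: "i \<in> I" "j \<in> I" "\<gamma> 0 \<in> U i" "\<gamma> 1 \<in> U j"
  shows "path_diff M x0 (\<kappa> i (\<gamma> 0) +++ \<gamma>) (\<kappa> j (\<gamma> 1)) =
    \<Phi> (c i (\<gamma> 0) \<otimes> inv (\<sigma> 0) \<otimes> (\<sigma> 1 \<otimes> inv (c j (\<gamma> 1))))"
proof -
  interpret P: group "pi1 M x0" by (rule group_pi1[OF x0])
  have sub: "path_in M (subpath a b \<gamma>) (\<gamma> a) (\<gamma> b)" if "0 \<le> a" "a \<le> 1" "0 \<le> b" "b \<le> 1" for a b
    using that \<gamma> path_image_subpath_subset[of a b \<gamma>] by (auto simp: path_in_def)
  have pin: "pathin (top_of_set M) \<gamma>"
    using \<gamma> by (auto simp: pathin_canon_iff path_image_def)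
  then have cm: "continuous_map torsor.unit_topology (top_of_set M) \<gamma>" by (simp add: pathin_def)
  have \<sigma>G: "\<sigma> t \<in> carrier G" if "0 \<le> t" "t \<le> 1" for t
    using torsor.parallel_in[OF \<sigma>] that by simp
  have chart: "\<exists>k\<in>I. \<gamma> t \<in> U k" if "0 \<le> t" "t \<le> 1" for t
    using that \<gamma>(2) U_cover by (force simp: path_image_def)
  define Q where "Q a b \<longleftrightarrow> (0 \<le> a \<and> a \<le> b \<and> b \<le> 1 \<longrightarrow> (\<forall>i\<in>I. \<forall>j\<in>I. \<gamma> a \<in> U i \<and> \<gamma> b \<in> U j \<longrightarrow>
     path_diff M x0 (\<kappa> i (\<gamma> a) +++ subpath a b \<gamma>) (\<kappa> j (\<gamma> b)) =
     \<Phi> (c i (\<gamma> a) \<otimes> inv (\<sigma> a) \<otimes> (\<sigma> b \<otimes> inv (c j (\<gamma> b))))))" for a b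
  have "Q 0 1"
  proof (rule Bolzano)
    fix a b e assume ab: "Q a b" "Q b e" "a \<le> b" "b \<le> e"
    show "Q a e"
      unfolding Q_def
    proof (intro impI ballI)
      fix i j assume r: "0 \<le> a \<and> a \<le> e \<and> e \<le> 1" and ij: "i \<in> I" "j \<in> I" "\<gamma> a \<in> U i \<and> \<gamma> e \<in> U j"
      have b: "0 \<le> b" "b \<le> 1" using r ab by auto
      obtain k where k: "k \<in> I" "\<gamma> b \<in> U k" using chart[OF b] by auto
      have s: "path_in M (subpath a b \<gamma>) (\<gamma> a) (\<gamma> b)" "path_in M (subpath b e \<gamma>) (\<gamma> b) (\<gamma> e)"
        "path_in M (subpath a e \<gamma>) (\<gamma> a) (\<gamma> e)"
        using sub r b by auto
      have K: "path_in M (\<kappa> i (\<gamma> a)) x0 (\<gamma> a)" "path_in M (\<kappa> k (\<gamma> b)) x0 (\<gamma> b)" "path_in M (\<kappa> j (\<gamma> e)) x0 (\<gamma> e)"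
        using \<kappa>_path ij k by auto
      have cc: "c i (\<gamma> a) \<in> carrier G" "c k (\<gamma> b) \<in> carrier G" "c j (\<gamma> e) \<in> carrier G"
        using c_closed ij k by auto
      have ss: "\<sigma> a \<in> carrier G" "\<sigma> b \<in> carrier G" "\<sigma> e \<in> carrier G" using \<sigma>G r b by auto
      have "hom_eq M (\<kappa> i (\<gamma> a) +++ subpath a e \<gamma>) (\<kappa> i (\<gamma> a) +++ (subpath a b \<gamma> +++ subpath b e \<gamma>))"
        using r b \<gamma> s K
        by (intro hom_eq_join[OF hom_eq_refl[OF K(1)] _ K(1) s(3)] homotopic_paths_sym[OF homotopic_join_subpaths]) auto
      also have "hom_eq M \<dots> ((\<kappa> i (\<gamma> a) +++ subpath a b \<gamma>) +++ subpath b e \<gamma>)"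
        by (rule homotopic_paths_sym[OF hom_eq_assoc[OF K(1) s(1,2)]])
      finally have h: "hom_eq M (\<kappa> i (\<gamma> a) +++ subpath a e \<gamma>) ((\<kappa> i (\<gamma> a) +++ subpath a b \<gamma>) +++ subpath b e \<gamma>)" .
      have "path_diff M x0 (\<kappa> i (\<gamma> a) +++ subpath a e \<gamma>) (\<kappa> j (\<gamma> e)) =
          path_diff M x0 ((\<kappa> i (\<gamma> a) +++ subpath a b \<gamma>) +++ subpath b e \<gamma>) (\<kappa> j (\<gamma> e))"
        by (rule path_diff_hom_eq[OF path_in_join[OF K(1) s(3)] K(3) h hom_eq_refl[OF K(3)]])
      also have "\<dots> = path_diff M x0 ((\<kappa> i (\<gamma> a) +++ subpath a b \<gamma>) +++ subpath b e \<gamma>) (\<kappa> k (\<gamma> b) +++ subpath b e \<gamma>) \<otimes>\<^bsub>pi1 M x0\<^esub>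
          path_diff M x0 (\<kappa> k (\<gamma> b) +++ subpath b e \<gamma>) (\<kappa> j (\<gamma> e))"
        by (rule path_diff_mult[symmetric]) (use K s in auto)
      also have "path_diff M x0 ((\<kappa> i (\<gamma> a) +++ subpath a b \<gamma>) +++ subpath b e \<gamma>) (\<kappa> k (\<gamma> b) +++ subpath b e \<gamma>) =
          path_diff M x0 (\<kappa> i (\<gamma> a) +++ subpath a b \<gamma>) (\<kappa> k (\<gamma> b))"
        by (rule path_diff_extend[OF path_in_join[OF K(1) s(1)] K(2) s(2)])
      also have "\<dots> = \<Phi> (c i (\<gamma> a) \<otimes> inv (\<sigma> a) \<otimes> (\<sigma> b \<otimes> inv (c k (\<gamma> b))))"
        using ab(1) r b ij k ab unfolding Q_def by auto
      also have "path_diff M x0 (\<kappa> k (\<gamma> b) +++ subpath b e \<gamma>) (\<kappa> j (\<gamma> e)) =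
          \<Phi> (c k (\<gamma> b) \<otimes> inv (\<sigma> b) \<otimes> (\<sigma> e \<otimes> inv (c j (\<gamma> e))))"
        using ab(2) r b ij k ab unfolding Q_def by auto
      also have "\<Phi> (c i (\<gamma> a) \<otimes> inv (\<sigma> a) \<otimes> (\<sigma> b \<otimes> inv (c k (\<gamma> b)))) \<otimes>\<^bsub>pi1 M x0\<^esub>
            \<Phi> (c k (\<gamma> b) \<otimes> inv (\<sigma> b) \<otimes> (\<sigma> e \<otimes> inv (c j (\<gamma> e)))) =
          \<Phi> ((c i (\<gamma> a) \<otimes> inv (\<sigma> a) \<otimes> (\<sigma> b \<otimes> inv (c k (\<gamma> b)))) \<otimes> (c k (\<gamma> b) \<otimes> inv (\<sigma> b) \<otimes> (\<sigma> e \<otimes> inv (c j (\<gamma> e)))))"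
        by (rule hom_mult[OF \<Phi>, symmetric]) (use cc ss in auto)
      also have "(c i (\<gamma> a) \<otimes> inv (\<sigma> a) \<otimes> (\<sigma> b \<otimes> inv (c k (\<gamma> b)))) \<otimes> (c k (\<gamma> b) \<otimes> inv (\<sigma> b) \<otimes> (\<sigma> e \<otimes> inv (c j (\<gamma> e)))) =
          c i (\<gamma> a) \<otimes> inv (\<sigma> a) \<otimes> (\<sigma> e \<otimes> inv (c j (\<gamma> e)))"
        using cc ss by (simp add: m_assoc inv_mult_cancel)
      finally show "path_diff M x0 (\<kappa> i (\<gamma> a) +++ subpath a e \<gamma>) (\<kappa> j (\<gamma> e)) =
          \<Phi> (c i (\<gamma> a) \<otimes> inv (\<sigma> a) \<otimes> (\<sigma> e \<otimes> inv (c j (\<gamma> e))))" .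
    qed
  next
    fix x :: real assume x: "0 \<le> x" "x \<le> 1"
    obtain l where l: "l \<in> I" "\<gamma> x \<in> U l" using chart[OF x] by auto
    have x': "x \<in> topspace torsor.unit_topology" using x by simp
    obtain V s where V: "openin torsor.unit_topology V" "x \<in> V" "s \<in> carrier G"
      "\<And>y. y \<in> V \<Longrightarrow> \<gamma> y \<in> U l \<and> \<sigma> y = s \<otimes> c l (\<gamma> y)"
      by (rule torsor.parallel_chart[OF \<sigma> cm x' l]) blast
    then obtain W where W: "open W" "V = {0..1} \<inter> W" by (auto simp: openin_open)
    then obtain d where d: "d > 0" "ball x d \<subseteq> W" using V(2) openE by blast
    have "Q a b" if ab: "a \<le> x" "x \<le> b" "b - a < d" for a b
      unfolding Q_def
    proof (intro impI ballI)
      fix i j assume r: "0 \<le> a \<and> a \<le> b \<and> b \<le> 1" and ij: "i \<in> I" "j \<in> I" "\<gamma> a \<in> U i \<and> \<gamma> b \<in> U j"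
      have V': "y \<in> V" if "y \<in> {a..b}" for y
      proof -
        have "y \<in> ball x d" using that ab by (auto simp: dist_real_def)
        then show ?thesis using d that r W by auto
      qed
      have a: "\<gamma> a \<in> U l" "\<sigma> a = s \<otimes> c l (\<gamma> a)" and b: "\<gamma> b \<in> U l" "\<sigma> b = s \<otimes> c l (\<gamma> b)"
        using V(4)[OF V'[of a]] V(4)[OF V'[of b]] r by auto
      have "path_image (subpath a b \<gamma>) \<subseteq> U l"
        using V(4) V' r by (auto simp: path_image_subpath)
      then have sl: "path_in (U l) (subpath a b \<gamma>) (\<gamma> a) (\<gamma> b)"
        using r \<gamma> by (auto simp: path_in_def)
      have s: "path_in M (subpath a b \<gamma>) (\<gamma> a) (\<gamma> b)" using sub r by auto
      have K: "path_in M (\<kappa> i (\<gamma> a)) x0 (\<gamma> a)" "path_in M (\<kappa> l (\<gamma> a)) x0 (\<gamma> a)"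
        "path_in M (\<kappa> l (\<gamma> b)) x0 (\<gamma> b)" "path_in M (\<kappa> j (\<gamma> b)) x0 (\<gamma> b)"
        using \<kappa>_path ij l a b by auto
      have cc: "c i (\<gamma> a) \<in> carrier G" "c l (\<gamma> a) \<in> carrier G" "c l (\<gamma> b) \<in> carrier G" "c j (\<gamma> b) \<in> carrier G"
        using c_closed ij l a b by auto
      have "path_diff M x0 (\<kappa> i (\<gamma> a) +++ subpath a b \<gamma>) (\<kappa> j (\<gamma> b)) =
          path_diff M x0 (\<kappa> i (\<gamma> a) +++ subpath a b \<gamma>) (\<kappa> l (\<gamma> a) +++ subpath a b \<gamma>) \<otimes>\<^bsub>pi1 M x0\<^esub>
          path_diff M x0 (\<kappa> l (\<gamma> a) +++ subpath a b \<gamma>) (\<kappa> j (\<gamma> b))"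
        by (rule path_diff_mult[symmetric]) (use K s in auto)
      also have "path_diff M x0 (\<kappa> i (\<gamma> a) +++ subpath a b \<gamma>) (\<kappa> l (\<gamma> a) +++ subpath a b \<gamma>) =
          path_diff M x0 (\<kappa> i (\<gamma> a)) (\<kappa> l (\<gamma> a))"
        by (rule path_diff_extend[OF K(1,2) s])
      also have "\<dots> = \<Phi> (c i (\<gamma> a) \<otimes> inv c l (\<gamma> a))"
        using \<kappa>_change ij l a by auto
      also have "path_diff M x0 (\<kappa> l (\<gamma> a) +++ subpath a b \<gamma>) (\<kappa> j (\<gamma> b)) = path_diff M x0 (\<kappa> l (\<gamma> b)) (\<kappa> j (\<gamma> b))"
        by (rule path_diff_hom_eq[OF path_in_join[OF K(2) s] K(4) \<kappa>_extend[OF l(1) sl] hom_eq_refl[OF K(4)]])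
      also have "\<dots> = \<Phi> (c l (\<gamma> b) \<otimes> inv c j (\<gamma> b))"
        using \<kappa>_change ij l b by auto
      also have "\<Phi> (c i (\<gamma> a) \<otimes> inv c l (\<gamma> a)) \<otimes>\<^bsub>pi1 M x0\<^esub> \<Phi> (c l (\<gamma> b) \<otimes> inv c j (\<gamma> b)) =
          \<Phi> (c i (\<gamma> a) \<otimes> inv c l (\<gamma> a) \<otimes> (c l (\<gamma> b) \<otimes> inv c j (\<gamma> b)))"
        by (rule hom_mult[OF \<Phi>, symmetric]) (use cc in auto)
      also have "c i (\<gamma> a) \<otimes> inv c l (\<gamma> a) \<otimes> (c l (\<gamma> b) \<otimes> inv c j (\<gamma> b)) =
          c i (\<gamma> a) \<otimes> inv (\<sigma> a) \<otimes> (\<sigma> b \<otimes> inv (c j (\<gamma> b)))"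
        using cc V(3) unfolding a(2) b(2) by (simp add: inv_mult_group m_assoc inv_mult_cancel)
      finally show "path_diff M x0 (\<kappa> i (\<gamma> a) +++ subpath a b \<gamma>) (\<kappa> j (\<gamma> b)) =
          \<Phi> (c i (\<gamma> a) \<otimes> inv (\<sigma> a) \<otimes> (\<sigma> b \<otimes> inv (c j (\<gamma> b))))" .
    qed
    then show "\<exists>d>0. \<forall>a b. a \<le> x \<and> x \<le> b \<and> b - a < d \<longrightarrow> Q a b"
      using d(1) by (intro exI[of _ d]) auto
  qed simp
  then show ?thesis using ij by (auto simp: Q_def)
qed

definition holonomy :: "(real \<Rightarrow> 'b) \<Rightarrow> 'a"
  where "holonomy \<gamma> = torsor.transport \<gamma> \<one>"

text \<open>For a loop and the section starting at one, \<open>path_coordinates\<close> gives the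
  class of the loop, conjugated by a marking path, as \<open>\<Phi>\<close> of a conjugate of the
  holonomy. So the holonomy determines the class.\<close>

lemma holonomy_injective:
  assumes p: "path_in M p x x" and q: "path_in M q x x" and eq: "holonomy p = holonomy q"
  shows "hom_eq M p q"
proof -
  interpret P: group "pi1 M x0" by (rule group_pi1[OF x0])
  have x: "x \<in> M" using path_in_ends[OF p] by simp
  then obtain i where i: "i \<in> I" "x \<in> U i" using U_cover by auto
  have K: "path_in M (\<kappa> i x) x0 x" by (rule \<kappa>_path[OF i])
  have "path_diff M x0 (\<kappa> i x +++ r) (\<kappa> i x) = \<Phi> (c i x \<otimes> (holonomy r \<otimes> inv (c i x)))"
    if r: "path_in M r x x" for r
  proof -
    have pin: "pathin (top_of_set M) r"
      using r by (auto simp: pathin_canon_iff path_image_def path_in_def)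
    obtain \<sigma> where \<sigma>: "torsor.parallel torsor.unit_topology r \<sigma>" "\<sigma> 0 = \<one>"
      by (rule torsor.parallel_path_exists[OF pin, of \<one>]) auto
    have "\<sigma> 1 = holonomy r"
      using torsor.transport_eq[OF pin \<sigma>(1)] \<sigma>(2) by (simp add: holonomy_def)
    moreover have "r 0 = x" "r 1 = x" using r by (auto simp: path_in_def pathstart_def pathfinish_def)
    ultimately show ?thesis
      using path_coordinates[of r \<sigma> i i] r i \<sigma> c_closed[OF i] by (auto simp: path_in_def)
  qed
  from this[OF p] this[OF q] eq
  have "path_diff M x0 (\<kappa> i x +++ p) (\<kappa> i x) = path_diff M x0 (\<kappa> i x +++ q) (\<kappa> i x)" by simp
  moreover have "path_diff M x0 (\<kappa> i x +++ q) (\<kappa> i x) \<otimes>\<^bsub>pi1 M x0\<^esub> path_diff M x0 (\<kappa> i x) (\<kappa> i x +++ q) = \<one>\<^bsub>pi1 M x0\<^esub>"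
    using path_diff_mult[OF path_in_join[OF K q] K path_in_join[OF K q]] path_diff_self[OF path_in_join[OF K q]] by simp
  ultimately have "path_diff M x0 (\<kappa> i x +++ p) (\<kappa> i x +++ q) = \<one>\<^bsub>pi1 M x0\<^esub>"
    using path_diff_mult[OF path_in_join[OF K p] K path_in_join[OF K q]] by simp
  then have h: "hom_eq M (\<kappa> i x +++ p) (\<kappa> i x +++ q)"
    by (rule path_diff_inj[OF path_in_join[OF K p] path_in_join[OF K q]])
  have canc: "hom_eq M (reversepath (\<kappa> i x) +++ (\<kappa> i x +++ r)) r" if r: "path_in M r x x" for r
  proof -
    have "hom_eq M (reversepath (\<kappa> i x) +++ (\<kappa> i x +++ r)) ((reversepath (\<kappa> i x) +++ \<kappa> i x) +++ r)"
      by (rule homotopic_paths_sym[OF hom_eq_assoc[OF path_in_reverse[OF K] K r]])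
    also have "hom_eq M \<dots> (linepath x x +++ r)"
      by (rule hom_eq_join[OF _ hom_eq_refl[OF r] path_in_join[OF path_in_reverse[OF K] K] r])
         (use homotopic_paths_linv[of "\<kappa> i x" M] K in \<open>auto simp: path_in_def\<close>)
    also have "hom_eq M \<dots> r"
      using r by (intro homotopic_paths_lid') (auto simp: path_in_def)
    finally show ?thesis .
  qed
  have "hom_eq M p (reversepath (\<kappa> i x) +++ (\<kappa> i x +++ p))"
    by (rule homotopic_paths_sym[OF canc[OF p]])
  also have "hom_eq M \<dots> (reversepath (\<kappa> i x) +++ (\<kappa> i x +++ q))"
    by (rule hom_eq_join[OF hom_eq_refl[OF path_in_reverse[OF K]] h path_in_reverse[OF K] path_in_join[OF K p]])
  also have "hom_eq M \<dots> q" by (rule canc[OF q])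
  finally show ?thesis .
qed

end

section \<open>Spaces with the decomposition of the figure-eight complement\<close>

datatype region = Above | Below | Outer | Crossing nat

text \<open>The loop that goes down through face \<open>k\<close> and returns through the outer face
  0, as in the Dehn presentation of a knot group. Faces 1 and 5 give the generators; the crossings
  \<open>(4,1)\<close>, \<open>(3,4)\<close> and \<open>(1,3)\<close> are solved for the faces 4, 3
  and 2.\<close>

definition face_word :: "nat \<Rightarrow> nat word"
  where "face_word k = (if k = 1 then [(0, True)] else if k = 5 then [(1, True)]
    else if k = 3 then [(1, False), (0, True), (1, True)] else if k = 4 then [(0, True), (1, True)]
    else if k = 2 then [(1, False), (0, True), (1, True), (0, True)] else [])"

text \<open>
  The faces in the quadrants of the four crossings \<open>(1,3)\<close>, \<open>(2,2)\<close>, \<open>(4,1)\<close>, \<open>(3,4)\<close>.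
\<close>

definition sw :: "nat \<Rightarrow> nat" where "sw k = [1, 1, 1, 3] ! k"
definition se :: "nat \<Rightarrow> nat" where "se k = [2, 4, 0, 4] ! k"
definition ne :: "nat \<Rightarrow> nat" where "ne k = [3, 3, 5, 5] ! k"
definition nw :: "nat \<Rightarrow> nat" where "nw k = [0, 2, 4, 0] ! k"

abbreviation fig8_group :: "nat word set monoid"
  where "fig8_group \<equiv> presented_group fig8_gens {fig8_relator}"

abbreviation fcls :: "nat word \<Rightarrow> nat word set"
  where "fcls \<equiv> wcls fig8_gens {fig8_relator}"

definition face_elt :: "nat \<Rightarrow> nat word set"
  where "face_elt k = fcls (face_word k)"

lemma face_word_words [simp]: "face_word k \<in> words fig8_gens"
  by (simp add: face_word_def fig8_gens_def)

lemma face_elt_carrier [simp]: "face_elt k \<in> carrier fig8_group"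
  unfolding face_elt_def by (rule wcls_in_carrier) simp

lemma crossing_check:
  "\<forall>k\<in>{0, 1, 2, 3}. fig8_trivial (winv (face_word (se k) @ winv (face_word (sw k))) @
    face_word (ne k) @ winv (face_word (nw k)))"
  by code_simp

interpretation fig8: group fig8_group
  by (rule group_presented_group)

lemma less4: "k < 4 \<longleftrightarrow> k \<in> {0, 1, 2, 3 :: nat}"
  by auto

text \<open>The two sides are the loops around the over-strand, down on the east and up on the west,
  just south and just north of the crossing.\<close>

lemma crossing_relation:
  assumes "k < 4"
  shows "face_elt (se k) \<otimes>\<^bsub>fig8_group\<^esub> inv\<^bsub>fig8_group\<^esub> face_elt (sw k) =
    face_elt (ne k) \<otimes>\<^bsub>fig8_group\<^esub> inv\<^bsub>fig8_group\<^esub> face_elt (nw k)"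
proof -
  have "fig8_eq (winv (face_word (se k) @ winv (face_word (sw k))) @ face_word (ne k) @ winv (face_word (nw k))) []"
    using bspec[OF crossing_check assms[unfolded less4]] by (rule fig8_trivial_imp)
  then have "fig8_eq (face_word (se k) @ winv (face_word (sw k))) (face_word (ne k) @ winv (face_word (nw k)))"
    by (subst (asm) word_eq_Nil_iff) simp_all
  then show ?thesis
    unfolding face_elt_def
    by (simp add: inv_presented_group mult_presented_group wcls_eq_iff)
qed

abbreviation regions :: "region set"
  where "regions \<equiv> insert Above (insert Below (insert Outer (Crossing ` {..<4})))"

text \<open>What the rest of the argument knows of the diagram; being purely topological, it can be
  carried along a homeomorphism. Inside a crossing box, \<open>West\<close> and \<open>East\<close>
  are the two sides of the over-strand, \<open>South\<close> and \<open>North\<close> those of the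
  under-strand.\<close>

locale fig8_space =
  fixes M :: "'b::real_normed_vector set" and U :: "region \<Rightarrow> 'b set" and P :: "nat \<Rightarrow> 'b set"
    and West East South North :: "nat \<Rightarrow> 'b set"
  assumes U_open: "i \<in> regions \<Longrightarrow> openin (top_of_set M) (U i)"
    and U_cover: "M = (\<Union>i\<in>regions. U i)"
    and U_simply: "i \<in> regions \<Longrightarrow> simply_connected (U i)"
    and upper_lower: "U Above \<inter> U Below = (\<Union>k<6. P k)"
    and P_open: "k < 6 \<Longrightarrow> openin (top_of_set M) (P k)"
    and P_connected: "k < 6 \<Longrightarrow> path_connected (P k)"
    and P_ne: "k < 6 \<Longrightarrow> P k \<noteq> {}"
    and P_disjoint: "k < 6 \<Longrightarrow> l < 6 \<Longrightarrow> k \<noteq> l \<Longrightarrow> P k \<inter> P l = {}"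
    and upper_outer: "path_connected (U Above \<inter> U Outer)"
    and lower_outer: "path_connected (U Below \<inter> U Outer)"
    and outer_face: "U Above \<inter> U Below \<inter> U Outer \<subseteq> P 0" "U Above \<inter> U Below \<inter> U Outer \<noteq> {}"
    and outer_crossing: "k < 4 \<Longrightarrow> U Outer \<inter> U (Crossing k) = {}"
    and crossings: "k < 4 \<Longrightarrow> l < 4 \<Longrightarrow> k \<noteq> l \<Longrightarrow> U (Crossing k) \<inter> U (Crossing l) = {}"
    and upper_crossing: "k < 4 \<Longrightarrow> U Above \<inter> U (Crossing k) = West k \<union> East k" "k < 4 \<Longrightarrow> West k \<inter> East k = {}"
    and lower_crossing: "k < 4 \<Longrightarrow> U Below \<inter> U (Crossing k) = South k \<union> North k" "k < 4 \<Longrightarrow> South k \<inter> North k = {}"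
    and quadrants_open: "k < 4 \<Longrightarrow> Q \<in> {West k, East k, South k, North k} \<Longrightarrow> openin (top_of_set M) Q"
    and quadrants_connected: "k < 4 \<Longrightarrow> Q \<in> {West k, East k, South k, North k} \<Longrightarrow> path_connected Q"
    and corners: "k < 4 \<Longrightarrow> West k \<inter> South k \<subseteq> P (sw k)" "k < 4 \<Longrightarrow> East k \<inter> South k \<subseteq> P (se k)"
      "k < 4 \<Longrightarrow> East k \<inter> North k \<subseteq> P (ne k)" "k < 4 \<Longrightarrow> West k \<inter> North k \<subseteq> P (nw k)"
    and corners_ne: "k < 4 \<Longrightarrow> West k \<inter> South k \<noteq> {}" "k < 4 \<Longrightarrow> East k \<inter> South k \<noteq> {}"
      "k < 4 \<Longrightarrow> East k \<inter> North k \<noteq> {}" "k < 4 \<Longrightarrow> West k \<inter> North k \<noteq> {}"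
begin

section \<open>The cocycle of the diagram\<close>

definition face_index :: "'b \<Rightarrow> nat"
  where "face_index x = (THE k. k < 6 \<and> x \<in> P k)"

lemma face_index: "k < 6 \<Longrightarrow> x \<in> P k \<Longrightarrow> face_index x = k"
  unfolding face_index_def using P_disjoint by (intro the_equality) auto

abbreviation fmult (infixl "\<cdot>" 70)
  where "x \<cdot> y \<equiv> x \<otimes>\<^bsub>fig8_group\<^esub> y"

abbreviation finv
  where "finv x \<equiv> inv\<^bsub>fig8_group\<^esub> x"

abbreviation fone
  where "fone \<equiv> \<one>\<^bsub>fig8_group\<^esub>"

text \<open>Normalised to one on \<open>Above\<close>, so that \<open>Below\<close> must carry the
  inverse of \<open>face_elt k\<close> over face \<open>k\<close>; off \<open>Above\<close> it is
  normalised to one too. In a crossing box the value is one on \<open>West\<close>, and the values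
  on the other sides follow by passing through the corners. A point of the box in neither half gets
  one.\<close>

fun label :: "region \<Rightarrow> 'b \<Rightarrow> nat word set"
  where
    "label Above x = fone"
  | "label Outer x = fone"
  | "label Below x = (if x \<in> U Above then finv (face_elt (face_index x)) else fone)"
  | "label (Crossing k) x =
      (if x \<in> U Above then if x \<in> West k then fone else face_elt (sw k) \<cdot> finv (face_elt (se k))
       else if x \<in> U Below then if x \<in> South k then face_elt (sw k) else face_elt (nw k)
       else fone)"

lemma label_carrier [simp]: "label i x \<in> carrier fig8_group"
  by (cases i) simp_all

definition transition :: "region \<Rightarrow> region \<Rightarrow> 'b set \<Rightarrow> nat word set \<Rightarrow> bool"
  where "transition i j Q g \<longleftrightarrow> openin (top_of_set M) Q \<and> path_connected Q \<and> Q \<subseteq> U i \<inter> U j \<and>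
    g \<in> carrier fig8_group \<and> (\<forall>x\<in>Q. label i x = g \<cdot> label j x)"

lemma face_elt_0: "face_elt 0 = fone"
  by (simp add: face_elt_def face_word_def one_presented_group)

lemma corner_less: "k < 4 \<Longrightarrow> sw k < 6" "k < 4 \<Longrightarrow> se k < 6" "k < 4 \<Longrightarrow> ne k < 6" "k < 4 \<Longrightarrow> nw k < 6"
  by (auto simp: less4 sw_def se_def ne_def nw_def)

lemma P_sub: "k < 6 \<Longrightarrow> P k \<subseteq> U Above \<inter> U Below"
  using upper_lower by blast

lemma transition_faces: "k < 6 \<Longrightarrow> transition Above Below (P k) (face_elt k)"
  using P_open P_connected P_sub face_index unfolding transition_def
  by (auto simp: subset_iff)

lemma transition_upper_outer: "transition Above Outer (U Above \<inter> U Outer) fone"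
  using U_open upper_outer unfolding transition_def by (auto intro: openin_Int)

lemma transition_lower_outer: "transition Below Outer (U Below \<inter> U Outer) fone"
  using U_open lower_outer outer_face(1) face_index[of 0] unfolding transition_def
  by (auto intro!: openin_Int simp: face_elt_0 subset_iff)

lemma transition_west:
  assumes "k < 4"
  shows "transition Above (Crossing k) (West k) fone"
proof -
  have "West k \<subseteq> U Above \<inter> U (Crossing k)"
    using upper_crossing(1)[OF assms] by auto
  then show ?thesis
    using quadrants_open[OF assms, of "West k"] quadrants_connected[OF assms, of "West k"] unfolding transition_def
    by (auto simp: subset_iff)
qed

lemma transition_east:
  assumes "k < 4"
  shows "transition Above (Crossing k) (East k) (face_elt (se k) \<cdot> finv (face_elt (sw k)))"
proof -
  have "East k \<subseteq> U Above \<inter> U (Crossing k)" "East k \<inter> West k = {}"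
    using upper_crossing[OF assms] by auto
  moreover have "fone = face_elt (se k) \<cdot> finv (face_elt (sw k)) \<cdot> (face_elt (sw k) \<cdot> finv (face_elt (se k)))"
    by (simp add: fig8.m_assoc fig8.inv_mult_cancel)
  ultimately show ?thesis
    using quadrants_open[OF assms, of "East k"] quadrants_connected[OF assms, of "East k"] unfolding transition_def
    by (auto simp: subset_iff disjoint_iff)
qed

lemma transition_south:
  assumes "k < 4"
  shows "transition Below (Crossing k) (South k) (finv (face_elt (sw k)))"
proof -
  have sub: "South k \<subseteq> U Below \<inter> U (Crossing k)"
    using lower_crossing[OF assms] by auto
  moreover have "label Below x = finv (face_elt (sw k)) \<cdot> label (Crossing k) x" if x: "x \<in> South k" for x
  proof (cases "x \<in> U Above")
    case True
    then have "x \<in> West k \<union> East k" using upper_crossing(1)[OF assms] sub x by blast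
    then consider "x \<in> West k" | "x \<in> East k" "x \<notin> West k" using upper_crossing(2)[OF assms] by blast
    then show ?thesis
    proof cases
      case 1
      then have "face_index x = sw k"
        using corners(1)[OF assms] x by (intro face_index[OF corner_less(1)[OF assms]]) auto
      then show ?thesis using True 1 by simp
    next
      case 2
      then have "face_index x = se k"
        using corners(2)[OF assms] x by (intro face_index[OF corner_less(2)[OF assms]]) auto
      then show ?thesis using True 2 by (simp add: fig8.inv_mult_cancel)
    qed
  next
    case False
    then show ?thesis using x sub by auto
  qed
  ultimately show ?thesis
    using quadrants_open[OF assms, of "South k"] quadrants_connected[OF assms, of "South k"] unfolding transition_def
    by (auto simp del: label.simps)
qed

text \<open>At the corner with \<open>East\<close> the crossing relation is needed: the value on
  \<open>East\<close> was fixed by way of \<open>South\<close> and has to agree with the way through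
  \<open>North\<close>.\<close>

lemma transition_north:
  assumes "k < 4"
  shows "transition Below (Crossing k) (North k) (finv (face_elt (nw k)))"
proof -
  have sub: "North k \<subseteq> U Below \<inter> U (Crossing k)" "North k \<inter> South k = {}"
    using lower_crossing[OF assms] by auto
  moreover have "label Below x = finv (face_elt (nw k)) \<cdot> label (Crossing k) x" if x: "x \<in> North k" for x
  proof (cases "x \<in> U Above")
    case True
    then have "x \<in> West k \<union> East k" using upper_crossing(1)[OF assms] sub x by blast
    then consider "x \<in> West k" | "x \<in> East k" "x \<notin> West k" using upper_crossing(2)[OF assms] by blast
    then show ?thesis
    proof cases
      case 1
      then have "face_index x = nw k"
        using corners(4)[OF assms] x by (intro face_index[OF corner_less(4)[OF assms]]) auto
      then show ?thesis using True 1 by simp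
    next
      case 2
      then have f: "face_index x = ne k"
        using corners(3)[OF assms] x by (intro face_index[OF corner_less(3)[OF assms]]) auto
      have "finv (face_elt (se k) \<cdot> finv (face_elt (sw k))) = finv (face_elt (ne k) \<cdot> finv (face_elt (nw k)))"
        using crossing_relation[OF assms] by simp
      then have "face_elt (sw k) \<cdot> finv (face_elt (se k)) = face_elt (nw k) \<cdot> finv (face_elt (ne k))"
        by (simp add: fig8.inv_mult_group)
      then show ?thesis using True 2 f
        by (simp add: fig8.inv_mult_cancel)
    qed
  next
    case False
    then show ?thesis using x sub by auto
  qed
  ultimately show ?thesis
    using quadrants_open[OF assms, of "North k"] quadrants_connected[OF assms, of "North k"] unfolding transition_def
    by (auto simp del: label.simps)
qed

lemma transition_refl: "i \<in> regions \<Longrightarrow> transition i i (U i) fone"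
  using U_open U_simply unfolding transition_def
  by (auto intro: simply_connected_imp_path_connected simp del: label.simps)

lemma transition_sym: "transition i j Q g \<Longrightarrow> transition j i Q (finv g)"
  unfolding transition_def by (auto simp: fig8.inv_mult_cancel simp del: label.simps)

text \<open>One list of cases for two comparisons: with the labels of the cocycle here, and with
  loops in the space in \<open>diff_basic_transition\<close>.\<close>

inductive basic_transition :: "region \<Rightarrow> region \<Rightarrow> 'b set \<Rightarrow> nat word set \<Rightarrow> bool"
  where
    "i \<in> regions \<Longrightarrow> basic_transition i i (U i) fone"
  | "k < 6 \<Longrightarrow> basic_transition Above Below (P k) (face_elt k)"
  | "basic_transition Above Outer (U Above \<inter> U Outer) fone"
  | "basic_transition Below Outer (U Below \<inter> U Outer) fone"
  | "k < 4 \<Longrightarrow> basic_transition Above (Crossing k) (West k) fone"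
  | "k < 4 \<Longrightarrow> basic_transition Above (Crossing k) (East k) (face_elt (se k) \<cdot> finv (face_elt (sw k)))"
  | "k < 4 \<Longrightarrow> basic_transition Below (Crossing k) (South k) (finv (face_elt (sw k)))"
  | "k < 4 \<Longrightarrow> basic_transition Below (Crossing k) (North k) (finv (face_elt (nw k)))"

lemma basic_transition: "basic_transition i j Q g \<Longrightarrow> transition i j Q g"
  by (induction rule: basic_transition.induct)
     (rule transition_refl transition_faces transition_upper_outer transition_lower_outer transition_west
        transition_east transition_south transition_north; assumption?)+

lemma basic_transition_exists:
  assumes i: "i \<in> regions" and j: "j \<in> regions" and x: "x \<in> U i" "x \<in> U j"
  shows "(\<exists>Q g. x \<in> Q \<and> basic_transition i j Q g) \<or> (\<exists>Q g. x \<in> Q \<and> basic_transition j i Q g)"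
proof -
  define R where "R a b \<longleftrightarrow> (\<exists>Q g. x \<in> Q \<and> basic_transition a b Q g)" for a b
  have self: "R i i"
    using basic_transition.intros(1)[OF i] x unfolding R_def by blast
  have ul: "R Above Below" if "x \<in> U Above" "x \<in> U Below"
    using that upper_lower basic_transition.intros(2) unfolding R_def by blast
  have uo: "R Above Outer" if "x \<in> U Above" "x \<in> U Outer"
    using that basic_transition.intros(3) unfolding R_def by blast
  have lo: "R Below Outer" if "x \<in> U Below" "x \<in> U Outer"
    using that basic_transition.intros(4) unfolding R_def by blast
  have uc: "R Above (Crossing k)" if "x \<in> U Above" "x \<in> U (Crossing k)" "k < 4" for k
    using that upper_crossing(1)[of k] basic_transition.intros(5,6)[of k] unfolding R_def by blast
  have lc: "R Below (Crossing k)" if "x \<in> U Below" "x \<in> U (Crossing k)" "k < 4" for k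
    using that lower_crossing(1)[of k] basic_transition.intros(7,8)[of k] unfolding R_def by blast
  have oc: "k < 4 \<Longrightarrow> x \<in> U Outer \<Longrightarrow> x \<notin> U (Crossing k)" for k
    using outer_crossing by blast
  have cc: "k < 4 \<Longrightarrow> l < 4 \<Longrightarrow> x \<in> U (Crossing k) \<Longrightarrow> x \<in> U (Crossing l) \<Longrightarrow> k = l" for k l
    using crossings by blast
  have "R i j \<or> R j i"
    using i
  proof (elim insertE imageE)
    assume "i = Above"
    then show ?thesis using self j x ul uo uc by (elim insertE imageE) auto
  next
    assume "i = Below"
    then show ?thesis using self j x ul lo lc by (elim insertE imageE) auto
  next
    assume "i = Outer"
    then show ?thesis using self j x uo lo oc by (elim insertE imageE) auto
  next
    fix k assume "i = Crossing k" "k \<in> {..<4}"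
    then have k: "k < 4" "x \<in> U (Crossing k)" "i = Crossing k" using x by auto
    from j show ?thesis
    proof (elim insertE imageE)
      fix l assume "j = Crossing l" "l \<in> {..<4}"
      then have "k = l" using cc[OF k(1) _ k(2)] x by simp
      then show ?thesis using self k \<open>j = Crossing l\<close> by simp
    qed (use uc[OF _ k(2,1)] lc[OF _ k(2,1)] oc[OF k(1)] k x in auto)
  qed
  then show ?thesis by (simp add: R_def)
qed

lemma transition_exists:
  assumes "i \<in> regions" "j \<in> regions" "x \<in> U i" "x \<in> U j"
  obtains Q g where "x \<in> Q" "transition i j Q g"
  using basic_transition_exists[OF assms] basic_transition transition_sym by metis

sublocale cocycle fig8_group "top_of_set M" regions U label
proof unfold_locales
  show "topspace (top_of_set M) = \<Union> (U ` regions)" using U_cover by simp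
  fix i j x assume "i \<in> regions" "j \<in> regions" "x \<in> U i" "x \<in> U j"
  then obtain Q g where "x \<in> Q" "transition i j Q g" by (rule transition_exists)
  then show "\<exists>V g. openin (top_of_set M) V \<and> x \<in> V \<and> V \<subseteq> U i \<inter> U j \<and> g \<in> carrier fig8_group \<and>
      (\<forall>y\<in>V. label i y = g \<cdot> label j y)"
    unfolding transition_def by blast
qed (use U_open in auto)

end

lemma (in group) mult_inv_eq_imp:
  "x \<in> carrier G \<Longrightarrow> y \<in> carrier G \<Longrightarrow> x \<otimes> inv y = z \<Longrightarrow> x = z \<otimes> y"
  by (auto simp: m_assoc)

section \<open>Marking paths and the homomorphism to the fundamental group\<close>

context fig8_space
begin

definition base :: 'b
  where "base = (SOME x. x \<in> P 0)"

text \<open>The point through which marking paths pass from \<open>Above\<close> into chart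
  \<open>i\<close>. It is chosen where \<open>label i\<close> is one (over face 0 for
  \<open>Below\<close>, in \<open>West\<close> for a crossing), so that markings and labels are
  normalised alike.\<close>

definition link :: "region \<Rightarrow> 'b"
  where "link i = (case i of Above \<Rightarrow> base | Below \<Rightarrow> base | Outer \<Rightarrow> SOME x. x \<in> U Above \<inter> U Outer
    | Crossing k \<Rightarrow> SOME x. x \<in> West k \<inter> South k)"

lemma link_simps: "link Above = base" "link Below = base" "link Outer = (SOME x. x \<in> U Above \<inter> U Outer)"
  "link (Crossing k) = (SOME x. x \<in> West k \<inter> South k)"
  by (simp_all add: link_def)

lemma base: "base \<in> P 0"
  unfolding base_def by (rule someI_ex) (use P_ne[of 0] in auto)

lemma link_outer: "link Outer \<in> U Above \<inter> U Outer"
  unfolding link_simps by (rule someI_ex) (use outer_face(2) in blast)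

lemma link_crossing: "k < 4 \<Longrightarrow> link (Crossing k) \<in> West k \<inter> South k"
  unfolding link_simps by (rule someI_ex) (use corners_ne(1) in blast)

lemma link_in:
  assumes "i \<in> regions" shows "link i \<in> U Above" "link i \<in> U i"
proof -
  have b: "base \<in> U Above" "base \<in> U Below" using base P_sub[of 0] by auto
  have "link i \<in> U Above \<and> link i \<in> U i"
    using assms
  proof (elim insertE imageE)
    fix k assume k: "i = Crossing k" "k \<in> {..<4}"
    then have "link i \<in> West k" using link_crossing[of k] by auto
    moreover have "West k \<subseteq> U Above \<inter> U (Crossing k)" using upper_crossing(1)[of k] k by auto
    ultimately show ?thesis using k(1) by auto
  qed (use b link_outer in \<open>simp_all add: link_simps(1,2)\<close>)
  then show "link i \<in> U Above" "link i \<in> U i" by auto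
qed

lemma above_region: "Above \<in> regions" "Below \<in> regions" "Outer \<in> regions"
  by auto

definition seg :: "region \<Rightarrow> 'b \<Rightarrow> 'b \<Rightarrow> real \<Rightarrow> 'b"
  where "seg i x y = (SOME p. path_in (U i) p x y)"

lemma seg:
  assumes "i \<in> regions" "x \<in> U i" "y \<in> U i"
  shows "path_in (U i) (seg i x y) x y"
proof -
  have "path_connected (U i)" using U_simply[OF assms(1)] by (rule simply_connected_imp_path_connected)
  then have "\<exists>p. path_in (U i) p x y" using assms by (auto simp: path_connected_def path_in_def)
  then show ?thesis unfolding seg_def by (rule someI_ex)
qed

lemma region_sub: "i \<in> regions \<Longrightarrow> U i \<subseteq> M"
  using U_cover by blast

lemma region_hom_eq:
  assumes "i \<in> regions" "path_in (U i) p x y" "path_in (U i) q x y"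
  shows "hom_eq M p q"
proof -
  have "hom_eq (U i) p q"
    using U_simply[OF assms(1)] assms by (auto simp: simply_connected_eq_homotopic_paths path_in_def)
  then show ?thesis using region_sub[OF assms(1)] by (rule homotopic_paths_subset)
qed

definition mark :: "region \<Rightarrow> 'b \<Rightarrow> real \<Rightarrow> 'b"
  where "mark i x = seg Above base (link i) +++ seg i (link i) x"

lemma base_above: "base \<in> U Above" "base \<in> U Below" "base \<in> M"
  using base P_sub[of 0] region_sub[of Above] by auto

lemma tail_path: "i \<in> regions \<Longrightarrow> path_in M (seg Above base (link i)) base (link i)"
  using seg[of Above base "link i"] link_in(1)[of i] base_above region_sub[of Above]
  by (auto intro: path_in_mono)

lemma seg_M: "i \<in> regions \<Longrightarrow> x \<in> U i \<Longrightarrow> y \<in> U i \<Longrightarrow> path_in M (seg i x y) x y"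
  using seg region_sub by (blast intro: path_in_mono)

lemma mark_path: "i \<in> regions \<Longrightarrow> x \<in> U i \<Longrightarrow> path_in M (mark i x) base x"
  unfolding mark_def using path_in_join[OF tail_path seg_M] link_in(2) by blast

lemma mark_extend:
  assumes i: "i \<in> regions" and d: "path_in (U i) d x y"
  shows "hom_eq M (mark i x +++ d) (mark i y)"
proof -
  have xy: "x \<in> U i" "y \<in> U i" using path_in_ends[OF d] by auto
  have dM: "path_in M d x y" using path_in_mono[OF d region_sub[OF i]] .
  note w = seg[OF i link_in(2)[OF i] xy(1)]
  have "hom_eq M (mark i x +++ d) (seg Above base (link i) +++ (seg i (link i) x +++ d))"
    unfolding mark_def by (rule hom_eq_assoc[OF tail_path[OF i] path_in_mono[OF w region_sub[OF i]] dM])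
  also have "hom_eq M \<dots> (mark i y)"
    unfolding mark_def
    by (rule hom_eq_join[OF hom_eq_refl[OF tail_path[OF i]] _ tail_path[OF i] path_in_mono[OF path_in_join[OF w d] region_sub[OF i]]])
       (rule region_hom_eq[OF i path_in_join[OF w d] seg[OF i link_in(2)[OF i] xy(2)]])
  finally show ?thesis .
qed

lemma mark_link:
  assumes i: "i \<in> regions"
  shows "hom_eq M (mark i (link i)) (mark Above (link i))"
proof -
  note l = link_in[OF i]
  have lM: "link i \<in> M" using l region_sub[OF i] by auto
  note w = seg[OF i l(2) l(2)] and t = seg[OF above_region(1) base_above(1) l(1)]
  have "hom_eq M (mark i (link i)) (seg Above base (link i) +++ linepath (link i) (link i))"
    unfolding mark_def
    by (rule hom_eq_join[OF hom_eq_refl[OF tail_path[OF i]] _ tail_path[OF i] path_in_mono[OF w region_sub[OF i]]])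
       (rule region_hom_eq[OF i w path_in_linepath[OF l(2)]])
  also have "hom_eq M \<dots> (mark Above (link i))"
    unfolding mark_def link_simps
    by (rule region_hom_eq[OF above_region(1) path_in_join[OF t path_in_linepath[OF l(1)]]
          path_in_join[OF seg[OF above_region(1) base_above(1) base_above(1)] t]])
  finally show ?thesis .
qed

definition diff :: "region \<Rightarrow> region \<Rightarrow> 'b \<Rightarrow> (real \<Rightarrow> 'b) set"
  where "diff i j x = path_diff M base (mark i x) (mark j x)"

interpretation H: group "pi1 M base"
  by (rule group_pi1[OF base_above(3)])

lemma diff_carrier [simp]: "i \<in> regions \<Longrightarrow> j \<in> regions \<Longrightarrow> x \<in> U i \<Longrightarrow> x \<in> U j \<Longrightarrow> diff i j x \<in> carrier (pi1 M base)"
  unfolding diff_def by (rule path_diff_carrier[OF mark_path mark_path])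

lemma diff_mult:
  "i \<in> regions \<Longrightarrow> j \<in> regions \<Longrightarrow> k \<in> regions \<Longrightarrow> x \<in> U i \<Longrightarrow> x \<in> U j \<Longrightarrow> x \<in> U k \<Longrightarrow>
    diff i j x \<otimes>\<^bsub>pi1 M base\<^esub> diff j k x = diff i k x"
  unfolding diff_def by (rule path_diff_mult[OF mark_path mark_path mark_path])

lemma diff_self: "i \<in> regions \<Longrightarrow> x \<in> U i \<Longrightarrow> diff i i x = \<one>\<^bsub>pi1 M base\<^esub>"
  unfolding diff_def by (rule path_diff_self[OF mark_path])

lemma diff_inv:
  assumes "i \<in> regions" "j \<in> regions" "x \<in> U i" "x \<in> U j"
  shows "diff j i x = inv\<^bsub>pi1 M base\<^esub> diff i j x"
  using diff_mult[of j i j x] diff_self[of j x] assms by (intro H.inv_equality[symmetric]) auto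

text \<open>Extending both marking paths along a path in \<open>Q\<close> leaves their difference
  unchanged.\<close>

lemma diff_const:
  assumes ij: "i \<in> regions" "j \<in> regions" and Q: "path_connected Q" "Q \<subseteq> U i \<inter> U j" and x: "x \<in> Q" "y \<in> Q"
  shows "diff i j x = diff i j y"
proof -
  obtain p where p: "path_in Q p x y" using Q(1) x unfolding path_connected_def path_in_def by blast
  have pi: "path_in (U i) p x y" "path_in (U j) p x y" using path_in_mono[OF p] Q by auto
  note pM = path_in_mono[OF pi(1) region_sub[OF ij(1)]]
  have xU: "x \<in> U i" "x \<in> U j" using Q x by auto
  note m = mark_path[OF ij(1) xU(1)] mark_path[OF ij(2) xU(2)]
  have "diff i j y = path_diff M base (mark i x +++ p) (mark j x +++ p)"
    unfolding diff_def
    by (rule path_diff_hom_eq[OF path_in_join[OF m(1) pM] path_in_join[OF m(2) pM]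
          mark_extend[OF ij(1) pi(1)] mark_extend[OF ij(2) pi(2)], symmetric])
  also have "\<dots> = diff i j x"
    unfolding diff_def by (rule path_diff_extend[OF m pM])
  finally show ?thesis by simp
qed

lemma diff_link: "i \<in> regions \<Longrightarrow> diff Above i (link i) = \<one>\<^bsub>pi1 M base\<^esub>"
proof -
  assume i: "i \<in> regions"
  note l = link_in[OF i]
  have "diff Above i (link i) = path_diff M base (mark Above (link i)) (mark Above (link i))"
    unfolding diff_def
    by (rule path_diff_hom_eq[OF mark_path[OF above_region(1) l(1)] mark_path[OF i l(2)]
          hom_eq_refl[OF mark_path[OF above_region(1) l(1)]] mark_link[OF i]])
  also have "\<dots> = \<one>\<^bsub>pi1 M base\<^esub>" by (rule path_diff_self[OF mark_path[OF above_region(1) l(1)]])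
  finally show ?thesis .
qed

definition face_loop :: "nat \<Rightarrow> (real \<Rightarrow> 'b) set"
  where "face_loop k = diff Above Below (SOME x. x \<in> P k)"

lemma diff_face:
  assumes "k < 6" "x \<in> P k" shows "diff Above Below x = face_loop k"
proof -
  have "(SOME x. x \<in> P k) \<in> P k" using assms by (intro someI)
  then show ?thesis unfolding face_loop_def
    using assms by (intro diff_const[OF above_region(1,2) P_connected[OF assms(1)] P_sub[OF assms(1)]])
qed

lemma face_loop_carrier [simp]: "k < 6 \<Longrightarrow> face_loop k \<in> carrier (pi1 M base)"
proof -
  assume k: "k < 6"
  then obtain x where "x \<in> P k" using P_ne by blast
  then show ?thesis using diff_face[OF k] diff_carrier[OF above_region(1,2), of x] P_sub[OF k] by auto
qed

lemma face_loop_0: "face_loop 0 = \<one>\<^bsub>pi1 M base\<^esub>"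
  using diff_face[of 0 base] base diff_link[OF above_region(2)] by (simp add: link_simps)

text \<open>The triple overlap lies over face 0, whose loop is trivial; a point there carries the
  normalisation from \<open>Above\<close> over to \<open>Below\<close>.\<close>

lemma diff_outer:
  assumes "x \<in> U Outer"
  shows "x \<in> U Above \<Longrightarrow> diff Above Outer x = \<one>\<^bsub>pi1 M base\<^esub>" "x \<in> U Below \<Longrightarrow> diff Below Outer x = \<one>\<^bsub>pi1 M base\<^esub>"
proof -
  have ao: "diff Above Outer x = \<one>\<^bsub>pi1 M base\<^esub>" if "x \<in> U Above" "x \<in> U Outer" for x
    using diff_const[OF above_region(1,3) upper_outer subset_refl, of x "link Outer"] that link_outer
      diff_link[OF above_region(3)] by simp
  show "x \<in> U Above \<Longrightarrow> diff Above Outer x = \<one>\<^bsub>pi1 M base\<^esub>" using ao assms by simp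
  assume x: "x \<in> U Below"
  obtain q where q: "q \<in> U Above \<inter> U Below \<inter> U Outer" using outer_face(2) by blast
  then have "q \<in> P 0" using outer_face(1) by blast
  then have "diff Above Below q = \<one>\<^bsub>pi1 M base\<^esub>" using diff_face[of 0 q] face_loop_0 by simp
  then have "diff Below Above q = \<one>\<^bsub>pi1 M base\<^esub>" using diff_inv[OF above_region(1,2), of q] q by simp
  then have "diff Below Outer q = \<one>\<^bsub>pi1 M base\<^esub>"
    using diff_mult[OF above_region(2,1,3), of q] q ao[of q] by simp
  then show "diff Below Outer x = \<one>\<^bsub>pi1 M base\<^esub>"
    using diff_const[OF above_region(2,3) lower_outer subset_refl, of x q] x q assms by simp
qed

lemma crossing_sub:
  "k < 4 \<Longrightarrow> West k \<subseteq> U Above \<inter> U (Crossing k)" "k < 4 \<Longrightarrow> East k \<subseteq> U Above \<inter> U (Crossing k)"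
  "k < 4 \<Longrightarrow> South k \<subseteq> U Below \<inter> U (Crossing k)" "k < 4 \<Longrightarrow> North k \<subseteq> U Below \<inter> U (Crossing k)"
  using upper_crossing(1)[of k] lower_crossing(1)[of k] by auto

text \<open>Each corner lies over a known face, and \<open>diff\<close> is constant on each of the
  four sides. Going round the corners \<open>p1\<close>, \<open>p2\<close>, \<open>p4\<close>
  determines the values, and the corner \<open>p3\<close>, reached from \<open>East\<close> and from
  \<open>North\<close>, gives the relation between the loops.\<close>

lemma diff_crossing:
  assumes k: "k < 4"
  shows "x \<in> West k \<Longrightarrow> diff Above (Crossing k) x = \<one>\<^bsub>pi1 M base\<^esub>"
    "x \<in> East k \<Longrightarrow> diff Above (Crossing k) x = face_loop (se k) \<otimes>\<^bsub>pi1 M base\<^esub> inv\<^bsub>pi1 M base\<^esub> face_loop (sw k)"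
    "x \<in> South k \<Longrightarrow> diff Below (Crossing k) x = inv\<^bsub>pi1 M base\<^esub> face_loop (sw k)"
    "x \<in> North k \<Longrightarrow> diff Below (Crossing k) x = inv\<^bsub>pi1 M base\<^esub> face_loop (nw k)"
    "face_loop (se k) \<otimes>\<^bsub>pi1 M base\<^esub> inv\<^bsub>pi1 M base\<^esub> face_loop (sw k) =
     face_loop (ne k) \<otimes>\<^bsub>pi1 M base\<^esub> inv\<^bsub>pi1 M base\<^esub> face_loop (nw k)"
proof -
  have C: "Crossing k \<in> regions" using k by simp
  note qc = quadrants_connected[OF k] and sub = crossing_sub[OF k] and less = corner_less[OF k]
  have W: "diff Above (Crossing k) x = \<one>\<^bsub>pi1 M base\<^esub>" if "x \<in> West k" for x
    using diff_const[OF above_region(1) C _ sub(1) that, of "link (Crossing k)"] qc[of "West k"]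
      link_crossing[OF k] diff_link[OF C] by simp
  then show "x \<in> West k \<Longrightarrow> diff Above (Crossing k) x = \<one>\<^bsub>pi1 M base\<^esub>" .
  have E: "diff Above (Crossing k) x = diff Above (Crossing k) y" if "x \<in> East k" "y \<in> East k" for x y
    using diff_const[OF above_region(1) C _ sub(2) that] qc[of "East k"] by simp
  have S: "diff Below (Crossing k) x = diff Below (Crossing k) y" if "x \<in> South k" "y \<in> South k" for x y
    using diff_const[OF above_region(2) C _ sub(3) that] qc[of "South k"] by simp
  have N: "diff Below (Crossing k) x = diff Below (Crossing k) y" if "x \<in> North k" "y \<in> North k" for x y
    using diff_const[OF above_region(2) C _ sub(4) that] qc[of "North k"] by simp
  have B: "diff Below (Crossing k) x = inv\<^bsub>pi1 M base\<^esub> face_loop f \<otimes>\<^bsub>pi1 M base\<^esub> diff Above (Crossing k) x"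
    if "f < 6" "x \<in> P f" "x \<in> U (Crossing k)" for f x
    using diff_mult[OF above_region(2,1) C, of x] diff_inv[OF above_region(1,2), of x] diff_face[OF that(1,2)]
      P_sub[OF that(1)] that by auto
  have A: "diff Above (Crossing k) x = face_loop f \<otimes>\<^bsub>pi1 M base\<^esub> diff Below (Crossing k) x"
    if "f < 6" "x \<in> P f" "x \<in> U (Crossing k)" for f x
    using diff_mult[OF above_region(1,2) C, of x] diff_face[OF that(1,2)] P_sub[OF that(1)] that by auto
  obtain p1 where p1: "p1 \<in> West k" "p1 \<in> South k" "p1 \<in> P (sw k)" "p1 \<in> U (Crossing k)"
    using corners_ne(1)[OF k] corners(1)[OF k] sub by blast
  obtain p2 where p2: "p2 \<in> East k" "p2 \<in> South k" "p2 \<in> P (se k)" "p2 \<in> U (Crossing k)"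
    using corners_ne(2)[OF k] corners(2)[OF k] sub by blast
  obtain p3 where p3: "p3 \<in> East k" "p3 \<in> North k" "p3 \<in> P (ne k)" "p3 \<in> U (Crossing k)"
    using corners_ne(3)[OF k] corners(3)[OF k] sub by blast
  obtain p4 where p4: "p4 \<in> West k" "p4 \<in> North k" "p4 \<in> P (nw k)" "p4 \<in> U (Crossing k)"
    using corners_ne(4)[OF k] corners(4)[OF k] sub by blast
  have S1: "diff Below (Crossing k) x = inv\<^bsub>pi1 M base\<^esub> face_loop (sw k)" if "x \<in> South k" for x
    using S[OF that p1(2)] B[OF less(1) p1(3,4)] W[OF p1(1)] less by simp
  then show "x \<in> South k \<Longrightarrow> diff Below (Crossing k) x = inv\<^bsub>pi1 M base\<^esub> face_loop (sw k)" .
  have N1: "diff Below (Crossing k) x = inv\<^bsub>pi1 M base\<^esub> face_loop (nw k)" if "x \<in> North k" for x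
    using N[OF that p4(2)] B[OF less(4) p4(3,4)] W[OF p4(1)] less by simp
  then show "x \<in> North k \<Longrightarrow> diff Below (Crossing k) x = inv\<^bsub>pi1 M base\<^esub> face_loop (nw k)" .
  have E1: "diff Above (Crossing k) x = face_loop (se k) \<otimes>\<^bsub>pi1 M base\<^esub> inv\<^bsub>pi1 M base\<^esub> face_loop (sw k)" if "x \<in> East k" for x
    using E[OF that p2(1)] A[OF less(2) p2(3,4)] S1[OF p2(2)] by simp
  then show "x \<in> East k \<Longrightarrow> diff Above (Crossing k) x = face_loop (se k) \<otimes>\<^bsub>pi1 M base\<^esub> inv\<^bsub>pi1 M base\<^esub> face_loop (sw k)" .
  show "face_loop (se k) \<otimes>\<^bsub>pi1 M base\<^esub> inv\<^bsub>pi1 M base\<^esub> face_loop (sw k) =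
     face_loop (ne k) \<otimes>\<^bsub>pi1 M base\<^esub> inv\<^bsub>pi1 M base\<^esub> face_loop (nw k)"
    using E1[OF p3(1)] A[OF less(3) p3(3,4)] N1[OF p3(2)] by simp
qed

definition gen_loop :: "nat \<Rightarrow> (real \<Rightarrow> 'b) set"
  where "gen_loop x = (if x = 0 then face_loop 1 else face_loop 5)"

lemma gen_loop: "gen_loop ` fig8_gens \<subseteq> carrier (pi1 M base)"
  by (auto simp: gen_loop_def)

lemma face_relations:
  "face_loop 3 = inv\<^bsub>pi1 M base\<^esub> face_loop 5 \<otimes>\<^bsub>pi1 M base\<^esub> (face_loop 1 \<otimes>\<^bsub>pi1 M base\<^esub> face_loop 5)"
  "face_loop 4 = face_loop 1 \<otimes>\<^bsub>pi1 M base\<^esub> face_loop 5"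
  "face_loop 2 = face_loop 3 \<otimes>\<^bsub>pi1 M base\<^esub> face_loop 1"
  "face_loop 4 \<otimes>\<^bsub>pi1 M base\<^esub> inv\<^bsub>pi1 M base\<^esub> face_loop 1 = face_loop 3 \<otimes>\<^bsub>pi1 M base\<^esub> inv\<^bsub>pi1 M base\<^esub> face_loop 2"
proof -
  have c [simp]: "face_loop 1 \<in> carrier (pi1 M base)" "face_loop 2 \<in> carrier (pi1 M base)" "face_loop 3 \<in> carrier (pi1 M base)"
    "face_loop 4 \<in> carrier (pi1 M base)" "face_loop 5 \<in> carrier (pi1 M base)"
    by auto
  note d = sw_def se_def ne_def nw_def
  have r0: "face_loop 2 \<otimes>\<^bsub>pi1 M base\<^esub> inv\<^bsub>pi1 M base\<^esub> face_loop 1 = face_loop 3"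
    using diff_crossing(5)[of 0] by (simp add: d face_loop_0)
  show "face_loop 2 = face_loop 3 \<otimes>\<^bsub>pi1 M base\<^esub> face_loop 1"
    using H.mult_inv_eq_imp[OF _ _ r0] by simp
  show "face_loop 4 \<otimes>\<^bsub>pi1 M base\<^esub> inv\<^bsub>pi1 M base\<^esub> face_loop 1 = face_loop 3 \<otimes>\<^bsub>pi1 M base\<^esub> inv\<^bsub>pi1 M base\<^esub> face_loop 2"
    using diff_crossing(5)[of 1] by (simp add: d)
  have r2: "face_loop 5 \<otimes>\<^bsub>pi1 M base\<^esub> inv\<^bsub>pi1 M base\<^esub> face_loop 4 = inv\<^bsub>pi1 M base\<^esub> face_loop 1"
    using diff_crossing(5)[of 2] by (simp add: d face_loop_0)
  have "face_loop 5 = inv\<^bsub>pi1 M base\<^esub> face_loop 1 \<otimes>\<^bsub>pi1 M base\<^esub> face_loop 4"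
    using H.mult_inv_eq_imp[OF _ _ r2] by simp
  then show f4: "face_loop 4 = face_loop 1 \<otimes>\<^bsub>pi1 M base\<^esub> face_loop 5"
    by (simp add: H.inv_mult_cancel)
  have r3: "face_loop 4 \<otimes>\<^bsub>pi1 M base\<^esub> inv\<^bsub>pi1 M base\<^esub> face_loop 3 = face_loop 5"
    using diff_crossing(5)[of 3] by (simp add: d face_loop_0)
  have "face_loop 4 = face_loop 5 \<otimes>\<^bsub>pi1 M base\<^esub> face_loop 3"
    using H.mult_inv_eq_imp[OF _ _ r3] by simp
  then have "inv\<^bsub>pi1 M base\<^esub> face_loop 5 \<otimes>\<^bsub>pi1 M base\<^esub> face_loop 4 = face_loop 3"
    by (simp add: H.inv_mult_cancel)
  then show "face_loop 3 = inv\<^bsub>pi1 M base\<^esub> face_loop 5 \<otimes>\<^bsub>pi1 M base\<^esub> (face_loop 1 \<otimes>\<^bsub>pi1 M base\<^esub> face_loop 5)"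
    using f4 by simp
qed

text \<open>The relation of the crossing \<open>(2,2)\<close> for actual loops, with those of the
  faces 2, 3 and 4 eliminated.\<close>

lemma gen_loop_relator: "weval (pi1 M base) gen_loop fig8_relator = \<one>\<^bsub>pi1 M base\<^esub>"
proof -
  define a b where "a = face_loop 1" "b = face_loop 5"
  have c [simp]: "a \<in> carrier (pi1 M base)" "b \<in> carrier (pi1 M base)" by (auto simp: a_b_def)
  note r = face_relations[folded a_b_def]
  have "a \<otimes>\<^bsub>pi1 M base\<^esub> b \<otimes>\<^bsub>pi1 M base\<^esub> inv\<^bsub>pi1 M base\<^esub> a =
      inv\<^bsub>pi1 M base\<^esub> b \<otimes>\<^bsub>pi1 M base\<^esub> (a \<otimes>\<^bsub>pi1 M base\<^esub> (b \<otimes>\<^bsub>pi1 M base\<^esub> (inv\<^bsub>pi1 M base\<^esub> a \<otimes>\<^bsub>pi1 M base\<^esub>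
      (inv\<^bsub>pi1 M base\<^esub> b \<otimes>\<^bsub>pi1 M base\<^esub> (inv\<^bsub>pi1 M base\<^esub> a \<otimes>\<^bsub>pi1 M base\<^esub> b)))))"
    using r(4) unfolding r(3) r(2) r(1) by (simp add: H.m_assoc H.inv_mult_group)
  from this[symmetric] show ?thesis
    by (simp add: fig8_relator_def gen_loop_def H.m_assoc H.inv_mult_cancel flip: a_b_def)
qed

text \<open>The homomorphism that serves as \<open>\<Phi>\<close> in the marking; it exists because
  the face loops satisfy the crossing relations.\<close>

definition realize :: "nat word set \<Rightarrow> (real \<Rightarrow> 'b) set"
  where "realize = H.presented_hom gen_loop"

lemma realize_hom: "realize \<in> hom fig8_group (pi1 M base)"
  unfolding realize_def using gen_loop_relator by (intro H.presented_hom_hom[OF gen_loop]) auto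

lemma realize_face: "k < 6 \<Longrightarrow> realize (face_elt k) = face_loop k"
proof -
  assume k: "k < 6"
  have "realize (face_elt k) = weval (pi1 M base) gen_loop (face_word k)"
    unfolding realize_def face_elt_def using gen_loop_relator
    by (intro H.presented_hom_wcls[OF gen_loop]) auto
  also have "\<dots> = face_loop k"
  proof -
    have "k = 0 \<or> k = 1 \<or> k = 2 \<or> k = 3 \<or> k = 4 \<or> k = 5" using k by auto
    moreover note r = face_relations face_loop_0
    ultimately show ?thesis
      by (elim disjE) (simp_all add: face_word_def gen_loop_def r H.m_assoc)
  qed
  finally show ?thesis .
qed

lemma realize_inv: "g \<in> carrier fig8_group \<Longrightarrow> realize (finv g) = inv\<^bsub>pi1 M base\<^esub> realize g"
  using group_hom.hom_inv[of fig8_group "pi1 M base" realize g] realize_hom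
  by (simp add: group_hom_def group_hom_axioms_def fig8.group_axioms H.group_axioms)

lemma realize_mult: "g \<in> carrier fig8_group \<Longrightarrow> h \<in> carrier fig8_group \<Longrightarrow>
    realize (g \<cdot> h) = realize g \<otimes>\<^bsub>pi1 M base\<^esub> realize h"
  using hom_mult[OF realize_hom] .

lemma realize_one: "realize fone = \<one>\<^bsub>pi1 M base\<^esub>"
  using realize_face[of 0] by (simp add: face_elt_0 face_loop_0)

lemma diff_basic_transition:
  assumes "basic_transition i j Q g" "x \<in> Q"
  shows "diff i j x = realize g"
  using assms
proof (induction rule: basic_transition.induct)
  case (1 i)
  then show ?case by (simp add: diff_self realize_one)
next
  case (2 k)
  then show ?case by (simp add: diff_face realize_face)
next
  case (6 k)
  then show ?case using corner_less[of k]
    by (simp add: diff_crossing realize_mult realize_inv realize_face)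
next
  case (7 k)
  then show ?case using corner_less[of k] by (simp add: diff_crossing realize_inv realize_face)
next
  case (8 k)
  then show ?case using corner_less[of k] by (simp add: diff_crossing realize_inv realize_face)
qed (auto simp: diff_outer diff_crossing realize_one)

lemma label_transition:
  assumes "transition i j Q g" "x \<in> Q" shows "label i x \<cdot> finv (label j x) = g"
proof -
  have "label i x = g \<cdot> label j x" "g \<in> carrier fig8_group" using assms by (auto simp: transition_def)
  then show ?thesis by (simp add: fig8.m_assoc del: label.simps)
qed

lemma diff_label:
  assumes ij: "i \<in> regions" "j \<in> regions" "x \<in> U i" "x \<in> U j"
  shows "diff i j x = realize (label i x \<cdot> finv (label j x))"
proof -
  from basic_transition_exists[OF assms] show ?thesis
  proof (elim disjE exE conjE)
    fix Q g assume "x \<in> Q" "basic_transition i j Q g"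
    then show ?thesis using label_transition[OF basic_transition] diff_basic_transition by metis
  next
    fix Q g assume Q: "x \<in> Q" "basic_transition j i Q g"
    have g: "g \<in> carrier fig8_group" using basic_transition[OF Q(2)] by (simp add: transition_def)
    have "diff i j x = inv\<^bsub>pi1 M base\<^esub> realize g"
      using diff_inv[OF ij(2,1) ij(4,3)] diff_basic_transition[OF Q(2,1)] by simp
    also have "\<dots> = realize (finv g)" using realize_inv[OF g] by simp
    finally show ?thesis
      using label_transition[OF transition_sym[OF basic_transition[OF Q(2)]] Q(1)] by simp
  qed
qed

sublocale marked: marked_cocycle fig8_group M regions U label base mark realize
proof unfold_locales
  show "path_in M (mark i x) base x" if "i \<in> regions" "x \<in> U i" for i x
    using mark_path that .
  show "hom_eq M (mark i x +++ d) (mark i y)" if "i \<in> regions" "path_in (U i) d x y" for i d x y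
    using mark_extend that .
  show "base \<in> M" by (rule base_above)
  show "realize \<in> hom fig8_group (pi1 M base)" by (rule realize_hom)
  show "path_diff M base (mark i x) (mark j x) = realize (label i x \<cdot> finv (label j x))"
    if "i \<in> regions" "j \<in> regions" "x \<in> U i" "x \<in> U j" for i j x
    using diff_label[OF that] by (simp only: diff_def)
qed

end

lemma loops_at_join:
  assumes f: "f \<in> loops_at X x" and g: "g \<in> loops_at X x"
  shows "loop_join f g \<in> loops_at X x"
proof -
  have cf: "continuous_map (top_of_set {0..1}) X f" "f 0 = x" "f 1 = x"
    and cg: "continuous_map (top_of_set {0..1}) X g" "g 0 = x" "g 1 = x"
    using f g by (auto simp: loops_at_def pathin_def)
  let ?I = "top_of_set {0..1::real}"
  have "continuous_map (subtopology ?I {t \<in> topspace ?I. t \<le> 1/2}) ?I (\<lambda>t. 2 * t)"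
    by (auto simp: subtopology_subtopology continuous_map_in_subtopology continuous_map_iff_continuous2 intro!: continuous_intros)
  from continuous_map_compose[OF this cf(1)]
  have 1: "continuous_map (subtopology ?I {t \<in> topspace ?I. t \<le> 1/2}) X (\<lambda>t. f (2 * t))"
    by (simp add: comp_def)
  have "continuous_map (subtopology ?I {t \<in> topspace ?I. 1/2 \<le> t}) ?I (\<lambda>t. 2 * t - 1)"
    by (auto simp: subtopology_subtopology continuous_map_in_subtopology continuous_map_iff_continuous2 intro!: continuous_intros)
  from continuous_map_compose[OF this cg(1)]
  have 2: "continuous_map (subtopology ?I {t \<in> topspace ?I. 1/2 \<le> t}) X (\<lambda>t. g (2 * t - 1))"
    by (simp add: comp_def)
  have "continuous_map ?I X (\<lambda>t. if t \<le> 1/2 then f (2 * t) else g (2 * t - 1))"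
  proof (rule continuous_map_cases_le[OF _ _ 1 2])
    show "f (2 * t) = g (2 * t - 1)" if "t = 1/2" for t
      unfolding that using cf cg by simp
  qed (auto simp: continuous_map_from_subtopology)
  then show ?thesis
    using cf cg by (simp add: loops_at_def pathin_def loop_join_def)
qed

lemma loop_homotopy_refl: "f \<in> loops_at X x \<Longrightarrow> (f, f) \<in> loop_homotopy X x"
  by (auto simp: loop_homotopy_def loops_at_def pathin_def)

lemma loop_homotopy_sym: "(f, g) \<in> loop_homotopy X x \<Longrightarrow> (g, f) \<in> loop_homotopy X x"
  by (auto simp: loop_homotopy_def homotopic_with_sym)

lemma loop_homotopy_trans:
  "(f, g) \<in> loop_homotopy X x \<Longrightarrow> (g, h) \<in> loop_homotopy X x \<Longrightarrow> (f, h) \<in> loop_homotopy X x"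
  by (auto simp: loop_homotopy_def intro: homotopic_with_trans)

section \<open>Sheets and walls of group elements\<close>

definition sheet_action :: "nat \<Rightarrow> nat word set \<Rightarrow> nat"
  where "sheet_action s g = sheet_act s (SOME u. u \<in> g)"

lemma some_fcls:
  assumes "u \<in> words fig8_gens" shows "fig8_eq u (SOME v. v \<in> fcls u)"
proof -
  have "u \<in> fcls u" using word_eq.refl[OF assms] by simp
  then have "(SOME v. v \<in> fcls u) \<in> fcls u" by (rule someI)
  then show ?thesis by (simp only: Image_singleton_iff word_rel_iff)
qed

lemma sheet_action_fcls: "s < 20 \<Longrightarrow> u \<in> words fig8_gens \<Longrightarrow> sheet_action s (fcls u) = sheet_act s u"
  unfolding sheet_action_def using sheet_act_fig8_eq[OF some_fcls] by simp

lemma fig8_group_cases: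
  assumes "g \<in> carrier fig8_group"
  obtains u where "g = fcls u" "u \<in> words fig8_gens"
  using assms by (auto simp: carrier_presented_group)

text \<open>Defined for all group elements but multiplicative only on the stabiliser of the sheet
  \<open>s\<close>, where the permutation returns to \<open>sheet_types s\<close>. This stabiliser
  is the holonomy group of the cover at \<open>s\<close>.\<close>

definition wall_class :: "nat \<Rightarrow> nat word set \<Rightarrow> nat word set"
  where "wall_class s g = wcls walls (racg_relators walls wall_crossings) (wall_word (sheet_types s) (SOME u. u \<in> g))"

lemma sheet_wall_words: "s < 20 \<Longrightarrow> wall_word (sheet_types s) u \<in> words walls"
  by (rule wall_word_words[OF types_sheet_types])

lemma wall_class_fcls:
  assumes "s < 20" "u \<in> words fig8_gens"
  shows "wall_class s (fcls u) = wcls walls (racg_relators walls wall_crossings) (wall_word (sheet_types s) u)"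
  unfolding wall_class_def
  using sheet_wall_word_eq[OF word_eq.sym[OF some_fcls[OF assms(2)]] assms(1)]
  by (subst wcls_eq_iff) (auto intro: sheet_wall_words[OF assms(1)])

lemma wall_class_mult:
  assumes s: "s < 20" and g: "g \<in> carrier fig8_group" "sheet_action s g = s" and h: "h \<in> carrier fig8_group"
  shows "wall_class s (g \<otimes>\<^bsub>fig8_group\<^esub> h) = wall_class s g \<otimes>\<^bsub>racg walls wall_crossings\<^esub> wall_class s h"
proof -
  obtain u where u: "g = fcls u" "u \<in> words fig8_gens" using fig8_group_cases[OF g(1)] .
  obtain v where v: "h = fcls v" "v \<in> words fig8_gens" using fig8_group_cases[OF h] .
  have "sheet_act s u = s" using g(2) sheet_action_fcls[OF s u(2)] u(1) by simp
  then show ?thesis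
    using sheet_wall_word_append[OF s u(2), of v] u v
    by (simp add: mult_presented_group wall_class_fcls[OF s] racg_eq_presented sheet_wall_words[OF s])
qed

lemma wall_class_inj:
  assumes s: "s < 20" and g: "g \<in> carrier fig8_group" "sheet_action s g = s"
    and h: "h \<in> carrier fig8_group" "sheet_action s h = s" and eq: "wall_class s g = wall_class s h"
  shows "g = h"
proof -
  obtain u where u: "g = fcls u" "u \<in> words fig8_gens" using fig8_group_cases[OF g(1)] .
  obtain v where v: "h = fcls v" "v \<in> words fig8_gens" using fig8_group_cases[OF h(1)] .
  have su: "sheet_act s u = s" and sv: "sheet_act s v = s"
    using g(2) h(2) sheet_action_fcls[OF s] u v by auto
  have ww: "wall_eq (wall_word (sheet_types s) u) (wall_word (sheet_types s) v)"
    using eq unfolding u(1) v(1) wall_class_fcls[OF s u(2)] wall_class_fcls[OF s v(2)]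
    by (subst (asm) wcls_eq_iff) (auto intro: sheet_wall_words[OF s])
  have v': "winv v \<in> words fig8_gens" using v by simp
  have vv: "fig8_eq (v @ winv v) []" by (rule word_eq_winv_right[OF v(2)])
  have "sheet_act s (winv v) = s"
    using sheet_act_fig8_eq[OF vv s] sv by (simp add: sheet_act_append) (simp add: sheet_act_def)
  then have suv: "sheet_act s (u @ winv v) = s" using su by (simp add: sheet_act_append)
  have "wall_eq (wall_word (sheet_types s) u @ wall_word (sheet_types s) (winv v))
      (wall_word (sheet_types s) v @ wall_word (sheet_types s) (winv v))"
    by (intro word_eq_append ww word_eq.refl sheet_wall_words[OF s])
  then have "wall_eq (wall_word (sheet_types s) (u @ winv v)) (wall_word (sheet_types s) (v @ winv v))"
    using sheet_wall_word_append[OF s u(2), of "winv v"] sheet_wall_word_append[OF s v(2), of "winv v"] su sv by simp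
  moreover have "wall_eq (wall_word (sheet_types s) (v @ winv v)) []"
    using sheet_wall_word_eq[OF vv s] by simp
  ultimately have "wall_eq (wall_word (sheet_types s) (u @ winv v)) []" by (rule word_eq.trans)
  then have "fig8_eq (u @ winv v) []"
    using sheet_wall_word_faithful[OF _ s suv] u v' by simp
  then have "fcls (u @ winv v) = fcls []" using u v' by (subst wcls_eq_iff) auto
  then have "g \<otimes>\<^bsub>fig8_group\<^esub> inv\<^bsub>fig8_group\<^esub> h = \<one>\<^bsub>fig8_group\<^esub>"
    using u v by (simp add: one_presented_group inv_presented_group mult_presented_group)
  then show "g = h" using g(1) h(1) fig8.inv_equality[of g "inv\<^bsub>fig8_group\<^esub> h"] by simp
qed

section \<open>The cover of degree 20\<close>

context fig8_space
begin

abbreviation "holonomy \<equiv> marked.holonomy"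

sublocale twenty: gset_cocycle fig8_group "top_of_set M" regions U label "{..<20}" sheet_action
proof unfold_locales
  fix s :: nat and g assume s: "s \<in> {..<20}" and g: "g \<in> carrier fig8_group"
  obtain u where u: "g = fcls u" "u \<in> words fig8_gens" using fig8_group_cases[OF g] .
  show "sheet_action s g \<in> {..<20}"
    using s u sheet_act_less by (simp add: sheet_action_fcls)
  fix h assume h: "h \<in> carrier fig8_group"
  obtain v where v: "h = fcls v" "v \<in> words fig8_gens" using fig8_group_cases[OF h] .
  show "sheet_action s (g \<cdot> h) = sheet_action (sheet_action s g) h"
    using s u v sheet_act_less[of s u] by (simp add: sheet_action_fcls mult_presented_group sheet_act_append)
next
  fix s :: nat assume "s \<in> {..<20}"
  then show "sheet_action s fone = s"
    by (simp add: one_presented_group sheet_action_fcls) (simp add: sheet_act_def)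
qed

abbreviation cover20 :: "('b \<times> nat) topology"
  where "cover20 \<equiv> twenty.cover"

lemma holonomy_carrier: "pathin (top_of_set M) \<gamma> \<Longrightarrow> holonomy \<gamma> \<in> carrier fig8_group"
  unfolding marked.holonomy_def by (rule marked.torsor.transport_in) auto

lemma holonomy_section:
  assumes "pathin (top_of_set M) \<gamma>"
  obtains \<sigma> where "marked.torsor.parallel twenty.unit_topology \<gamma> \<sigma>" "\<sigma> 0 = fone" "\<sigma> 1 = holonomy \<gamma>"
proof -
  obtain \<sigma> where \<sigma>: "marked.torsor.parallel twenty.unit_topology \<gamma> \<sigma>" "\<sigma> 0 = fone"
    using marked.torsor.parallel_path_exists[OF assms, of fone] by blast
  have "\<sigma> 1 = holonomy \<gamma>"
    using marked.torsor.transport_eq[OF assms \<sigma>(1)] unfolding marked.holonomy_def \<sigma>(2) by (rule HOL.sym)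
  with \<sigma> show ?thesis by (rule that)
qed

text \<open>Letting the group-valued parallel section act on \<open>s\<close> gives a parallel
  section of sheets. So a loop lifts to a loop at sheet \<open>s\<close> exactly when its holonomy
  fixes \<open>s\<close>.\<close>

lemma transport_twenty:
  assumes \<gamma>: "pathin (top_of_set M) \<gamma>" and s: "s < 20"
  shows "twenty.transport \<gamma> s = sheet_action s (holonomy \<gamma>)"
proof -
  obtain \<sigma> where \<sigma>: "marked.torsor.parallel twenty.unit_topology \<gamma> \<sigma>" "\<sigma> 0 = fone" "\<sigma> 1 = holonomy \<gamma>"
    using holonomy_section[OF \<gamma>] .
  have "twenty.parallel twenty.unit_topology \<gamma> (\<lambda>t. sheet_action s (\<sigma> t))"
    unfolding twenty.parallel_def
  proof
    fix t assume "t \<in> topspace twenty.unit_topology"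
    then obtain i V g where V: "i \<in> regions" "openin twenty.unit_topology V" "t \<in> V" "g \<in> carrier fig8_group"
      "\<forall>y\<in>V. \<gamma> y \<in> U i \<and> \<sigma> y = g \<cdot> label i (\<gamma> y)"
      using \<sigma>(1) unfolding marked.torsor.parallel_def by meson
    then show "\<exists>i\<in>regions. \<exists>V s'. openin twenty.unit_topology V \<and> t \<in> V \<and> s' \<in> {..<20} \<and>
        (\<forall>y\<in>V. \<gamma> y \<in> U i \<and> sheet_action s (\<sigma> y) = sheet_action s' (label i (\<gamma> y)))"
      using twenty.act_mult[of s g] twenty.act_closed[of s g] s
      by (intro bexI[of _ i] exI[of _ V] exI[of _ "sheet_action s g"]) (auto simp del: label.simps)
  qed
  from twenty.transport_eq[OF \<gamma> this] \<sigma>(2,3) twenty.act_one[of s] s show ?thesis by simp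
qed

text \<open>Labels multiply from the right, so left translation preserves parallel sections, and the
  section along \<open>g\<close> may start at \<open>holonomy f\<close>.\<close>

lemma holonomy_join:
  assumes f: "f \<in> loops_at (top_of_set M) x" and g: "g \<in> loops_at (top_of_set M) x"
  shows "holonomy (loop_join f g) = holonomy f \<cdot> holonomy g"
proof -
  have p: "pathin (top_of_set M) f" "pathin (top_of_set M) g" "pathin (top_of_set M) (loop_join f g)" "f 1 = g 0"
    using f g loops_at_join[OF f g] by (auto simp: loops_at_def)
  have hf: "holonomy f \<in> carrier fig8_group" by (rule holonomy_carrier[OF p(1)])
  obtain \<sigma> where \<sigma>: "marked.torsor.parallel twenty.unit_topology g \<sigma>" "\<sigma> 0 = fone" "\<sigma> 1 = holonomy g"
    using holonomy_section[OF p(2)] .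
  have "marked.torsor.parallel twenty.unit_topology g (\<lambda>t. holonomy f \<cdot> \<sigma> t)"
    unfolding marked.torsor.parallel_def
  proof
    fix t assume "t \<in> topspace twenty.unit_topology"
    then obtain i V h where V: "i \<in> regions" "openin twenty.unit_topology V" "t \<in> V" "h \<in> carrier fig8_group"
      "\<forall>y\<in>V. g y \<in> U i \<and> \<sigma> y = h \<cdot> label i (g y)"
      using \<sigma>(1) unfolding marked.torsor.parallel_def by meson
    then show "\<exists>i\<in>regions. \<exists>V h'. openin twenty.unit_topology V \<and> t \<in> V \<and> h' \<in> carrier fig8_group \<and>
        (\<forall>y\<in>V. g y \<in> U i \<and> holonomy f \<cdot> \<sigma> y = h' \<cdot> label i (g y))"
      using hf by (intro bexI[of _ i] exI[of _ V] exI[of _ "holonomy f \<cdot> h"]) (auto simp: fig8.m_assoc simp del: label.simps)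
  qed
  from marked.torsor.transport_eq[OF p(2) this] \<sigma>(2,3) hf
  have "marked.torsor.transport g (holonomy f) = holonomy f \<cdot> holonomy g" by simp
  moreover have "holonomy (loop_join f g) = marked.torsor.transport g (holonomy f)"
    unfolding marked.holonomy_def by (rule marked.torsor.transport_join[OF p]) (rule fig8.one_closed)
  ultimately show ?thesis by (rule HOL.trans[rotated])
qed

lemma holonomy_homotopic: "(f, g) \<in> loop_homotopy (top_of_set M) x \<Longrightarrow> holonomy f = holonomy g"
  unfolding marked.holonomy_def by (rule marked.torsor.transport_homotopic) auto

lemma holonomy_inj:
  assumes "f \<in> loops_at (top_of_set M) x" "g \<in> loops_at (top_of_set M) x" "holonomy f = holonomy g"
  shows "(f, g) \<in> loop_homotopy (top_of_set M) x"
  using marked.holonomy_injective[of f x g] assms by (simp add: loops_at_top_of_set loop_homotopy_top_of_set)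

lemma cover20_loop:
  assumes f: "f \<in> loops_at cover20 (x, s)"
  shows "fst \<circ> f \<in> loops_at (top_of_set M) x" "s < 20" "holonomy (fst \<circ> f) \<in> carrier fig8_group"
    "sheet_action s (holonomy (fst \<circ> f)) = s"
proof -
  note l = twenty.loops_at_cover[OF f]
  show "fst \<circ> f \<in> loops_at (top_of_set M) x" by (rule l(1))
  show s: "s < 20" using l(3) by simp
  have p: "pathin (top_of_set M) (fst \<circ> f)" using l(1) by (simp add: loops_at_def)
  show "holonomy (fst \<circ> f) \<in> carrier fig8_group" by (rule holonomy_carrier[OF p])
  show "sheet_action s (holonomy (fst \<circ> f)) = s"
    using l(4) transport_twenty[OF p s] by simp
qed

text \<open>A loop in the cover goes to the wall class of the holonomy of its projection. This is
  injective on homotopy classes because each of the three steps is: projection, holonomy, and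
  \<open>wall_class\<close> on the stabiliser of the sheet.\<close>

lemma special_cover20:
  assumes y: "y \<in> topspace cover20"
  shows "special_group (fundamental_group cover20 y)"
proof -
  obtain x s where xs: "y = (x, s)" by fastforce
  let ?R = "loop_homotopy cover20 (x, s)" and ?L = "loops_at cover20 (x, s)"
  define \<rho> where "\<rho> A = wall_class s (holonomy (fst \<circ> (SOME f. f \<in> A)))" for A :: "(real \<Rightarrow> 'b \<times> nat) set"
  have hol_eq: "holonomy (fst \<circ> f) = holonomy (fst \<circ> g)" if "(f, g) \<in> ?R" for f g
    using holonomy_homotopic[OF twenty.loop_homotopy_project[OF that]] .
  have \<rho>: "\<rho> A = wall_class s (holonomy (fst \<circ> f))" if "f \<in> A" "\<And>g. g \<in> A \<Longrightarrow> (f, g) \<in> ?R" for A f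
    using hol_eq[OF that(2)[OF someI[of "\<lambda>f. f \<in> A", OF that(1)]]] by (simp add: \<rho>_def)
  have \<rho>1: "\<rho> (?R `` {f}) = wall_class s (holonomy (fst \<circ> f))" if "f \<in> ?L" for f
    by (rule \<rho>) (use loop_homotopy_refl[OF that] in auto)
  have s: "s < 20" using y xs by (simp add: twenty.topspace_cover)
  have "\<rho> \<in> hom (fundamental_group cover20 (x, s)) (racg walls wall_crossings)"
  proof (rule homI)
    fix A B assume "A \<in> carrier (fundamental_group cover20 (x, s))" "B \<in> carrier (fundamental_group cover20 (x, s))"
    then obtain f g where f: "f \<in> ?L" "A = ?R `` {f}" and g: "g \<in> ?L" "B = ?R `` {g}"
      by (auto simp: fundamental_group_def quotient_def)
    obtain u where u: "holonomy (fst \<circ> f) = fcls u" "u \<in> words fig8_gens"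
      using fig8_group_cases[OF cover20_loop(3)[OF f(1)]] .
    show "\<rho> A \<in> carrier (racg walls wall_crossings)"
      unfolding f(2) \<rho>1[OF f(1)] u(1) wall_class_fcls[OF s u(2)] racg_eq_presented
      by (rule wcls_in_carrier[OF sheet_wall_words[OF s]])
    let ?AB = "\<Union>f\<in>A. \<Union>g\<in>B. ?R `` {loop_join f g}"
    have hj: "holonomy (fst \<circ> loop_join f' g') = holonomy (fst \<circ> f') \<cdot> holonomy (fst \<circ> g')"
      if "f' \<in> ?L" "g' \<in> ?L" for f' g'
    proof -
      have "fst \<circ> loop_join f' g' = loop_join (fst \<circ> f') (fst \<circ> g')" by (auto simp: loop_join_def)
      then show ?thesis
        using holonomy_join[OF cover20_loop(1)[OF that(1)] cover20_loop(1)[OF that(2)]] by simp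
    qed
    \<comment> \<open>The product class is a union over all representatives, and
      \<open>\<rho>\<close> selects an arbitrary element of it; all elements have the same
      holonomy.\<close>
    have in_AB: "holonomy (fst \<circ> h) = holonomy (fst \<circ> f) \<cdot> holonomy (fst \<circ> g)" if h: "h \<in> ?AB" for h
    proof -
      obtain f' g' where fg: "(f, f') \<in> ?R" "(g, g') \<in> ?R" "(loop_join f' g', h) \<in> ?R"
        using h f g by auto
      then have "f' \<in> ?L" "g' \<in> ?L" by (auto simp: loop_homotopy_def)
      then show ?thesis using hol_eq[OF fg(1)] hol_eq[OF fg(2)] hol_eq[OF fg(3)] hj by simp
    qed
    have "f \<in> A" "g \<in> B" using loop_homotopy_refl[OF f(1)] loop_homotopy_refl[OF g(1)] f g by auto
    moreover have "loop_join f g \<in> ?R `` {loop_join f g}"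
      using loop_homotopy_refl[OF loops_at_join[OF f(1) g(1)]] by simp
    ultimately have "loop_join f g \<in> ?AB" by blast
    then have "(SOME h. h \<in> ?AB) \<in> ?AB" by (rule someI[of "\<lambda>h. h \<in> ?AB"])
    from in_AB[OF this]
    have "\<rho> ?AB = wall_class s (holonomy (fst \<circ> f) \<cdot> holonomy (fst \<circ> g))"
      unfolding \<rho>_def by simp
    also have "\<dots> = \<rho> A \<otimes>\<^bsub>racg walls wall_crossings\<^esub> \<rho> B"
      using wall_class_mult[OF s cover20_loop(3,4)[OF f(1)] cover20_loop(3)[OF g(1)]]
        \<rho>1[OF f(1)] \<rho>1[OF g(1)] f(2) g(2) by simp
    finally show "\<rho> (A \<otimes>\<^bsub>fundamental_group cover20 (x, s)\<^esub> B) = \<rho> A \<otimes>\<^bsub>racg walls wall_crossings\<^esub> \<rho> B"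
      by (simp add: fundamental_group_def)
  qed
  moreover have "inj_on \<rho> (carrier (fundamental_group cover20 (x, s)))"
  proof (rule inj_onI)
    fix A B assume "A \<in> carrier (fundamental_group cover20 (x, s))" "B \<in> carrier (fundamental_group cover20 (x, s))"
      and eq: "\<rho> A = \<rho> B"
    then obtain f g where f: "f \<in> ?L" "A = ?R `` {f}" and g: "g \<in> ?L" "B = ?R `` {g}"
      by (auto simp: fundamental_group_def quotient_def)
    have "holonomy (fst \<circ> f) = holonomy (fst \<circ> g)"
      using wall_class_inj[OF s cover20_loop(3,4)[OF f(1)] cover20_loop(3,4)[OF g(1)]] eq \<rho>1[OF f(1)] \<rho>1[OF g(1)] f(2) g(2)
      by simp
    from holonomy_inj[OF cover20_loop(1)[OF f(1)] cover20_loop(1)[OF g(1)] this]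
    have fg: "(f, g) \<in> ?R" by (rule twenty.loop_homotopy_lift[OF f(1) g(1)])
    show "A = B"
      unfolding f(2) g(2)
      using loop_homotopy_trans[OF fg] loop_homotopy_trans[OF loop_homotopy_sym[OF fg]] by auto
  qed
  ultimately have "\<rho> \<in> mon (fundamental_group cover20 (x, s)) (racg walls wall_crossings)"
    by (simp add: mon_def)
  then show ?thesis
    using finite_simple_graph_walls unfolding special_group_def C_special_def xs by blast
qed

lemma connected_sheet:
  assumes i: "i \<in> regions" and t: "t < 20"
  shows "connectedin cover20 (twenty.sheet i t (U i))"
proof -
  have "connected (U i)" using U_simply[OF i] by (rule simply_connected_imp_connected)
  then have "connectedin (subtopology (top_of_set M) (U i)) (U i)"
    using region_sub[OF i] by (simp add: connectedin_subtopology)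
  then show ?thesis
    using connectedin_continuous_map_image[OF twenty.continuous_map_sheet[OF i, of t]] t
    by (simp add: twenty.sheet_def)
qed

lemma sheet_connected:
  assumes i: "i \<in> regions" and t: "t < 20" and xy: "x \<in> U i" "y \<in> U i"
  shows "connected_component_of cover20 (x, sheet_action t (label i x)) (y, sheet_action t (label i y))"
  unfolding connected_component_of_def
  using connected_sheet[OF i t] xy by (intro exI[of _ "twenty.sheet i t (U i)"]) (auto simp: twenty.sheet_def simp del: label.simps)

text \<open>Go from the base to face \<open>k\<close> within \<open>Above\<close> and return within
  \<open>Below\<close>: the sheet changes by \<open>face_elt k\<close>.\<close>

lemma base_connected_face:
  assumes k: "k < 6" and s: "s < 20"
  shows "connected_component_of cover20 (base, s) (base, sheet_action s (face_elt k))"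
proof -
  obtain x where x: "x \<in> P k" using P_ne[OF k] by auto
  have xU: "x \<in> U Above" "x \<in> U Below" using P_sub[OF k] x by auto
  let ?t = "sheet_action s (face_elt k)"
  have t: "?t < 20" using twenty.act_closed[of s "face_elt k"] s by simp
  have b: "face_index base = 0" "face_index x = k" using face_index[of 0 base] base face_index[OF k x] by auto
  have one: "sheet_action u fone = u" if "u < 20" for u using twenty.act_one[of u] that by simp
  have "connected_component_of cover20 (base, s) (x, s)"
    using sheet_connected[OF above_region(1) s base_above(1) xU(1)] by (simp add: one s)
  moreover have "sheet_action ?t (finv (face_elt k)) = s"
    using twenty.act_mult[of s "face_elt k" "finv (face_elt k)"] s one by simp
  then have "connected_component_of cover20 (x, s) (base, ?t)"
    using sheet_connected[OF above_region(2) t xU(2) base_above(2)]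
    by (simp add: one t b xU base_above face_elt_0)
  ultimately show ?thesis by (rule connected_component_of_trans)
qed

lemma base_connected_word:
  "u \<in> words fig8_gens \<Longrightarrow> s < 20 \<Longrightarrow> connected_component_of cover20 (base, s) (base, sheet_act s u)"
proof (induction u rule: rev_induct)
  case Nil
  then show ?case
    using base_above(3) by (simp add: sheet_act_def connected_component_of_refl twenty.topspace_cover)
next
  case (snoc l u)
  let ?t = "sheet_act s u" and ?t' = "sheet_act s (u @ [l])"
  have u: "u \<in> words fig8_gens" and l: "fst l \<in> fig8_gens" using snoc.prems by auto
  have t: "?t < 20" "?t' < 20" using sheet_act_less[OF snoc.prems(2)] u snoc.prems(1) by auto
  have gen: "connected_component_of cover20 (base, r) (base, sheet_step (x, True) ! r)" if "r < 20" "x \<in> fig8_gens" for r x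
  proof -
    have "sheet_action r (fcls [(x, True)]) = sheet_step (x, True) ! r"
      using that by (simp add: sheet_action_fcls del: sheet_step.simps) (simp add: sheet_act_def)
    moreover have "fcls [(x, True)] = face_elt (if x = 0 then 1 else 5)"
      using that by (auto simp: fig8_gens_def face_elt_def face_word_def)
    ultimately show ?thesis using base_connected_face[of "if x = 0 then 1 else 5" r] that by (auto simp del: sheet_step.simps)
  qed
  have t': "?t' = sheet_step l ! ?t" by (simp add: sheet_act_def)
  have "connected_component_of cover20 (base, ?t) (base, ?t')"
  proof (cases "snd l")
    case True
    then have "l = (fst l, True)" by (cases l) auto
    then show ?thesis using gen[OF t(1) l] t' by metis
  next
    case False
    then have "flip_letter l = (fst l, True)" by simp
    then have "sheet_step (fst l, True) ! ?t' = ?t"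
      using sheet_letter(2)[OF t(1) l] t' by metis
    then show ?thesis using gen[OF t(2) l] connected_component_of_sym by metis
  qed
  with snoc.IH[OF u snoc.prems(2)] show ?case by (rule connected_component_of_trans)
qed

lemma connected_cover20: "connected_space cover20"
proof -
  \<comment> \<open>Move inside the chart to its link, which lies in \<open>Above\<close>, and
    inside \<open>Above\<close> to the base; there the words of the group permute the sheets
    transitively.\<close>
  have *: "connected_component_of cover20 (base, 0) z" if z: "z \<in> topspace cover20" for z
  proof -
    obtain x s where xs: "z = (x, s)" "x \<in> M" "s < 20" using z by (auto simp: twenty.topspace_cover)
    obtain i where i: "i \<in> regions" "x \<in> U i" using xs(2) U_cover by blast
    have s': "s \<in> {..<20}" using xs(3) by simp
    obtain t where t: "t \<in> {..<20}" "s = sheet_action t (label i x)" by (rule twenty.chart_coordinate[OF i s'])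
    let ?l = "link i" and ?r = "sheet_action t (label i (link i))"
    note l = link_in[OF i(1)]
    have r: "?r < 20" using twenty.act_closed[OF t(1) label_carrier[of i "link i"]] by simp
    have one: "sheet_action ?r fone = ?r" using twenty.act_one[of ?r] r by simp
    have "connected_component_of cover20 (?l, ?r) z"
      using sheet_connected[OF i(1) _ l(2) i(2), of t] t xs(1) by (simp del: label.simps)
    moreover have "connected_component_of cover20 (base, ?r) (?l, ?r)"
      using sheet_connected[OF above_region(1) r base_above(1) l(1)] one by simp
    moreover obtain u where u: "u \<in> words fig8_gens" "sheet_act 0 u = ?r" using sheet_transitive[OF r] .
    then have "connected_component_of cover20 (base, 0) (base, ?r)"
      using base_connected_word[OF u(1), of 0] by simp
    ultimately show ?thesis by (blast intro: connected_component_of_trans)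
  qed
  show ?thesis
    unfolding connected_space_iff_connected_component
  proof (intro ballI)
    fix y z assume y: "y \<in> topspace cover20" and z: "z \<in> topspace cover20"
    show "connected_component_of cover20 y z"
      by (rule connected_component_of_trans[OF iffD1[OF connected_component_of_sym *[OF y]] *[OF z]])
  qed
qed

theorem special_cover_exists:
  "covering_of_degree 20 cover20 (top_of_set M) fst \<and> special_cover cover20 (top_of_set M) fst"
proof -
  have "covering_of_degree 20 cover20 (top_of_set M) fst"
    by (rule twenty.covering_of_degree_cover) auto
  moreover have "covering_map cover20 (top_of_set M) fst"
    by (rule twenty.covering_map_cover) (simp add: lessThan_empty_iff)
  ultimately show ?thesis
    using connected_cover20 special_cover20 by (simp add: special_cover_def)
qed

end

section \<open>The complement of the polygon\<close>

definition over_strand :: "real \<Rightarrow> real \<Rightarrow> bool"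
  where "over_strand x y \<longleftrightarrow> x = 0 \<and> 0 \<le> y \<and> y \<le> 3 \<or> x = 1 \<and> 2 \<le> y \<and> y \<le> 4 \<or> x = 2 \<and> 1 \<le> y \<and> y \<le> 3 \<or>
    x = 3 \<and> 2 \<le> y \<and> y \<le> 5 \<or> x = 4 \<and> 0 \<le> y \<and> y \<le> 4 \<or> x = 5 \<and> 1 \<le> y \<and> y \<le> 5"

definition under_strand :: "real \<Rightarrow> real \<Rightarrow> bool"
  where "under_strand x y \<longleftrightarrow> y = 0 \<and> 0 \<le> x \<and> x \<le> 4 \<or> y = 1 \<and> 2 \<le> x \<and> x \<le> 5 \<or> y = 2 \<and> 1 \<le> x \<and> x \<le> 3 \<or>
    y = 3 \<and> 0 \<le> x \<and> x \<le> 2 \<or> y = 4 \<and> 1 \<le> x \<and> x \<le> 4 \<or> y = 5 \<and> 3 \<le> x \<and> x \<le> 5"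

definition corner :: "real \<Rightarrow> real \<Rightarrow> bool"
  where "corner x y \<longleftrightarrow> (x, y) \<in> {(0,0), (0,3), (1,2), (1,4), (2,1), (2,3), (3,2), (3,5), (4,0), (4,4), (5,1), (5,5)}"

lemma figure_eight_polygon_iff:
  "(x, y, z) \<in> figure_eight_polygon \<longleftrightarrow>
    over_strand x y \<and> z = 1 \<or> under_strand x y \<and> z = 0 \<or> corner x y \<and> 0 \<le> z \<and> z \<le> 1"
proof -
  have "(x, y, z) \<in> figure_eight_polygon \<longleftrightarrow>
    x = 0 \<and> 0 \<le> y \<and> y \<le> 3 \<and> z = 1 \<or> x = 0 \<and> y = 3 \<and> 0 \<le> z \<and> z \<le> 1 \<or>
    0 \<le> x \<and> x \<le> 2 \<and> y = 3 \<and> z = 0 \<or> x = 2 \<and> y = 3 \<and> 0 \<le> z \<and> z \<le> 1 \<or>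
    x = 2 \<and> 1 \<le> y \<and> y \<le> 3 \<and> z = 1 \<or> x = 2 \<and> y = 1 \<and> 0 \<le> z \<and> z \<le> 1 \<or>
    2 \<le> x \<and> x \<le> 5 \<and> y = 1 \<and> z = 0 \<or> x = 5 \<and> y = 1 \<and> 0 \<le> z \<and> z \<le> 1 \<or>
    x = 5 \<and> 1 \<le> y \<and> y \<le> 5 \<and> z = 1 \<or> x = 5 \<and> y = 5 \<and> 0 \<le> z \<and> z \<le> 1 \<or>
    3 \<le> x \<and> x \<le> 5 \<and> y = 5 \<and> z = 0 \<or> x = 3 \<and> y = 5 \<and> 0 \<le> z \<and> z \<le> 1 \<or>
    x = 3 \<and> 2 \<le> y \<and> y \<le> 5 \<and> z = 1 \<or> x = 3 \<and> y = 2 \<and> 0 \<le> z \<and> z \<le> 1 \<or>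
    1 \<le> x \<and> x \<le> 3 \<and> y = 2 \<and> z = 0 \<or> x = 1 \<and> y = 2 \<and> 0 \<le> z \<and> z \<le> 1 \<or>
    x = 1 \<and> 2 \<le> y \<and> y \<le> 4 \<and> z = 1 \<or> x = 1 \<and> y = 4 \<and> 0 \<le> z \<and> z \<le> 1 \<or>
    1 \<le> x \<and> x \<le> 4 \<and> y = 4 \<and> z = 0 \<or> x = 4 \<and> y = 4 \<and> 0 \<le> z \<and> z \<le> 1 \<or>
    x = 4 \<and> 0 \<le> y \<and> y \<le> 4 \<and> z = 1 \<or> x = 4 \<and> y = 0 \<and> 0 \<le> z \<and> z \<le> 1 \<or>
    0 \<le> x \<and> x \<le> 4 \<and> y = 0 \<and> z = 0 \<or> x = 0 \<and> y = 0 \<and> 0 \<le> z \<and> z \<le> 1"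
    unfolding figure_eight_polygon_def closed_polygon_def
    by (simp add: lessThan_nat_numeral lessThan_Suc closed_segment_same_fst closed_segment_same_snd
        closed_segment_eq_real_ivl disj_ac conj_ac)
  then show ?thesis
    unfolding over_strand_def under_strand_def corner_def by (simp only: insert_iff prod.inject empty_iff) argo
qed

text \<open>Each edge is removed together with the curtain that hangs below it, so the set is
  invariant under upward translation. The bounds \<open>-1\<close> here and \<open>2\<close> in
  \<open>below_set\<close> make the two sets overlap in a slab over the faces of the
  diagram.\<close>

definition above_set :: "R3 set"
  where "above_set = {(x, y, z). - 1 < z \<and> \<not> (over_strand x y \<and> z \<le> 1) \<and> \<not> (under_strand x y \<and> z \<le> 0)}"

definition below_set :: "R3 set"
  where "below_set = {(x, y, z). z < 2 \<and> \<not> (over_strand x y \<and> 1 \<le> z) \<and> \<not> (under_strand x y \<and> 0 \<le> z)}"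

definition cross_x :: "nat \<Rightarrow> real" where "cross_x k = [1, 2, 4, 3] ! k"
definition cross_y :: "nat \<Rightarrow> real" where "cross_y k = [3, 2, 1, 4] ! k"

text \<open>The box lies strictly between the heights of the two strands, and the half-width 1/2
  keeps it clear of all other strands.\<close>

definition crossing_box :: "nat \<Rightarrow> R3 set"
  where "crossing_box k = {cross_x k - 1/2 <..< cross_x k + 1/2} \<times> {cross_y k - 1/2 <..< cross_y k + 1/2} \<times> {0<..<1}"

definition west_box :: "nat \<Rightarrow> R3 set"
  where "west_box k = {cross_x k - 1/2 <..< cross_x k} \<times> {cross_y k - 1/2 <..< cross_y k + 1/2} \<times> {0<..<1}"
definition east_box :: "nat \<Rightarrow> R3 set"
  where "east_box k = {cross_x k <..< cross_x k + 1/2} \<times> {cross_y k - 1/2 <..< cross_y k + 1/2} \<times> {0<..<1}"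
definition south_box :: "nat \<Rightarrow> R3 set"
  where "south_box k = {cross_x k - 1/2 <..< cross_x k + 1/2} \<times> {cross_y k - 1/2 <..< cross_y k} \<times> {0<..<1}"
definition north_box :: "nat \<Rightarrow> R3 set"
  where "north_box k = {cross_x k - 1/2 <..< cross_x k + 1/2} \<times> {cross_y k <..< cross_y k + 1/2} \<times> {0<..<1}"

abbreviation slab :: "real set" where "slab \<equiv> {-1<..<2}"

text \<open>Faces of the diagram times the slab, as unions of overlapping rectangles. For the outer
  face, the first four pieces cover the outside of the square with side 5, the last three the
  notches at two of its corners.\<close>

definition prism :: "nat \<Rightarrow> R3 set"
  where "prism k =
    (if k = 1 then {0<..<4} \<times> {0<..<1} \<times> slab \<union> {0<..<2} \<times> {0<..<2} \<times> slab \<union> {0<..<1} \<times> {0<..<3} \<times> slab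
     else if k = 2 then {1<..<2} \<times> {2<..<3} \<times> slab
     else if k = 3 then {1<..<3} \<times> {3<..<4} \<times> slab \<union> {2<..<3} \<times> {2<..<4} \<times> slab
     else if k = 4 then {3<..<4} \<times> {1<..<4} \<times> slab \<union> {2<..<4} \<times> {1<..<2} \<times> slab
     else if k = 5 then {3<..<5} \<times> {4<..<5} \<times> slab \<union> {4<..<5} \<times> {1<..<5} \<times> slab
     else {..<0} \<times> UNIV \<times> slab \<union> UNIV \<times> {..<0} \<times> slab \<union> {5<..} \<times> UNIV \<times> slab \<union> UNIV \<times> {5<..} \<times> slab \<union>
       {4<..} \<times> {..<1} \<times> slab \<union> {..<3} \<times> {4<..} \<times> slab \<union> {..<1} \<times> {3<..} \<times> slab)"

text \<open>The neighbourhood of infinity: the outside of a ball of radius 10, which contains the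
  polygon with room to spare.\<close>

definition far :: "R3 set"
  where "far = {(x, y, z). 100 < x^2 + y^2 + z^2}"

section \<open>Incidence and connectivity of the pieces in Euclidean space\<close>

lemma less6: "k < 6 \<longleftrightarrow> k = 0 \<or> k = 1 \<or> k = 2 \<or> k = 3 \<or> k = 4 \<or> k = (5::nat)"
  by auto

lemma less4_cases: "k < 4 \<longleftrightarrow> k = 0 \<or> k = 1 \<or> k = 2 \<or> k = (3::nat)"
  by auto

lemma open_prism: "open (prism k)"
  unfolding prism_def by (simp add: open_Times open_Un)

lemma open_boxes: "open (crossing_box k)" "open (west_box k)" "open (east_box k)" "open (south_box k)" "open (north_box k)"
  unfolding crossing_box_def west_box_def east_box_def south_box_def north_box_def by (simp_all add: open_Times)

lemma convex_boxes: "convex (crossing_box k)" "convex (west_box k)" "convex (east_box k)" "convex (south_box k)" "convex (north_box k)"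
  unfolding crossing_box_def west_box_def east_box_def south_box_def north_box_def by (simp_all add: convex_Times)

lemma strands_in_box:
  assumes "k < 4" "cross_x k - 1/2 < x" "x < cross_x k + 1/2" "cross_y k - 1/2 < y" "y < cross_y k + 1/2"
  shows "over_strand x y \<longleftrightarrow> x = cross_x k" "under_strand x y \<longleftrightarrow> y = cross_y k"
proof -
  have "(over_strand x y \<longleftrightarrow> x = a) \<and> (under_strand x y \<longleftrightarrow> y = b)"
    if "(a, b) \<in> {(1, 3), (2, 2), (4, 1), (3, 4)}" "a - 1/2 < x" "x < a + 1/2" "b - 1/2 < y" "y < b + 1/2" for a b
    using that unfolding over_strand_def under_strand_def insert_iff prod.inject empty_iff by argo
  moreover have "(cross_x k, cross_y k) \<in> {(1, 3), (2, 2), (4, 1), (3, 4)}"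
    using assms(1) unfolding less4_cases by (elim disjE) (simp_all add: cross_x_def cross_y_def)
  ultimately show "over_strand x y \<longleftrightarrow> x = cross_x k" "under_strand x y \<longleftrightarrow> y = cross_y k"
    using assms by blast+
qed

lemma box_split:
  assumes "k < 4"
  shows "above_set \<inter> crossing_box k = west_box k \<union> east_box k"
    and "below_set \<inter> crossing_box k = south_box k \<union> north_box k"
  using strands_in_box[OF assms]
  unfolding above_set_def below_set_def crossing_box_def west_box_def east_box_def south_box_def north_box_def
  by auto

lemma box_disjoint:
  "west_box k \<inter> east_box k = {}" "south_box k \<inter> north_box k = {}"
  by (auto simp: west_box_def east_box_def south_box_def north_box_def)

lemma boxes_disjoint: "k < 4 \<Longrightarrow> l < 4 \<Longrightarrow> k \<noteq> l \<Longrightarrow> crossing_box k \<inter> crossing_box l = {}"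
  unfolding less4_cases crossing_box_def cross_x_def cross_y_def by (elim disjE) auto

lemma box_corners:
  assumes "k < 4"
  shows "west_box k \<inter> south_box k \<subseteq> prism (sw k)" "east_box k \<inter> south_box k \<subseteq> prism (se k)"
    "east_box k \<inter> north_box k \<subseteq> prism (ne k)" "west_box k \<inter> north_box k \<subseteq> prism (nw k)"
  using assms unfolding less4_cases west_box_def east_box_def south_box_def north_box_def
  by (elim disjE; force simp: cross_x_def cross_y_def sw_def se_def ne_def nw_def prism_def)+

lemma box_corners_ne:
  "west_box k \<inter> south_box k \<noteq> {}" "east_box k \<inter> south_box k \<noteq> {}"
  "east_box k \<inter> north_box k \<noteq> {}" "west_box k \<inter> north_box k \<noteq> {}"
proof -
  let ?p = "\<lambda>a b. (cross_x k + a, cross_y k + b, 1/2::real)"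
  have "?p (-1/4) (-1/4) \<in> west_box k \<inter> south_box k" "?p (1/4) (-1/4) \<in> east_box k \<inter> south_box k"
    "?p (1/4) (1/4) \<in> east_box k \<inter> north_box k" "?p (-1/4) (1/4) \<in> west_box k \<inter> north_box k"
    by (auto simp: west_box_def east_box_def south_box_def north_box_def)
  then show "west_box k \<inter> south_box k \<noteq> {}" "east_box k \<inter> south_box k \<noteq> {}"
    "east_box k \<inter> north_box k \<noteq> {}" "west_box k \<inter> north_box k \<noteq> {}"
    by blast+
qed

lemma prism_disjoint: "k < 6 \<Longrightarrow> l < 6 \<Longrightarrow> k \<noteq> l \<Longrightarrow> prism k \<inter> prism l = {}"
  unfolding less6 by (elim disjE; hypsubst; (simp; fail)?) (auto simp: prism_def)

lemma prism_ne: "k < 6 \<Longrightarrow> prism k \<noteq> {}"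
proof -
  assume "k < 6"
  have "(-1, 0, 0) \<in> prism 0" "(1/2, 1/2, 0) \<in> prism 1" "(3/2, 5/2, 0) \<in> prism 2"
    "(5/2, 7/2, 0) \<in> prism 3" "(7/2, 3/2, 0) \<in> prism 4" "(9/2, 9/2, 0) \<in> prism 5"
    by (auto simp: prism_def)
  with \<open>k < 6\<close> show ?thesis unfolding less6 by (elim disjE) auto
qed

lemma plane_cases:
  fixes x :: real
  shows "x < 0 \<or> x = 0 \<or> 0 < x \<and> x < 1 \<or> x = 1 \<or> 1 < x \<and> x < 2 \<or> x = 2 \<or> 2 < x \<and> x < 3 \<or> x = 3 \<or>
    3 < x \<and> x < 4 \<or> x = 4 \<or> 4 < x \<and> x < 5 \<or> x = 5 \<or> 5 < x"
  by argo

lemma above_below: "above_set \<inter> below_set = (\<Union>k<6. prism k)"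
proof -
  have "(x, y, z) \<in> above_set \<inter> below_set \<longleftrightarrow> (\<exists>k<6. (x, y, z) \<in> prism k)" for x y z
  proof -
    have "(x, y, z) \<in> above_set \<inter> below_set \<longleftrightarrow> - 1 < z \<and> z < 2 \<and> \<not> over_strand x y \<and> \<not> under_strand x y"
      unfolding above_set_def below_set_def by (simp, argo)
    moreover have "(\<exists>k<6. (x, y, z) \<in> prism k) \<longleftrightarrow>
        (x, y, z) \<in> prism 0 \<or> (x, y, z) \<in> prism 1 \<or> (x, y, z) \<in> prism 2 \<or> (x, y, z) \<in> prism 3 \<or> (x, y, z) \<in> prism 4 \<or> (x, y, z) \<in> prism 5"
      unfolding less6 by blast
    moreover have "\<not> over_strand x y \<and> \<not> under_strand x y \<and> - 1 < z \<and> z < 2 \<longleftrightarrow>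
        (x, y, z) \<in> prism 0 \<or> (x, y, z) \<in> prism 1 \<or> (x, y, z) \<in> prism 2 \<or> (x, y, z) \<in> prism 3 \<or> (x, y, z) \<in> prism 4 \<or> (x, y, z) \<in> prism 5"
      using plane_cases[of x] plane_cases[of y]
      by (elim disjE) (simp_all add: prism_def over_strand_def under_strand_def)
    ultimately show ?thesis by blast
  qed
  then show ?thesis by (simp add: set_eq_iff Bex_def)
qed

lemma strands_bounded: "over_strand x y \<or> under_strand x y \<Longrightarrow> 0 \<le> x \<and> x \<le> 5 \<and> 0 \<le> y \<and> y \<le> 5"
  unfolding over_strand_def under_strand_def by argo

lemma strands_meet:
  assumes "over_strand x y" "under_strand x y"
  shows "corner x y \<or> (\<exists>k<4. x = cross_x k \<and> y = cross_y k)"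
proof -
  have "corner x y \<or> (x, y) = (1, 3) \<or> (x, y) = (2, 2) \<or> (x, y) = (4, 1) \<or> (x, y) = (3, 4)"
    using assms unfolding over_strand_def under_strand_def corner_def
    by (elim disjE conjE) simp_all
  moreover have "\<exists>k<4. x = cross_x k \<and> y = cross_y k" if "(x, y) = (1, 3) \<or> (x, y) = (2, 2) \<or> (x, y) = (4, 1) \<or> (x, y) = (3, 4)"
    using that unfolding less4_cases by (auto simp: cross_x_def cross_y_def)
  ultimately show ?thesis by blast
qed

text \<open>A point of the complement outside \<open>above_set\<close> and \<open>below_set\<close>
  lies strictly between an over-strand and an under-strand with the same projection. As it is not on
  a vertical edge, it is at one of the four crossings.\<close>

lemma polygon_cover: "- figure_eight_polygon = above_set \<union> below_set \<union> (\<Union>k<4. crossing_box k)"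
proof -
  have "(x, y, z) \<notin> figure_eight_polygon \<longleftrightarrow> (x, y, z) \<in> above_set \<or> (x, y, z) \<in> below_set \<or> (\<exists>k<4. (x, y, z) \<in> crossing_box k)"
    for x y z
  proof
    assume n: "(x, y, z) \<notin> figure_eight_polygon"
    show "(x, y, z) \<in> above_set \<or> (x, y, z) \<in> below_set \<or> (\<exists>k<4. (x, y, z) \<in> crossing_box k)"
    proof (rule ccontr)
      assume "\<not> ?thesis"
      then have a: "(x, y, z) \<notin> above_set" and b: "(x, y, z) \<notin> below_set" and c: "\<And>k. k < 4 \<Longrightarrow> (x, y, z) \<notin> crossing_box k"
        by auto
      have ou: "over_strand x y" "under_strand x y" "0 < z" "z < 1"
        using a b n unfolding above_set_def below_set_def figure_eight_polygon_iff by (simp, argo)+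
      then obtain k where "k < 4" "x = cross_x k" "y = cross_y k"
        using strands_meet n unfolding figure_eight_polygon_iff by force
      then show False using c[of k] ou by (simp add: crossing_box_def)
    qed
  next
    assume r: "(x, y, z) \<in> above_set \<or> (x, y, z) \<in> below_set \<or> (\<exists>k<4. (x, y, z) \<in> crossing_box k)"
    have "\<not> corner x y \<and> 0 < z \<and> z < 1" if "k < 4" "(x, y, z) \<in> crossing_box k" for k
      using that unfolding less4_cases
      by (elim disjE; hypsubst) (auto simp: corner_def crossing_box_def cross_x_def cross_y_def)
    with r have "(x, y, z) \<in> above_set \<or> (x, y, z) \<in> below_set \<or> \<not> corner x y \<and> 0 < z \<and> z < 1"
      by blast
    moreover have "corner x y \<Longrightarrow> over_strand x y \<and> under_strand x y"
      unfolding corner_def over_strand_def under_strand_def by (simp, argo)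
    ultimately show "(x, y, z) \<notin> figure_eight_polygon"
      unfolding figure_eight_polygon_iff above_set_def below_set_def mem_Collect_eq prod.case by argo
  qed
  then show ?thesis by auto
qed

lemma closed_strands:
  "closed {p :: R3. over_strand (fst p) (fst (snd p))}" "closed {p :: R3. under_strand (fst p) (fst (snd p))}"
  unfolding over_strand_def under_strand_def
  by (intro closed_Collect_disj closed_Collect_conj closed_Collect_eq closed_Collect_le continuous_intros)+

lemma open_above: "open above_set" and open_below: "open below_set"
proof -
  let ?O = "{p :: R3. over_strand (fst p) (fst (snd p))}" and ?U = "{p :: R3. under_strand (fst p) (fst (snd p))}"
  have cl: "closed {p :: R3. snd (snd p) \<le> a}" "closed {p :: R3. a \<le> snd (snd p)}" for a
    by (intro closed_Collect_le continuous_intros)+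
  have above: "above_set = - {p. snd (snd p) \<le> - 1} \<inter> - (?O \<inter> {p. snd (snd p) \<le> 1}) \<inter> - (?U \<inter> {p. snd (snd p) \<le> 0})"
    unfolding above_set_def by auto
  show "open above_set" unfolding above by (intro open_Int open_Compl closed_Int closed_strands cl)
  have below: "below_set = - {p. 2 \<le> snd (snd p)} \<inter> - (?O \<inter> {p. 1 \<le> snd (snd p)}) \<inter> - (?U \<inter> {p. 0 \<le> snd (snd p)})"
    unfolding below_set_def by auto
  show "open below_set" unfolding below by (intro open_Int open_Compl closed_Int closed_strands cl)
qed

text \<open>Two straight-line homotopies: translation by \<open>e\<close> into the convex set
  \<open>C\<close>, then contraction inside \<open>C\<close> to \<open>c\<close>.\<close>

lemma contractible_push:
  fixes S C :: "'a::real_normed_vector set"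
  assumes e: "\<And>p t. p \<in> S \<Longrightarrow> 0 \<le> t \<Longrightarrow> t \<le> 1 \<Longrightarrow> p + t *\<^sub>R e \<in> S" and C: "convex C" "C \<subseteq> S" "c \<in> C"
    and end_in: "\<And>p. p \<in> S \<Longrightarrow> p + e \<in> C"
  shows "contractible S"
proof -
  have "homotopic_with_canon (\<lambda>_. True) S S (\<lambda>p. p) (\<lambda>p. p + e)"
  proof (rule homotopic_with_linear)
    fix p assume p: "p \<in> S"
    show "closed_segment p (p + e) \<subseteq> S"
    proof
      fix q assume "q \<in> closed_segment p (p + e)"
      then obtain u where "0 \<le> u" "u \<le> 1" "q = (1 - u) *\<^sub>R p + u *\<^sub>R (p + e)"
        by (auto simp: closed_segment_def)
      then show "q \<in> S" using e[OF p, of u] by (simp add: algebra_simps)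
    qed
  qed (intro continuous_intros)+
  moreover have "homotopic_with_canon (\<lambda>_. True) S S (\<lambda>p. p + e) (\<lambda>_. c)"
  proof (rule homotopic_with_linear)
    show "closed_segment (p + e) c \<subseteq> S" if "p \<in> S" for p
      using closed_segment_subset[OF end_in[OF that] C(3,1)] C(2) by blast
  qed (intro continuous_intros)+
  ultimately show ?thesis
    unfolding contractible_def id_def by (blast intro: homotopic_with_trans)
qed

lemma simply_connected_above: "simply_connected above_set"
proof (rule contractible_imp_simply_connected, rule contractible_push)
  \<comment> \<open>A shift by 3 takes every point with \<open>z > -1\<close> above height 1, the
    top of the polygon.\<close>
  show "p + t *\<^sub>R (0, 0, 3) \<in> above_set" if "p \<in> above_set" "0 \<le> t" for p t
    using that by (cases p) (auto simp: above_set_def)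
  show "convex (UNIV \<times> UNIV \<times> {1<..} :: R3 set)" by (intro convex_Times convex_UNIV) auto
  show "(UNIV \<times> UNIV \<times> {1<..} :: R3 set) \<subseteq> above_set" by (auto simp: above_set_def)
  show "(0, 0, 2) \<in> (UNIV \<times> UNIV \<times> {1<..} :: R3 set)" by simp
  show "p + (0, 0, 3) \<in> (UNIV \<times> UNIV \<times> {1<..} :: R3 set)" if "p \<in> above_set" for p
    using that by (cases p) (auto simp: above_set_def)
qed

lemma simply_connected_below: "simply_connected below_set"
proof (rule contractible_imp_simply_connected, rule contractible_push)
  show "p + t *\<^sub>R (0, 0, - 3) \<in> below_set" if "p \<in> below_set" "0 \<le> t" for p t
    using that by (cases p) (auto simp: below_set_def)
  show "convex (UNIV \<times> UNIV \<times> {..<0} :: R3 set)" by (intro convex_Times convex_UNIV) auto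
  show "(UNIV \<times> UNIV \<times> {..<0} :: R3 set) \<subseteq> below_set" by (auto simp: below_set_def)
  show "(0, 0, - 1) \<in> (UNIV \<times> UNIV \<times> {..<0} :: R3 set)" by simp
  show "p + (0, 0, - 3) \<in> (UNIV \<times> UNIV \<times> {..<0} :: R3 set)" if "p \<in> below_set" for p
    using that by (cases p) (auto simp: below_set_def)
qed

lemma path_connected_prism: "path_connected (prism k)"
proof -
  have b: "path_connected (A \<times> B \<times> slab)" if "convex A" "convex B" for A B :: "real set"
    using that by (intro convex_imp_path_connected convex_Times) auto
  have un: "path_connected (S \<union> T)" if "path_connected S" "path_connected T" "p \<in> S \<inter> T" for S T and p :: R3
    using that path_connected_Un by blast
  have "path_connected ({0<..<4} \<times> {0<..<1} \<times> slab \<union> {0<..<2} \<times> {0<..<2} \<times> slab \<union> {0<..<1} \<times> {0<..<3} \<times> slab :: R3 set)"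
    by (intro un[of _ _ "(1/2, 1/2, 0)"] b) auto
  moreover have "path_connected ({1<..<2} \<times> {2<..<3} \<times> slab :: R3 set)"
    by (intro b) auto
  moreover have "path_connected ({1<..<3} \<times> {3<..<4} \<times> slab \<union> {2<..<3} \<times> {2<..<4} \<times> slab :: R3 set)"
    by (intro un[of _ _ "(5/2, 7/2, 0)"] b) auto
  moreover have "path_connected ({3<..<4} \<times> {1<..<4} \<times> slab \<union> {2<..<4} \<times> {1<..<2} \<times> slab :: R3 set)"
    by (intro un[of _ _ "(7/2, 3/2, 0)"] b) auto
  moreover have "path_connected ({3<..<5} \<times> {4<..<5} \<times> slab \<union> {4<..<5} \<times> {1<..<5} \<times> slab :: R3 set)"
    by (intro un[of _ _ "(9/2, 9/2, 0)"] b) auto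
  moreover have "path_connected ({..<0} \<times> UNIV \<times> slab \<union> UNIV \<times> {..<0} \<times> slab \<union> {5<..} \<times> UNIV \<times> slab \<union> UNIV \<times> {5<..} \<times> slab \<union>
       {4<..} \<times> {..<1} \<times> slab \<union> {..<3} \<times> {4<..} \<times> slab \<union> {..<1} \<times> {3<..} \<times> slab :: R3 set)"
    by (rule un[of _ _ "(0, 6, 0)"], rule un[of _ _ "(0, 6, 0)"], rule un[of _ _ "(6, 0, 0)"],
        rule un[of _ _ "(6, 6, 0)"], rule un[of _ _ "(6, - 1, 0)"], rule un[of _ _ "(- 1, - 1, 0)"])
      (auto intro!: b)
  ultimately show ?thesis
    unfolding prism_def by presburger
qed

lemma far_not_strand:
  assumes "(x, y, z) \<in> far" "\<bar>z\<bar> \<le> 2"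
  shows "\<not> over_strand x y" "\<not> under_strand x y"
proof -
  have "\<not> (0 \<le> x \<and> x \<le> 5 \<and> 0 \<le> y \<and> y \<le> 5)"
  proof
    assume "0 \<le> x \<and> x \<le> 5 \<and> 0 \<le> y \<and> y \<le> 5"
    then have "x^2 \<le> 5^2" "y^2 \<le> 5^2" "z^2 \<le> 2^2"
      using assms(2) by (intro power_mono abs_le_square_iff[THEN iffD1]; simp)+
    then show False using assms(1) by (simp add: far_def)
  qed
  then show "\<not> over_strand x y" "\<not> under_strand x y"
    using strands_bounded by blast+
qed

lemma far_halves: "above_set \<inter> far = {(x, y, z). - 1 < z} \<inter> far" "below_set \<inter> far = {(x, y, z). z < 2} \<inter> far"
proof -
  have *: "over_strand x y \<or> under_strand x y \<Longrightarrow> (x, y, z) \<in> far \<Longrightarrow> 2 < \<bar>z\<bar>" for x y z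
    using far_not_strand by force
  show "above_set \<inter> far = {(x, y, z). - 1 < z} \<inter> far" "below_set \<inter> far = {(x, y, z). z < 2} \<inter> far"
    unfolding above_set_def below_set_def using * by force+
qed

text \<open>Inside a half space, a far point is moved out horizontally until it can be lifted over the ball.\<close>

lemma path_connected_far:
  fixes s c :: real
  assumes s: "s = 1 \<or> s = - 1" and c: "-5 \<le> c" "c \<le> 0"
  shows "path_connected ({(x, y, z). c < s * z} \<inter> far)" (is "path_connected ?F")
proof -
  have seg: "path_component ?F p q" if "closed_segment p q \<subseteq> ?F" for p q
    using that unfolding path_component_def by (intro exI[of _ "linepath p q"]) auto
  have sq: "s * s = 1" using s by auto
  define C where "C = {(x :: real, y :: real, z :: real). 10 < s * z}"
  have "convex {z. 10 < s * z}"
    using convex_halfspace_gt[of 10 s] by simp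
  then have "convex (UNIV \<times> UNIV \<times> {z. 10 < s * z} :: R3 set)"
    by (intro convex_Times convex_UNIV)
  moreover have "C = UNIV \<times> UNIV \<times> {z. 10 < s * z}" by (auto simp: C_def)
  ultimately have "convex C" by simp
  have C: "C \<subseteq> ?F"
  proof
    fix p assume "p \<in> C"
    then obtain x y z where p: "p = (x, y, z)" "10 < s * z" by (auto simp: C_def)
    have "10^2 < (s * z)^2" using p(2) by (intro power_strict_mono) auto
    moreover have "(s * z)^2 = z^2" using s by auto
    ultimately have "100 < z^2" by simp
    then have "100 < x^2 + y^2 + z^2"
      using zero_le_power2[of x] zero_le_power2[of y] by linarith
    then show "p \<in> ?F" using p c by (simp add: far_def)
  qed
  have out: "\<exists>q\<in>C. path_component ?F p q" if p: "p \<in> ?F" for p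
  proof -
    obtain x y z where xyz: "p = (x, y, z)" by (metis prod_cases3)
    have cz: "c < s * z" and f: "100 < x^2 + y^2 + z^2" using p by (auto simp: xyz far_def)
    \<comment> \<open>A vertical lift could enter the ball when \<open>s * z < 0\<close>. But then
      \<open>z^2 \<le> 25\<close>, hence \<open>x^2 + y^2 > 75\<close>, and after doubling
      \<open>x\<close> and \<open>y\<close> the whole column avoids the ball. From
      \<open>s * z > c \<ge> -5\<close>, a lift by 16 passes beyond 10 and so into
      \<open>C\<close>.\<close>
    define w where "w = z + s * 16"
    have "path_component ?F (x, y, z) (2 * x, 2 * y, z)"
    proof (rule seg, rule subsetI)
      fix q assume "q \<in> closed_segment (x, y, z) (2 * x, 2 * y, z)"
      then obtain t where t: "0 \<le> t" "t \<le> 1" "q = (1 - t) *\<^sub>R (x, y, z) + t *\<^sub>R (2 * x, 2 * y, z)"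
        by (auto simp: closed_segment_def)
      have q: "q = ((1 + t) * x, (1 + t) * y, z)" by (simp add: t(3) algebra_simps)
      have "1 * (x^2 + y^2) \<le> (1 + t)^2 * (x^2 + y^2)" using t(1) by (intro mult_right_mono) (auto simp: one_le_power)
      then have "x^2 + y^2 + z^2 \<le> ((1 + t) * x)^2 + ((1 + t) * y)^2 + z^2" by (simp add: power_mult_distrib distrib_left)
      then show "q \<in> ?F" using cz f by (simp add: q far_def)
    qed
    moreover have "path_component ?F (2 * x, 2 * y, z) (2 * x, 2 * y, w)"
    proof (rule seg, rule subsetI)
      fix q assume "q \<in> closed_segment (2 * x, 2 * y, z) (2 * x, 2 * y, w)"
      then obtain t where t: "0 \<le> t" "t \<le> 1" "q = (1 - t) *\<^sub>R (2 * x, 2 * y, z) + t *\<^sub>R (2 * x, 2 * y, w)"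
        by (auto simp: closed_segment_def)
      define v where "v = z + t * (s * 16)"
      have q: "q = (2 * x, 2 * y, v)" by (simp add: t(3) w_def v_def algebra_simps)
      have sv: "s * v = s * z + t * 16" using sq by (simp add: v_def algebra_simps)
      have v2: "v^2 = (s * v)^2" and z2: "z^2 = (s * z)^2" using s by auto
      have four: "(2 * x)^2 = 4 * x^2" "(2 * y)^2 = 4 * y^2" by (simp_all add: power_mult_distrib)
      have "100 < (2 * x)^2 + (2 * y)^2 + v^2"
      proof (cases "0 \<le> s * z")
        case True
        then have "z^2 \<le> v^2" unfolding v2 z2 sv using t(1) by (intro power_mono) auto
        then show ?thesis using f four zero_le_power2[of x] zero_le_power2[of y] by linarith
      next
        case False
        then have "(s * z)^2 \<le> 5^2" using cz c by (intro abs_le_square_iff[THEN iffD1]) simp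
        then have "75 < x^2 + y^2" using f z2 by simp
        then show ?thesis using four zero_le_power2[of v] by linarith
      qed
      then show "q \<in> ?F" using cz t(1) by (simp add: q far_def sv)
    qed
    moreover have "(2 * x, 2 * y, w) \<in> C"
      using cz c sq by (simp add: C_def w_def algebra_simps)
    ultimately show ?thesis unfolding xyz using path_component_trans by blast
  qed
  show ?thesis
    unfolding path_connected_component
  proof (intro ballI)
    fix p q assume "p \<in> ?F" "q \<in> ?F"
    then obtain p' q' where "p' \<in> C" "q' \<in> C" "path_component ?F p p'" "path_component ?F q q'"
      using out by meson
    moreover have "path_component ?F p' q'"
      using seg closed_segment_subset[OF \<open>p' \<in> C\<close> \<open>q' \<in> C\<close> \<open>convex C\<close>] C by (meson order_trans)
    ultimately show "path_component ?F p q"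
      using path_component_trans path_component_sym by meson
  qed
qed

lemma path_connected_far_halves: "path_connected (above_set \<inter> far)" "path_connected (below_set \<inter> far)"
proof -
  have "{(x, y, z). - 1 < z} = {(x :: real, y :: real, z :: real). - 1 < 1 * z}"
    "{(x, y, z). z < 2} = {(x :: real, y :: real, z :: real). - 2 < - 1 * z}"
    by auto
  then show "path_connected (above_set \<inter> far)" "path_connected (below_set \<inter> far)"
    unfolding far_halves using path_connected_far[of 1 "- 1"] path_connected_far[of "- 1" "- 2"] by simp_all
qed

lemma far_middle: "above_set \<inter> below_set \<inter> far \<subseteq> prism 0"
proof
  fix p assume p: "p \<in> above_set \<inter> below_set \<inter> far"
  obtain x y z where xyz: "p = (x, y, z)" by (metis prod_cases3)
  have z: "- 1 < z" "z < 2" using p by (auto simp: xyz above_set_def below_set_def)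
  then have "z^2 \<le> 2^2" by (intro abs_le_square_iff[THEN iffD1]) auto
  moreover have "x^2 \<le> 5^2" if "0 \<le> x" "x \<le> 5" using that by (intro power_mono) auto
  moreover have "y^2 \<le> 5^2" if "0 \<le> y" "y \<le> 5" using that by (intro power_mono) auto
  moreover have "100 < x^2 + y^2 + z^2" using p by (simp add: xyz far_def)
  ultimately have "\<not> (0 \<le> x \<and> x \<le> 5 \<and> 0 \<le> y \<and> y \<le> 5)" by (intro notI) simp
  then show "p \<in> prism 0" using z by (auto simp: xyz prism_def)
qed

lemma far_middle_ne: "(20, 0, 0) \<in> above_set \<inter> below_set \<inter> far"
  by (auto simp: above_set_def below_set_def far_def over_strand_def under_strand_def)

lemma far_box: "k < 4 \<Longrightarrow> far \<inter> crossing_box k = {}"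
proof (rule equals0I)
  fix p assume k: "k < 4" and p: "p \<in> far \<inter> crossing_box k"
  obtain x y z where xyz: "p = (x, y, z)" by (metis prod_cases3)
  have "0 \<le> cross_x k - 1/2" "cross_x k + 1/2 \<le> 5" "0 \<le> cross_y k - 1/2" "cross_y k + 1/2 \<le> 5"
    using k unfolding less4_cases by (auto simp: cross_x_def cross_y_def)
  then have "0 \<le> x" "x \<le> 5" "0 \<le> y" "y \<le> 5" "0 \<le> z" "z \<le> 1"
    using p by (auto simp: xyz crossing_box_def)
  then have "x^2 \<le> 5^2" "y^2 \<le> 5^2" "z^2 \<le> 1^2" by (intro power_mono; simp)+
  then show False using p by (simp add: xyz far_def)
qed

section \<open>Stereographic projection and transfer to the sphere\<close>

lemma mem_S3: "p \<in> S3 \<longleftrightarrow> fst p \<bullet> fst p + (snd p)^2 = 1"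
  by (cases p) (simp add: S3_def norm_eq_1 power2_eq_square)

definition stereographic :: "R4 \<Rightarrow> R3"
  where "stereographic p = (1 / (1 - snd p)) *\<^sub>R fst p"

lemma homeomorphism_stereographic:
  "homeomorphism UNIV (S3 - {(0, 1)}) inv_stereographic stereographic"
proof (rule homeomorphismI)
  have pos: "x \<bullet> x + 1 \<noteq> 0" for x :: R3
    using inner_ge_zero[of x] by linarith
  have ne: "snd p \<noteq> 1" if "p \<in> S3 - {(0, 1)}" for p
  proof
    assume 1: "snd p = 1"
    then have "fst p \<bullet> fst p = 0" using that by (simp add: mem_S3 del: inner_eq_zero_iff)
    then have "fst p = 0" by (simp only: inner_eq_zero_iff)
    then show False using 1 that by (simp add: prod_eq_iff)
  qed
  show "continuous_on UNIV inv_stereographic"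
    unfolding inv_stereographic_def by (intro continuous_intros) (auto simp: pos)
  show "continuous_on (S3 - {(0, 1)}) stereographic"
    unfolding stereographic_def by (intro continuous_intros) (use ne in auto)
  show "inv_stereographic ` UNIV \<subseteq> S3 - {(0, 1)}"
  proof (rule image_subsetI)
    fix x :: R3
    have "(2 / (x \<bullet> x + 1))^2 * (x \<bullet> x) + ((x \<bullet> x - 1) / (x \<bullet> x + 1))^2 = (4 * (x \<bullet> x) + (x \<bullet> x - 1)^2) / (x \<bullet> x + 1)^2"
      by (simp add: power_divide add_divide_distrib)
    also have "4 * (x \<bullet> x) + (x \<bullet> x - 1)^2 = (x \<bullet> x + 1)^2"
      by (simp add: power2_eq_square algebra_simps)
    also have "(x \<bullet> x + 1)^2 / (x \<bullet> x + 1)^2 = 1" using pos[of x] by simp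
    finally show "inv_stereographic x \<in> S3 - {(0, 1)}"
      using pos[of x] by (simp add: mem_S3 inv_stereographic_def power2_eq_square divide_eq_1_iff)
  qed
  show "stereographic ` (S3 - {(0, 1)}) \<subseteq> UNIV" by simp
  show "stereographic (inv_stereographic x) = x" for x
  proof -
    define c where "c = 2 / (x \<bullet> x + 1)"
    have c: "c \<noteq> 0" "1 - (x \<bullet> x - 1) / (x \<bullet> x + 1) = c"
      using pos[of x] by (simp_all add: c_def divide_simps)
    have "stereographic (inv_stereographic x) = (1 / c) *\<^sub>R (c *\<^sub>R x)"
      by (simp only: stereographic_def inv_stereographic_def fst_conv snd_conv c c_def[symmetric])
    then show ?thesis using c(1) by simp
  qed
  show "inv_stereographic (stereographic p) = p" if p: "p \<in> S3 - {(0, 1)}" for p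
  proof -
    obtain x w where xw: "p = (x, w)" by (cases p)
    have w: "1 - w \<noteq> 0" using ne[OF p] xw by simp
    have "x \<bullet> x = (1 - w) * (1 + w)" using p by (simp add: mem_S3 xw power2_eq_square algebra_simps)
    then have n: "stereographic p \<bullet> stereographic p = (1 + w) / (1 - w)"
      using w by (simp add: stereographic_def xw)
    have "(1 + w) / (1 - w) + 1 = 2 / (1 - w)" "(1 + w) / (1 - w) - 1 = 2 * w / (1 - w)"
      using w by (simp_all add: divide_simps)
    then show ?thesis
      unfolding inv_stereographic_def n using w by (simp add: stereographic_def xw)
  qed
qed

text \<open>The height \<open>99/101 = (100 - 1) / (100 + 1)\<close> is that of the image of the
  sphere of radius 10, so \<open>cap\<close> is the image of \<open>far\<close> together with the
  north pole.\<close>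

definition cap :: "R4 set"
  where "cap = {p \<in> S3. 99/101 < snd p}"

lemma inv_stereographic_cap: "inv_stereographic x \<in> cap \<longleftrightarrow> x \<in> far"
proof -
  have S: "inv_stereographic x \<in> S3"
    using homeomorphism_image1[OF homeomorphism_stereographic] by blast
  have pos: "0 < x \<bullet> x + 1" using inner_ge_zero[of x] by linarith
  have "99/101 < (x \<bullet> x - 1) / (x \<bullet> x + 1) \<longleftrightarrow> 100 < x \<bullet> x"
    using pos by (simp only: pos_less_divide_eq) argo
  then show ?thesis
    using S by (cases x) (simp add: cap_def inv_stereographic_def far_def power2_eq_square add.assoc)
qed

lemma openin_cap: "openin (top_of_set S3) cap"
proof -
  have "open {p :: R4. 99/101 < snd p}" by (intro open_Collect_less continuous_intros)
  moreover have "cap = S3 \<inter> {p. 99/101 < snd p}" by (auto simp: cap_def)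
  ultimately show ?thesis by (metis openin_open_Int)
qed

text \<open>Being part of the upper hemisphere, the cap is the graph of a function over a
  ball.\<close>

lemma simply_connected_cap: "simply_connected cap"
proof -
  define r where "r = sqrt (1 - (99/101)^2)"
  have r2: "x \<in> ball 0 r \<longleftrightarrow> x \<bullet> x < 1 - (99/101)^2" for x :: R3
    by (simp add: r_def norm_eq_sqrt_inner)
  have "homeomorphism (ball 0 r) cap (\<lambda>x. (x, sqrt (1 - x \<bullet> x))) fst"
  proof (rule homeomorphismI)
    show "continuous_on (ball 0 r) (\<lambda>x :: R3. (x, sqrt (1 - x \<bullet> x)))"
      by (intro continuous_intros)
    show "continuous_on cap fst" by (intro continuous_intros)
    show "(\<lambda>x. (x, sqrt (1 - x \<bullet> x))) ` ball 0 r \<subseteq> cap"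
    proof (rule image_subsetI)
      fix x :: R3 assume "x \<in> ball 0 r"
      then have x: "(99/101)^2 < 1 - x \<bullet> x" unfolding r2 by linarith
      moreover have "0 \<le> 1 - x \<bullet> x" using x by (simp add: power2_eq_square)
      ultimately show "(x, sqrt (1 - x \<bullet> x)) \<in> cap"
        using real_less_rsqrt[OF x] by (simp add: cap_def mem_S3)
    qed
    show "fst ` cap \<subseteq> ball 0 r"
    proof (rule image_subsetI)
      fix p assume p: "p \<in> cap"
      then have "(99/101)^2 < (snd p)^2" by (intro power_strict_mono) (auto simp: cap_def)
      then show "fst p \<in> ball 0 r" using p unfolding r2 by (simp add: cap_def mem_S3)
    qed
    show "(fst p, sqrt (1 - fst p \<bullet> fst p)) = p" if p: "p \<in> cap" for p
    proof -
      have "1 - fst p \<bullet> fst p = (snd p)^2" "0 \<le> snd p" using p by (auto simp: cap_def mem_S3)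
      then show ?thesis by (simp add: prod_eq_iff)
    qed
  qed simp
  then show ?thesis
    using homeomorphic_simply_connected convex_imp_simply_connected convex_ball
    unfolding homeomorphic_def by blast
qed

lemma far_polygon: "far \<inter> figure_eight_polygon = {}"
proof (rule equals0I)
  fix p assume p: "p \<in> far \<inter> figure_eight_polygon"
  obtain x y z where xyz: "p = (x, y, z)" by (metis prod_cases3)
  have "corner x y \<Longrightarrow> over_strand x y"
    unfolding corner_def over_strand_def by (simp, argo)
  then have "over_strand x y \<or> under_strand x y" "\<bar>z\<bar> \<le> 2"
    using p by (auto simp: xyz figure_eight_polygon_iff)
  then show False using far_not_strand p xyz by blast
qed

text \<open>The Euclidean pieces are carried over by \<open>h \<circ> inv_stereographic\<close>. The
  chart at infinity contains the north pole, which this map misses, so it is the image of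
  \<open>cap\<close> under \<open>h\<close> itself.\<close>

lemma fig8_space_complement:
  assumes h: "homeomorphism S3 S3 h g" and K: "h ` inv_stereographic ` figure_eight_polygon = K"
  shows "\<exists>U P West East South North. fig8_space (S3 - K) U P West East South North"
proof -
  let ?\<iota> = inv_stereographic and ?N = "(0, 1) :: R4"
  define H where "H = h \<circ> ?\<iota>"
  define U where "U = case_region (H ` above_set) (H ` below_set) (h ` cap) (\<lambda>k. H ` crossing_box k)"
  have U: "U Above = H ` above_set" "U Below = H ` below_set" "U Outer = h ` cap" "U (Crossing k) = H ` crossing_box k" for k
    by (simp_all add: U_def)
  have inj_h: "inj_on h S3" by (rule inj_on_inverseI) (rule homeomorphism_apply1[OF h])
  have range: "range ?\<iota> = S3 - {?N}"
    by (rule homeomorphism_image1[OF homeomorphism_stereographic])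
  have N: "?N \<in> S3" "?N \<in> cap" by (simp_all add: mem_S3 cap_def)
  have hS: "h ` S3 = S3" by (rule homeomorphism_image1[OF h])
  have cap_S3: "cap \<subseteq> S3" by (auto simp: cap_def)
  have H: "homeomorphism UNIV (h ` (S3 - {?N})) H (stereographic \<circ> g)"
    unfolding H_def by (rule homeomorphism_compose[OF homeomorphism_stereographic])
      (rule homeomorphism_of_subsets[OF h], use hS in auto)
  have inj_H: "inj H" by (rule inj_on_inverseI) (rule homeomorphism_apply1[OF H])
  have H_Int: "H ` A \<inter> H ` B = H ` (A \<inter> B)" for A B by (rule image_Int[OF inj_H, symmetric])
  have H_empty: "H ` A \<inter> H ` B = {}" if "A \<inter> B = {}" for A B using that by (simp add: H_Int)
  have H_cap: "H ` A \<inter> h ` cap = H ` (A \<inter> far)" for A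
  proof -
    have "H ` A \<inter> h ` cap = h ` (?\<iota> ` A \<inter> cap)"
      unfolding H_def image_comp[symmetric] using range cap_S3
      by (intro inj_on_image_Int[OF inj_h, symmetric]) auto
    also have "?\<iota> ` A \<inter> cap = ?\<iota> ` (A \<inter> far)" using inv_stereographic_cap by auto
    finally show ?thesis by (simp add: H_def image_comp)
  qed
  have K': "K = H ` figure_eight_polygon" using K by (simp add: H_def image_comp)
  have in_M: "H ` A \<subseteq> S3 - K" if "A \<subseteq> - figure_eight_polygon" for A
  proof -
    have "H ` A \<subseteq> S3" using homeomorphism_image1[OF H] hS by blast
    moreover have "H ` A \<inter> K = {}" unfolding K' using that by (intro H_empty) blast
    ultimately show ?thesis by blast
  qed
  have cap_M: "h ` cap \<subseteq> S3 - K"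
  proof -
    have "K \<inter> h ` cap = {}" unfolding K' H_cap using far_polygon by (simp add: Int_commute)
    then show ?thesis using cap_S3 hS by blast
  qed
  have M: "S3 - K = H ` (- figure_eight_polygon) \<union> h ` cap"
  proof
    show "S3 - K \<subseteq> H ` (- figure_eight_polygon) \<union> h ` cap"
    proof
      fix q assume q: "q \<in> S3 - K"
      then obtain p where p: "p \<in> S3" "q = h p" using hS by blast
      show "q \<in> H ` (- figure_eight_polygon) \<union> h ` cap"
      proof (cases "p = ?N")
        case True then show ?thesis using N p by blast
      next
        case False
        then obtain x where "p = ?\<iota> x" using p range by blast
        then have "q = H x" using p by (simp add: H_def)
        then show ?thesis using q K' by blast
      qed
    qed
  qed (use in_M cap_M in auto)
  have open_S3: "openin (top_of_set S3) (H ` A)" if "open A" for A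
  proof -
    have "openin (top_of_set (h ` (S3 - {?N}))) (H ` A)"
      using homeomorphism_imp_open_map[OF H] that by simp
    moreover have "openin (top_of_set S3) (h ` (S3 - {?N}))"
      using homeomorphism_imp_open_map[OF h] by (simp add: openin_delete)
    ultimately show ?thesis using openin_trans by blast
  qed
  have open_M: "openin (top_of_set (S3 - K)) (H ` A)" if "open A" "A \<subseteq> - figure_eight_polygon" for A
    using openin_subset_trans[OF open_S3[OF that(1)] in_M[OF that(2)]] by blast
  have open_cap: "openin (top_of_set (S3 - K)) (h ` cap)"
    using openin_subset_trans[OF homeomorphism_imp_open_map[OF h openin_cap] cap_M] by blast
  have sub: "above_set \<subseteq> - figure_eight_polygon" "below_set \<subseteq> - figure_eight_polygon"
    "k < 4 \<Longrightarrow> crossing_box k \<subseteq> - figure_eight_polygon" for k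
    unfolding polygon_cover by auto
  have sub_prism: "prism k \<subseteq> - figure_eight_polygon" if "k < 6" for k
    using above_below sub(1) that by blast
  have sub_box: "west_box k \<subseteq> - figure_eight_polygon" "east_box k \<subseteq> - figure_eight_polygon"
    "south_box k \<subseteq> - figure_eight_polygon" "north_box k \<subseteq> - figure_eight_polygon" if "k < 4" for k
    using box_split[OF that] sub(3)[OF that] by blast+
  have simply: "simply_connected (H ` A)" if "simply_connected A" for A
    using homeomorphism_of_subsets[OF H, of A "H ` A" "H ` A"] homeomorphism_image1[OF H] that
      homeomorphic_simply_connected unfolding homeomorphic_def by blast
  have path: "path_connected (H ` A)" if "path_connected A" for A
    using path_connected_continuous_image[OF continuous_on_subset[OF homeomorphism_cont1[OF H]] that] by simp
  have simply_cap: "simply_connected (h ` cap)"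
    using homeomorphism_of_subsets[OF h cap_S3, of "h ` cap" "h ` cap"] hS cap_S3 simply_connected_cap
      homeomorphic_simply_connected unfolding homeomorphic_def by blast
  have "fig8_space (S3 - K) U (\<lambda>k. H ` prism k) (\<lambda>k. H ` west_box k) (\<lambda>k. H ` east_box k)
    (\<lambda>k. H ` south_box k) (\<lambda>k. H ` north_box k)"
  proof
    show "openin (top_of_set (S3 - K)) (U i)" if "i \<in> regions" for i
      using that by (auto simp: U open_cap intro!: open_M open_above open_below open_boxes sub)
    show "S3 - K = (\<Union>i\<in>regions. U i)"
      unfolding M polygon_cover by (auto simp: U)
    show "simply_connected (U i)" if "i \<in> regions" for i
      using that simply_cap simply[OF simply_connected_above] simply[OF simply_connected_below]
        simply[OF convex_imp_simply_connected[OF convex_boxes(1)]]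
      by (auto simp: U)
    show "U Above \<inter> U Below = (\<Union>k<6. H ` prism k)"
      by (simp add: U H_Int above_below image_UN)
    show "openin (top_of_set (S3 - K)) (H ` prism k)" if "k < 6" for k
      by (intro open_M open_prism sub_prism that)
    show "path_connected (H ` prism k)" for k
      by (intro path path_connected_prism)
    show "H ` prism k \<noteq> {}" if "k < 6" for k
      using prism_ne[OF that] by simp
    show "H ` prism k \<inter> H ` prism l = {}" if "k < 6" "l < 6" "k \<noteq> l" for k l
      by (intro H_empty prism_disjoint that)
    show "path_connected (U Above \<inter> U Outer)" "path_connected (U Below \<inter> U Outer)"
      unfolding U H_cap by (intro path path_connected_far_halves)+
    show "U Above \<inter> U Below \<inter> U Outer \<subseteq> H ` prism 0" "U Above \<inter> U Below \<inter> U Outer \<noteq> {}"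
      unfolding U H_Int H_cap using far_middle far_middle_ne by blast+
    show "U Outer \<inter> U (Crossing k) = {}" if "k < 4" for k
      unfolding U using H_cap[of "crossing_box k"] far_box[OF that] by (simp add: Int_commute)
    show "U (Crossing k) \<inter> U (Crossing l) = {}" if "k < 4" "l < 4" "k \<noteq> l" for k l
      unfolding U by (intro H_empty boxes_disjoint that)
    show "U Above \<inter> U (Crossing k) = H ` west_box k \<union> H ` east_box k"
      "U Below \<inter> U (Crossing k) = H ` south_box k \<union> H ` north_box k" if "k < 4" for k
      unfolding U H_Int box_split[OF that] by (rule image_Un)+
    show "H ` west_box k \<inter> H ` east_box k = {}" "H ` south_box k \<inter> H ` north_box k = {}" for k
      by (intro H_empty box_disjoint)+
    show "openin (top_of_set (S3 - K)) Q" "path_connected Q"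
      if "k < 4" "Q \<in> {H ` west_box k, H ` east_box k, H ` south_box k, H ` north_box k}" for k Q
      using that path[OF convex_imp_path_connected] convex_boxes
      by (auto intro!: open_M open_boxes sub_box)
    show "H ` west_box k \<inter> H ` south_box k \<subseteq> H ` prism (sw k)" "H ` east_box k \<inter> H ` south_box k \<subseteq> H ` prism (se k)"
      "H ` east_box k \<inter> H ` north_box k \<subseteq> H ` prism (ne k)" "H ` west_box k \<inter> H ` north_box k \<subseteq> H ` prism (nw k)"
      if "k < 4" for k
      unfolding H_Int by (intro image_mono box_corners that)+
    show "H ` west_box k \<inter> H ` south_box k \<noteq> {}" "H ` east_box k \<inter> H ` south_box k \<noteq> {}"
      "H ` east_box k \<inter> H ` north_box k \<noteq> {}" "H ` west_box k \<inter> H ` north_box k \<noteq> {}" for k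
      unfolding H_Int using box_corners_ne by simp_all
  qed
  then show ?thesis by blast
qed

theorem corollary1p3:
  fixes K :: "R4 set"
  assumes "figure_eight_knot K"
  shows "\<exists>(Y :: (R4 \<times> nat) topology) p.
    covering_of_degree 20 Y (top_of_set (S3 - K)) p \<and>
    special_cover Y (top_of_set (S3 - K)) p"
proof -
  obtain H :: "real \<times> R4 \<Rightarrow> R4" where H: "\<forall>t\<in>{0..1}. \<exists>g. homeomorphism S3 S3 (\<lambda>x. H (t, x)) g"
    "(\<lambda>x. H (1, x)) ` inv_stereographic ` figure_eight_polygon = K"
    using assms unfolding figure_eight_knot_def ambient_isotopic_S3_def by blast
  \<comment> \<open>The final homeomorphism of the isotopy carries the complement of the standard
    polygon to that of \<open>K\<close>.\<close>
  obtain g where "homeomorphism S3 S3 (\<lambda>x. H (1, x)) g" using H(1) by fastforce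
  then obtain U P West East South North where "fig8_space (S3 - K) U P West East South North"
    using fig8_space_complement H(2) by blast
  then interpret fig8_space "S3 - K" U P West East South North .
  show ?thesis using special_cover_exists by blast
qed

end
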